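(* Let $g_1, \dots, g_s \in \mathbb{R}[\bar X] = \mathbb{R}[X_1,\dots,X_n]$ be such that $$\emptyset \ne S = \{\bar x \in \mathbb{R}^n \mid g_1(\bar x)\ge 0, \dots, g_s(\bar x) \ge 0\} \subset (-1,1)^n$$ and the quadratic module $M(g_1,\dots,g_s)\subset \mathbb{R}[\bar X]$ is archimedean. Then there exists a constant $c>0$ such that for every $r\in\mathbb{N}$ and every $f \in \mathbb{R}[\bar X, \bar Y]$, $\bar Y=(Y_1,\dots,Y_r)$, positive on $S \times \mathbb{R}^r$ with $\deg_{\bar X} f = d$, $\deg_{\bar Y} f = 2$, $f$ satisfying condition $(\dagger)$ on $S$, and $$\min\{\bar f(\bar x, \bar y, z) \mid \bar x \in S,\ (\bar y,z) \in C^r\} = f^{\bullet} > 0,$$ $f$ can be written as $f = \sigma_0 + \sigma_1 g_1 + \dots + \sigma_s g_s$ with $\sigma_0,\dots,\sigma_s \in \sum \mathbb{R}[\bar X, \bar Y]^2$ and $$\deg(\sigma_0), \deg(\sigma_1 g_1), \dots, \deg(\sigma_s g_s) \le c\, r^2\, \mathrm{e}^{\left(\frac{\|f\|_\bullet r^2 d^2 (3n)^d}{f^\bullet}\right)^c}.$$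
   Context: Notation: $\bar X = (X_1,\dots,X_n)$, $\bar Y = (Y_1,\dots,Y_r)$. $\sum A^2$ denotes the set of finite sums of squares of elements of a ring $A$. The quadratic module generated by $g_1,\dots,g_s$ in $\mathbb{R}[\bar X]$ is $M(g_1,\dots,g_s)=\{\sigma_0+\sigma_1g_1+\dots+\sigma_sg_s \mid \sigma_i \in \sum\mathbb{R}[\bar X]^2\}$; it is archimedean if for some $N\in\mathbb{N}$, $N - (X_1^2+\dots+X_n^2) \in M(g_1,\dots,g_s)$. $C^r = \{(\bar y, z)\in\mathbb{R}^{r+1} \mid y_1^2+\dots+y_r^2+z^2 = 1\}$. For even $m$ and $f = \sum_{\beta\in\mathbb{N}_0^r, |\beta|\le m} f_\beta(\bar X)\bar Y^\beta \in \mathbb{R}[\bar X,\bar Y]$ with $\deg_{\bar Y} f = m$, its homogenization with respect to $\bar Y$ only is $\bar f = \sum_{|\beta|\le m} f_\beta(\bar X)\bar Y^\beta Z^{m-|\beta|}$. Condition $(\dagger)$ on $S$: for every $\bar x\in S$, the form $\sum_{|\beta| = m} f_\beta(\bar x)\bar Y^\beta$ is a positive definite $m$-form on $\mathbb{R}^r$. The norm $\|\cdot\|_\bullet$: writing $f = \sum_{|\beta|\le m}\sum_{\alpha\in\mathbb{N}_0^n, |\alpha|\le d}\binom{|\alpha|}{\alpha} a_{\alpha,\beta}\bar X^\alpha \bar Y^\beta$, where $|\alpha|=\alpha_1+\dots+\alpha_n$ and $\binom{|\alpha|}{\alpha} = \frac{|\alpha|!}{\alpha_1!\cdots\alpha_n!}$,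 set $\|f\|_\bullet = \max |a_{\alpha,\beta}|$. Here $m = 2$. *)

theory Defs
  imports "HOL-Analysis.Analysis" "HOL-Library.Poly_Mapping"
begin

text \<open>Multivariate real polynomials in countably many variables indexed by nat:
  a polynomial is a finitely supported map from monomials (exponent vectors,
  themselves finitely supported maps nat to nat) to real coefficients.
  Convention: X_1..X_n are variables 0..n-1, Y_1..Y_r are variables n..n+r-1,
  and the homogenizing variable Z is variable n+r.\<close>

type_synonym mpoly = "(nat \<Rightarrow>\<^sub>0 nat) \<Rightarrow>\<^sub>0 real"

definition mvar :: "nat \<Rightarrow> mpoly" where
  "mvar i = Poly_Mapping.single (Poly_Mapping.single i 1) 1"

definition mconst :: "real \<Rightarrow> mpoly" where
  "mconst c = Poly_Mapping.single 0 c"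

definition mmonom :: "(nat \<Rightarrow>\<^sub>0 nat) \<Rightarrow> real \<Rightarrow> mpoly" where
  "mmonom mo c = Poly_Mapping.single mo c"

definition meval :: "mpoly \<Rightarrow> (nat \<Rightarrow> real) \<Rightarrow> real" where
  "meval p x = (\<Sum>mo\<in>Poly_Mapping.keys p. Poly_Mapping.lookup p mo * (\<Prod>i\<in>Poly_Mapping.keys (mo::nat \<Rightarrow>\<^sub>0 nat). x i ^ Poly_Mapping.lookup mo i))"

definition mvars :: "mpoly \<Rightarrow> nat set" where
  "mvars p = \<Union> (Poly_Mapping.keys ` Poly_Mapping.keys p)"

definition mon_deg_in :: "nat set \<Rightarrow> (nat \<Rightarrow>\<^sub>0 nat) \<Rightarrow> nat" where
  "mon_deg_in V mo = (\<Sum>i\<in>Poly_Mapping.keys mo \<inter> V. Poly_Mapping.lookup mo i)"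

definition deg_in :: "nat set \<Rightarrow> mpoly \<Rightarrow> nat" where
  "deg_in V p = Max (insert 0 (mon_deg_in V ` Poly_Mapping.keys p))"

definition mdeg :: "mpoly \<Rightarrow> nat" where
  "mdeg p = deg_in UNIV p"

definition sos_in :: "nat set \<Rightarrow> mpoly \<Rightarrow> bool" where
  "sos_in V p \<longleftrightarrow> (\<exists>qs. (\<forall>q\<in>set qs. mvars q \<subseteq> V) \<and> p = sum_list (map (\<lambda>q. q * q) qs))"

definition qmodule :: "nat set \<Rightarrow> mpoly list \<Rightarrow> mpoly set" where
  "qmodule V gs = {p. \<exists>\<sigma>0 \<sigma>s. length \<sigma>s = length gs \<and> sos_in V \<sigma>0 \<and>
      (\<forall>\<sigma>\<in>set \<sigma>s. sos_in V \<sigma>) \<and>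
      p = \<sigma>0 + sum_list (map (\<lambda>(\<sigma>, g). \<sigma> * g) (zip \<sigma>s gs))}"

definition archimedean_qm :: "nat \<Rightarrow> mpoly list \<Rightarrow> bool" where
  "archimedean_qm n gs \<longleftrightarrow>
     (\<exists>N::nat. mconst (real N) - (\<Sum>i<n. mvar i * mvar i) \<in> qmodule {..<n} gs)"

text \<open>basic closed semialgebraic set, as a predicate on points (only the
  coordinates 0..n-1 matter when the g_j only involve X)\<close>
definition inS :: "mpoly list \<Rightarrow> (nat \<Rightarrow> real) \<Rightarrow> bool" where
  "inS gs x \<longleftrightarrow> (\<forall>g\<in>set gs. meval g x \<ge> 0)"

definition Yvars :: "nat \<Rightarrow> nat \<Rightarrow> nat set" where
  "Yvars n r = {n..<n+r}"

definition topY :: "nat \<Rightarrow> nat \<Rightarrow> nat \<Rightarrow> mpoly \<Rightarrow> mpoly" where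
  "topY n r m f = (\<Sum>mo\<in>{mo\<in>Poly_Mapping.keys f. mon_deg_in (Yvars n r) mo = m}. mmonom mo (Poly_Mapping.lookup f mo))"

definition homY :: "nat \<Rightarrow> nat \<Rightarrow> nat \<Rightarrow> mpoly \<Rightarrow> mpoly" where
  "homY n r m f = (\<Sum>mo\<in>Poly_Mapping.keys f. mmonom mo (Poly_Mapping.lookup f mo) * mvar (n + r) ^ (m - mon_deg_in (Yvars n r) mo))"

definition xmultinom :: "nat \<Rightarrow> (nat \<Rightarrow>\<^sub>0 nat) \<Rightarrow> real" where
  "xmultinom n mo = fact (\<Sum>i<n. Poly_Mapping.lookup mo i) / (\<Prod>i<n. fact (Poly_Mapping.lookup mo i))"

text \<open>the norm ||f||_bullet = max |a_{alpha,beta}| where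
  coeff of X^alpha Y^beta = multinomial(alpha) * a_{alpha,beta}\<close>
definition bnorm :: "nat \<Rightarrow> mpoly \<Rightarrow> real" where
  "bnorm n f = Max (insert 0 ((\<lambda>mo. \<bar>Poly_Mapping.lookup f mo\<bar> / xmultinom n mo) ` Poly_Mapping.keys f))"

end

theory Submission
  imports Defs "HOL-Computational_Algebra.Polynomial"
begin

text \<open>
  Write \<open>f = \<Sum>i,j. A\<^sub>i\<^sub>j(X) Y\<^sub>i Y\<^sub>j\<close> with one \<open>Y\<^sub>i\<close> equal to \<open>1\<close>; the hypothesis says that the matrix \<open>A(x)\<close> is at least
  \<open>f\<^sup>\<bullet>\<close> times the identity for \<open>x \<in> S\<close>. Fix a box \<open>[-R, R]\<^sup>n\<close>, rescale the \<open>g\<close>'s to be at most \<open>1\<close> on it, and subtract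
  \<open>\<mu> \<Sum> g (1 - g)\<^bsup>2k\<^esup>\<close> times the identity. Where some \<open>g\<close> is clearly negative this adds a large positive term;
  elsewhere a Lojasiewicz inequality places \<open>x\<close> near \<open>S\<close> and each \<open>g (1 - g)\<^bsup>2k\<^esup>\<close> is at most \<open>1 / (2k)\<close>. With \<open>\<mu>\<close> and
  \<open>k\<close> polynomial in the data the new matrix is positive on the whole box, so for a large \<open>N\<close> its Bernstein coefficients
  of degree \<open>N\<close> are positive semidefinite, that is, sums of squares of forms in \<open>Y\<close>. The coefficients of
  \<open>(1 - g)\<^bsup>2k\<^esup>\<close> are exponential in \<open>k\<close>, and so is \<open>N\<close>. Up to squares there are only finitely many Bernstein polynomials, namely
  the products of distinct factors \<open>(1 \<plusminus> X\<^sub>j / R) / 2\<close>; these are small perturbations of a positive constant when \<open>R\<close> is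
  large, hence lie in the archimedean quadratic module.

  The Lojasiewicz inequality comes from an ultrapower of the reals: a sequence of counterexamples yields a point whose
  defect is smaller than every power of the infinitesimal \<open>\<eta>\<close>. Among the elements bounded by powers of \<open>1 / \<eta>\<close> there is a
  subring that represents every residue modulo the elements smaller than all powers of \<open>\<eta>\<close>, so the point
  can be moved by a negligible amount into that subring, where the inequalities hold exactly.
\<close>

section \<open>Real polynomials in several variables\<close>

text \<open>Constants depending on the \<open>g\<close>'s alone (box radius, degree
  \<open>T\<close>, Lojasiewicz constants, \<open>\<gamma>\<close>) are fixed before
  \<open>f\<close> appears. Whatever depends on \<open>f\<close> must be dominated by the bracket
  \<open>B\<close> in the exponent: the matrix size r + 1, \<open>d\<close>, the normalized
  coefficient norm and \<open>R ^ d\<close>. The last is exponential in d, and it is the factor 3^d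
  in \<open>B\<close> that controls it. Keeping Y as matrix indices confines the box and Bernstein
  arguments to the bounded X-directions, so that r enters only through the size of the matrix. The
  obstacle is that a quadratic module is not closed under products, while Bernstein polynomials are
  products of box constraints. Only finitely many products matter modulo squares, and
  \<open>R\<close> is chosen after the module, so all of them can be made members with one degree
  \<open>T\<close>. The Lojasiewicz inequality is needed because the penalty only sees the size of
  the \<open>g\<close>'s, whereas positivity of the matrix is known only on S. It turns a small
  defect into a small distance at polynomial cost, so \<open>\<mu>\<close> and \<open>k\<close> stay
  polynomial in \<open>B\<close> and a single exponential appears.\<close>

abbreviation "lookup \<equiv> Poly_Mapping.lookup"
abbreviation "keys \<equiv> Poly_Mapping.keys"
abbreviation "single \<equiv> Poly_Mapping.single"

lemma mconst_hom:
  "mconst 0 = 0" "mconst 1 = 1" "mconst (a + b) = mconst a + mconst b"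
  "mconst (a * b) = mconst a * mconst b" "mconst (a - b) = mconst a - mconst b"
  "mconst (- a) = - mconst a"
  by (simp_all add: mconst_def single_add single_diff single_uminus mult_single)

lemma mconst_of_nat: "mconst (real k) = of_nat k"
  unfolding mconst_def by (rule single_of_nat)

lemma mconst_sum: "mconst (sum f S) = (\<Sum>i\<in>S. mconst (f i))"
  by (induction S rule: infinite_finite_induct) (simp_all add: mconst_hom)

lemma mconst_prod: "mconst (prod f S) = (\<Prod>i\<in>S. mconst (f i))"
  by (induction S rule: infinite_finite_induct) (simp_all add: mconst_hom)

lemma mconst_power: "mconst (a ^ k) = mconst a ^ k"
  by (induction k) (simp_all add: mconst_hom)

definition mon :: "(nat \<Rightarrow> real) \<Rightarrow> (nat \<Rightarrow>\<^sub>0 nat) \<Rightarrow> real" where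
  "mon x mo = (\<Prod>i\<in>keys mo. x i ^ lookup mo i)"

lemma mon_superset: "finite S \<Longrightarrow> keys mo \<subseteq> S \<Longrightarrow> mon x mo = (\<Prod>i\<in>S. x i ^ lookup mo i)"
  unfolding mon_def by (rule prod.mono_neutral_left) (auto simp: in_keys_iff)

lemma mon_add: "mon x (a + b) = mon x a * mon x b"
proof -
  have "keys (a + b) \<subseteq> keys a \<union> keys b" by (rule keys_add)
  then show ?thesis
    by (simp add: mon_superset[of "keys a \<union> keys b"] lookup_add power_add prod.distrib)
qed

lemma mon_zero [simp]: "mon x 0 = 1"
  by (simp add: mon_def)

lemma mon_single [simp]: "mon x (single i k) = x i ^ k"
  by (cases "k = 0") (simp_all add: mon_def)

lemma meval_alt: "meval p x = (\<Sum>mo\<in>keys p. lookup p mo * mon x mo)"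
  by (simp add: meval_def mon_def)

lemma meval_superset:
  "finite S \<Longrightarrow> keys p \<subseteq> S \<Longrightarrow> meval p x = (\<Sum>mo\<in>S. lookup p mo * mon x mo)"
  unfolding meval_alt by (rule sum.mono_neutral_left) (auto simp: in_keys_iff)

lemma meval_zero [simp]: "meval 0 x = 0"
  by (simp add: meval_alt)

lemma meval_single [simp]: "meval (single mo c) x = c * mon x mo"
  by (simp add: meval_alt)

lemma meval_add: "meval (p + q) x = meval p x + meval q x"
  by (simp add: meval_superset[OF _ keys_add] meval_superset[of "keys p \<union> keys q"] lookup_add
      algebra_simps sum.distrib)

lemma meval_uminus: "meval (- p) x = - meval p x"
  using meval_add[of p "- p" x] by simp

lemma meval_diff: "meval (p - q) x = meval p x - meval q x"
  using meval_add[of p "- q" x] by (simp add: meval_uminus)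

lemma meval_sum: "meval (sum f S) x = (\<Sum>i\<in>S. meval (f i) x)"
  by (induction S rule: infinite_finite_induct) (simp_all add: meval_add)

lemma meval_sum_list: "meval (sum_list (map f xs)) x = (\<Sum>a\<leftarrow>xs. meval (f a) x)"
  by (induction xs) (simp_all add: meval_add)

lemma mpoly_sum_singles: "p = (\<Sum>mo\<in>keys p. single mo (lookup p mo))"
  by (rule poly_mapping_eqI) (simp add: lookup_sum lookup_single when_def in_keys_iff)

lemma mult_as_sum:
  fixes p q :: mpoly
  shows "p * q = (\<Sum>a\<in>keys p. \<Sum>b\<in>keys q. single (a + b) (lookup p a * lookup q b))"
  by (subst mpoly_sum_singles[of p], subst mpoly_sum_singles[of q])
    (simp add: sum_product mult_single)

lemma meval_mult: "meval (p * q) x = meval p x * meval q x"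
proof -
  have "meval (p * q) x = (\<Sum>a\<in>keys p. \<Sum>b\<in>keys q. (lookup p a * mon x a) * (lookup q b * mon x b))"
    by (subst mult_as_sum) (simp add: meval_sum mon_add mult_ac)
  then show ?thesis by (simp add: meval_alt sum_product)
qed

lemma meval_mconst [simp]: "meval (mconst c) x = c"
  by (simp add: mconst_def)

lemma meval_mvar [simp]: "meval (mvar i) x = x i"
  by (simp add: mvar_def)

lemma meval_one [simp]: "meval 1 x = 1"
  using meval_mconst[of 1 x] by (simp add: mconst_hom)

lemma meval_power: "meval (p ^ k) x = meval p x ^ k"
  by (induction k) (simp_all add: meval_mult)

lemma meval_cong:
  assumes "mvars p \<subseteq> V" "\<And>i. i \<in> V \<Longrightarrow> x i = y i"
  shows "meval p x = meval p y"
  unfolding meval_def using assms by (intro sum.cong prod.cong arg_cong2[where f="(*)"] refl)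
    (auto simp: mvars_def)

lemma mon_deg_superset:
  "finite S \<Longrightarrow> keys mo \<subseteq> S \<Longrightarrow> mon_deg_in V mo = (\<Sum>i\<in>S \<inter> V. lookup mo i)"
  unfolding mon_deg_in_def by (rule sum.mono_neutral_left) (auto simp: in_keys_iff)

lemma mon_deg_add: "mon_deg_in V (a + b) = mon_deg_in V a + mon_deg_in V b"
proof -
  have "keys (a + b) \<subseteq> keys a \<union> keys b" by (rule keys_add)
  then show ?thesis
    by (simp add: mon_deg_superset[of "keys a \<union> keys b"] lookup_add sum.distrib)
qed

lemma mon_deg_zero [simp]: "mon_deg_in V 0 = 0"
  by (simp add: mon_deg_in_def)

lemma mon_deg_single [simp]: "mon_deg_in V (single i k) = (if i \<in> V then k else 0)"
  by (cases "k = 0") (auto simp: mon_deg_in_def)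

lemma deg_in_le_iff: "deg_in V p \<le> T \<longleftrightarrow> (\<forall>mo\<in>keys p. mon_deg_in V mo \<le> T)"
  unfolding deg_in_def by (subst Max_le_iff) auto

subsection \<open>Polynomials of bounded degree in a set of variables\<close>

text \<open>Variables and total degree are bundled into one membership statement: the closure rules
  below bound both at once and never evaluate the maximum inside \<open>mdeg\<close>.\<close>

definition polys :: "nat set \<Rightarrow> nat \<Rightarrow> mpoly set" where
  "polys V T = {p. mvars p \<subseteq> V \<and> mdeg p \<le> T}"

lemma polys_iff: "p \<in> polys V T \<longleftrightarrow> (\<forall>mo\<in>keys p. keys mo \<subseteq> V \<and> mon_deg_in UNIV mo \<le> T)"
  by (auto simp: polys_def mvars_def mdeg_def deg_in_le_iff)

lemma polys_mono: "p \<in> polys V T \<Longrightarrow> V \<subseteq> W \<Longrightarrow> T \<le> T' \<Longrightarrow> p \<in> polys W T'"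
  by (auto simp: polys_def)

lemma polys_zero [simp]: "0 \<in> polys V T"
  by (simp add: polys_iff)

lemma polys_add: "p \<in> polys V T \<Longrightarrow> q \<in> polys V T \<Longrightarrow> p + q \<in> polys V T"
  using keys_add[of p q] by (auto simp: polys_iff)

lemma polys_uminus: "p \<in> polys V T \<Longrightarrow> - p \<in> polys V T"
  by (auto simp: polys_iff in_keys_iff)

lemma polys_diff: "p \<in> polys V T \<Longrightarrow> q \<in> polys V T \<Longrightarrow> p - q \<in> polys V T"
  using polys_add[of p V T "- q"] by (simp add: polys_uminus)

lemma polys_sum: "(\<And>i. i \<in> S \<Longrightarrow> f i \<in> polys V T) \<Longrightarrow> sum f S \<in> polys V T"
  by (induction S rule: infinite_finite_induct) (auto intro: polys_add)

lemma polys_sum_list: "(\<And>a. a \<in> set xs \<Longrightarrow> f a \<in> polys V T) \<Longrightarrow> sum_list (map f xs) \<in> polys V T"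
  by (induction xs) (auto intro: polys_add)

lemma polys_mult:
  assumes "p \<in> polys V T" "q \<in> polys V T'"
  shows "p * q \<in> polys V (T + T')"
  unfolding polys_iff
proof
  fix mo assume "mo \<in> keys (p * q)"
  then obtain a b where ab: "mo = a + b" "a \<in> keys p" "b \<in> keys q"
    using keys_mult[of p q] by blast
  with assms have "keys a \<subseteq> V" "mon_deg_in UNIV a \<le> T" "keys b \<subseteq> V" "mon_deg_in UNIV b \<le> T'"
    by (auto simp: polys_iff)
  then show "keys mo \<subseteq> V \<and> mon_deg_in UNIV mo \<le> T + T'"
    using keys_add[of a b] by (auto simp: ab mon_deg_add)
qed

lemma polys_mconst [simp]: "mconst c \<in> polys V T"
  by (auto simp: polys_iff mconst_def)

lemma polys_one [simp]: "1 \<in> polys V T"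
  using polys_mconst[of 1] by (simp add: mconst_hom)

lemma polys_mvar: "i \<in> V \<Longrightarrow> mvar i \<in> polys V 1"
  by (auto simp: polys_iff mvar_def)

lemma polys_mult_const: "p \<in> polys V T \<Longrightarrow> mconst c * p \<in> polys V T"
  using polys_mult[OF polys_mconst[of c V 0]] by simp

lemma polys_power: "p \<in> polys V T \<Longrightarrow> p ^ k \<in> polys V (k * T)"
proof (induction k)
  case (Suc k)
  then show ?case using polys_mult[of p V T "p ^ k" "k * T"] by simp
qed simp

lemma polys_prod: "(\<And>i. i \<in> S \<Longrightarrow> f i \<in> polys V (T i)) \<Longrightarrow> prod f S \<in> polys V (sum T S)"
  by (induction S rule: infinite_finite_induct) (auto intro: polys_mult)

lemma mdeg_polys: "p \<in> polys V T \<Longrightarrow> mdeg p \<le> T"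
  and mvars_polys: "p \<in> polys V T \<Longrightarrow> mvars p \<subseteq> V"
  by (auto simp: polys_def)

subsection \<open>The coefficient norm\<close>

text \<open>Unlike \<open>bnorm\<close>, this norm is submultiplicative, as the powers of 1 - g
  require; \<open>coefficient_matrix\<close> passes from \<open>bnorm\<close> to it.\<close>

definition l1 :: "mpoly \<Rightarrow> real" where
  "l1 p = (\<Sum>mo\<in>keys p. \<bar>lookup p mo\<bar>)"

lemma l1_nonneg [simp]: "0 \<le> l1 p"
  by (simp add: l1_def sum_nonneg)

lemma l1_superset: "finite S \<Longrightarrow> keys p \<subseteq> S \<Longrightarrow> l1 p = (\<Sum>mo\<in>S. \<bar>lookup p mo\<bar>)"
  unfolding l1_def by (rule sum.mono_neutral_left) (auto simp: in_keys_iff)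

lemma l1_zero [simp]: "l1 0 = 0"
  by (simp add: l1_def)

lemma l1_single [simp]: "l1 (single mo c) = \<bar>c\<bar>"
  by (simp add: l1_def)

lemma l1_mconst [simp]: "l1 (mconst c) = \<bar>c\<bar>"
  by (simp add: mconst_def)

lemma l1_one [simp]: "l1 1 = 1"
  using l1_mconst[of 1] by (simp add: mconst_hom)

lemma l1_add: "l1 (p + q) \<le> l1 p + l1 q"
proof -
  have "l1 (p + q) = (\<Sum>mo\<in>keys p \<union> keys q. \<bar>lookup (p + q) mo\<bar>)"
    by (rule l1_superset) (auto simp: keys_add)
  also have "\<dots> \<le> (\<Sum>mo\<in>keys p \<union> keys q. \<bar>lookup p mo\<bar> + \<bar>lookup q mo\<bar>)"
    by (intro sum_mono) (simp add: lookup_add abs_triangle_ineq)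
  also have "\<dots> = l1 p + l1 q"
    by (simp add: sum.distrib l1_superset[of "keys p \<union> keys q"])
  finally show ?thesis .
qed

lemma l1_uminus [simp]: "l1 (- p) = l1 p"
proof -
  have "keys (- p) = keys p" by (auto simp: in_keys_iff)
  then show ?thesis by (simp add: l1_def)
qed

lemma l1_diff: "l1 (p - q) \<le> l1 p + l1 q"
  using l1_add[of p "- q"] by simp

lemma l1_sum: "l1 (sum f S) \<le> (\<Sum>i\<in>S. l1 (f i))"
  by (induction S rule: infinite_finite_induct) (auto intro: order_trans[OF l1_add])

lemma l1_sum_list: "l1 (sum_list (map f xs)) \<le> (\<Sum>a\<leftarrow>xs. l1 (f a))"
  by (induction xs) (auto intro: order_trans[OF l1_add])

lemma l1_mult: "l1 (p * q) \<le> l1 p * l1 q"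
proof -
  have "l1 (p * q) \<le> (\<Sum>a\<in>keys p. \<Sum>b\<in>keys q. l1 (single (a + b) (lookup p a * lookup q b)))"
    unfolding mult_as_sum by (rule order_trans[OF l1_sum], rule sum_mono, rule l1_sum)
  also have "\<dots> = (\<Sum>a\<in>keys p. \<bar>lookup p a\<bar>) * (\<Sum>b\<in>keys q. \<bar>lookup q b\<bar>)"
    by (simp add: sum_product abs_mult)
  also have "\<dots> = l1 p * l1 q" by (simp add: l1_def)
  finally show ?thesis .
qed

lemma l1_power: "l1 (p ^ k) \<le> l1 p ^ k"
proof (induction k)
  case (Suc k)
  then show ?case using l1_mult[of p "p ^ k"] mult_left_mono[of "l1 (p ^ k)" "l1 p ^ k" "l1 p"] by simp
qed simp

section \<open>Values and Lipschitz constants of polynomials on a cube\<close>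

lemma mon_scaled:
  assumes "R > 0"
  shows "mon x mo = R ^ mon_deg_in UNIV mo * mon (\<lambda>i. x i / R) mo"
  using assms by (simp add: mon_def mon_deg_in_def power_divide prod_dividef power_sum)

lemma mon_le:
  assumes "keys mo \<subseteq> V" "\<And>i. i \<in> V \<Longrightarrow> \<bar>x i\<bar> \<le> 1"
  shows "\<bar>mon x mo\<bar> \<le> 1"
  unfolding mon_def abs_prod using assms by (intro prod_le_1) (auto simp: power_abs intro!: power_le_one)

text \<open>Telescoping: when all factors have modulus at most 1, a product changes by at most the
  sum of the changes of its factors.\<close>

lemma mon_diff_le:
  assumes "keys mo \<subseteq> V" "\<And>i. i \<in> V \<Longrightarrow> \<bar>x i\<bar> \<le> 1" "\<And>i. i \<in> V \<Longrightarrow> \<bar>y i\<bar> \<le> 1"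
    "\<And>i. i \<in> V \<Longrightarrow> \<bar>x i - y i\<bar> \<le> e"
  shows "\<bar>mon x mo - mon y mo\<bar> \<le> real (mon_deg_in UNIV mo) * e"
proof -
  have "norm (mon x mo - mon y mo) \<le> (\<Sum>i\<in>keys mo. norm (x i ^ lookup mo i - y i ^ lookup mo i))"
    unfolding mon_def using assms
    by (intro norm_prod_diff) (auto simp: power_abs intro!: power_le_one)
  also have "\<dots> \<le> (\<Sum>i\<in>keys mo. real (lookup mo i) * e)"
  proof (rule sum_mono)
    fix i assume "i \<in> keys mo"
    then have "i \<in> V" using assms by auto
    then have "norm (x i ^ lookup mo i - y i ^ lookup mo i) \<le> lookup mo i * norm (x i - y i)"
      using assms by (intro norm_power_diff) auto
    also have "\<dots> \<le> lookup mo i * e" using assms \<open>i \<in> V\<close> by (intro mult_left_mono) auto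
    finally show "norm (x i ^ lookup mo i - y i ^ lookup mo i) \<le> lookup mo i * e" .
  qed
  finally show ?thesis by (simp add: mon_deg_in_def sum_distrib_right)
qed

lemma meval_bound:
  assumes "p \<in> polys V d" "R \<ge> 1" "\<And>i. i \<in> V \<Longrightarrow> \<bar>x i\<bar> \<le> R"
  shows "\<bar>meval p x\<bar> \<le> l1 p * R ^ d"
proof -
  have "\<bar>meval p x\<bar> \<le> (\<Sum>mo\<in>keys p. \<bar>lookup p mo * mon x mo\<bar>)"
    unfolding meval_alt by (rule sum_abs)
  also have "\<dots> \<le> (\<Sum>mo\<in>keys p. \<bar>lookup p mo\<bar> * R ^ d)"
  proof (rule sum_mono)
    fix mo assume "mo \<in> keys p"
    then have mo: "keys mo \<subseteq> V" "mon_deg_in UNIV mo \<le> d" using assms(1) by (auto simp: polys_iff)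
    have "\<bar>mon (\<lambda>i. x i / R) mo\<bar> \<le> 1" using assms mo by (intro mon_le[of mo V]) auto
    moreover have "R ^ mon_deg_in UNIV mo \<le> R ^ d" using assms mo by (intro power_increasing) auto
    ultimately have "R ^ mon_deg_in UNIV mo * \<bar>mon (\<lambda>i. x i / R) mo\<bar> \<le> R ^ d * 1"
      using assms by (intro mult_mono) auto
    then have "\<bar>mon x mo\<bar> \<le> R ^ d"
      using assms mon_scaled[of R x mo] by (simp add: abs_mult)
    then show "\<bar>lookup p mo * mon x mo\<bar> \<le> \<bar>lookup p mo\<bar> * R ^ d"
      by (simp add: abs_mult mult_left_mono)
  qed
  finally show ?thesis by (simp add: l1_def sum_distrib_right)
qed

text \<open>Dividing the coordinates by \<open>R\<close> reduces to the unit cube at the price of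
  \<open>R ^ d\<close>; because \<open>R \<ge> 1\<close>, the distance \<open>e\<close> remains a
  valid bound after the division.\<close>

lemma meval_lipschitz:
  assumes "p \<in> polys V d" "R \<ge> 1" "\<And>i. i \<in> V \<Longrightarrow> \<bar>x i\<bar> \<le> R" "\<And>i. i \<in> V \<Longrightarrow> \<bar>y i\<bar> \<le> R"
    "\<And>i. i \<in> V \<Longrightarrow> \<bar>x i - y i\<bar> \<le> e" "e \<ge> 0"
  shows "\<bar>meval p x - meval p y\<bar> \<le> l1 p * (R ^ d * d * e)"
proof -
  have "\<bar>meval p x - meval p y\<bar> \<le> (\<Sum>mo\<in>keys p. \<bar>lookup p mo * (mon x mo - mon y mo)\<bar>)"
    unfolding meval_alt sum_subtractf[symmetric] right_diff_distrib[symmetric] by (rule sum_abs)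
  also have "\<dots> \<le> (\<Sum>mo\<in>keys p. \<bar>lookup p mo\<bar> * (R ^ d * d * e))"
  proof (rule sum_mono)
    fix mo assume "mo \<in> keys p"
    then have mo: "keys mo \<subseteq> V" "mon_deg_in UNIV mo \<le> d" using assms(1) by (auto simp: polys_iff)
    have e: "\<bar>x i / R - y i / R\<bar> \<le> e" if "i \<in> V" for i
    proof -
      have "\<bar>x i / R - y i / R\<bar> = \<bar>x i - y i\<bar> / R"
        using assms by (simp add: diff_divide_distrib[symmetric])
      also have "\<dots> \<le> \<bar>x i - y i\<bar> / 1" using assms by (intro divide_left_mono) auto
      finally show ?thesis using assms(5)[OF that] by simp
    qed
    have "\<bar>mon (\<lambda>i. x i / R) mo - mon (\<lambda>i. y i / R) mo\<bar> \<le> real (mon_deg_in UNIV mo) * e"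
      using assms mo e by (intro mon_diff_le[of mo V]) auto
    also have "\<dots> \<le> d * e" using mo assms by (intro mult_right_mono) auto
    finally have 1: "\<bar>mon (\<lambda>i. x i / R) mo - mon (\<lambda>i. y i / R) mo\<bar> \<le> d * e" .
    have "\<bar>mon x mo - mon y mo\<bar> = R ^ mon_deg_in UNIV mo * \<bar>mon (\<lambda>i. x i / R) mo - mon (\<lambda>i. y i / R) mo\<bar>"
      using assms mon_scaled[of R x mo] mon_scaled[of R y mo]
      by (simp add: right_diff_distrib[symmetric] abs_mult)
    also have "\<dots> \<le> R ^ d * (d * e)"
      using assms mo 1 by (intro mult_mono power_increasing) auto
    finally show "\<bar>lookup p mo * (mon x mo - mon y mo)\<bar> \<le> \<bar>lookup p mo\<bar> * (R ^ d * d * e)"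
      by (simp add: abs_mult mult_left_mono mult.assoc)
  qed
  finally show ?thesis by (simp add: l1_def sum_distrib_right)
qed

section \<open>Quadratic modules with degree bounds\<close>

lemma mdeg_le_iff: "mdeg p \<le> T \<longleftrightarrow> p \<in> polys UNIV T"
  by (simp add: polys_def)

lemma sos_add: "sos_in V p \<Longrightarrow> sos_in V q \<Longrightarrow> sos_in V (p + q)"
proof -
  assume "sos_in V p" "sos_in V q"
  then obtain qs rs where "\<forall>q\<in>set qs. mvars q \<subseteq> V" "p = sum_list (map (\<lambda>q. q * q) qs)"
    "\<forall>q\<in>set rs. mvars q \<subseteq> V" "q = sum_list (map (\<lambda>q. q * q) rs)"
    by (auto simp: sos_in_def)
  then show ?thesis unfolding sos_in_def by (intro exI[of _ "qs @ rs"]) auto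
qed

lemma sos_zero [simp]: "sos_in V 0"
  unfolding sos_in_def by (intro exI[of _ "[]"]) simp

lemma sos_square: "mvars q \<subseteq> V \<Longrightarrow> sos_in V (q * q)"
  unfolding sos_in_def by (intro exI[of _ "[q]"]) simp

lemma mvars_mult: "mvars p \<subseteq> V \<Longrightarrow> mvars q \<subseteq> V \<Longrightarrow> mvars (p * q) \<subseteq> V"
  using polys_mult[of p V "mdeg p" q "mdeg q"] by (auto simp: polys_def)

lemma sos_mult:
  assumes "sos_in V p" "sos_in V q" shows "sos_in V (p * q)"
proof -
  have square: "sos_in V (a * a * sum_list (map (\<lambda>q. q * q) qs))"
    if "mvars a \<subseteq> V" "\<forall>q\<in>set qs. mvars q \<subseteq> V" for a qs
    using that
  proof (induction qs)
    case (Cons b qs)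
    have "sos_in V ((a * b) * (a * b))" using Cons by (intro sos_square mvars_mult) auto
    then have "sos_in V ((a * b) * (a * b) + a * a * sum_list (map (\<lambda>q. q * q) qs))"
      using Cons by (intro sos_add) auto
    then show ?case by (simp add: algebra_simps)
  qed simp
  obtain ps where ps: "\<forall>q\<in>set ps. mvars q \<subseteq> V" "p = sum_list (map (\<lambda>q. q * q) ps)"
    using assms(1) by (auto simp: sos_in_def)
  obtain qs where qs: "\<forall>q\<in>set qs. mvars q \<subseteq> V" "q = sum_list (map (\<lambda>q. q * q) qs)"
    using assms(2) by (auto simp: sos_in_def)
  have "sos_in V (sum_list (map (\<lambda>q. q * q) ps) * q)" using ps(1)
    by (induction ps) (auto simp: distrib_right qs intro!: sos_add square qs(1))
  then show ?thesis by (simp add: ps)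
qed

lemma sos_mconst: "c \<ge> 0 \<Longrightarrow> sos_in V (mconst c)"
  using sos_square[of "mconst (sqrt c)" V] mvars_polys[OF polys_mconst]
  by (simp add: mconst_hom(4)[symmetric])

lemma sos_sum: "(\<And>i. i \<in> S \<Longrightarrow> sos_in V (f i)) \<Longrightarrow> sos_in V (sum f S)"
  by (induction S rule: infinite_finite_induct) (auto intro: sos_add)

lemma sos_sum_list: "(\<And>a. a \<in> set xs \<Longrightarrow> sos_in V (f a)) \<Longrightarrow> sos_in V (sum_list (map f xs))"
  by (induction xs) (auto intro: sos_add)

lemma sos_mono: "sos_in V p \<Longrightarrow> V \<subseteq> W \<Longrightarrow> sos_in W p"
  by (fastforce simp: sos_in_def)

text \<open>Truncated quadratic module: the degree bound is on every summand, since leading terms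
  may cancel in the sum. Multipliers are functions of the position, which makes addition pointwise;
  \<open>qmd_lists\<close> restores the list form of the theorem.\<close>

definition qmd :: "nat set \<Rightarrow> mpoly list \<Rightarrow> nat \<Rightarrow> mpoly set" where
  "qmd V gs T = {p. \<exists>\<sigma>0 \<sigma>. sos_in V \<sigma>0 \<and> mdeg \<sigma>0 \<le> T \<and>
      (\<forall>i<length gs. sos_in V (\<sigma> i) \<and> mdeg (\<sigma> i * gs ! i) \<le> T) \<and>
      p = \<sigma>0 + (\<Sum>i<length gs. \<sigma> i * gs ! i)}"

lemma qmdI:
  assumes "sos_in V \<sigma>0" "mdeg \<sigma>0 \<le> T" "\<And>i. i < length gs \<Longrightarrow> sos_in V (\<sigma> i)"
    "\<And>i. i < length gs \<Longrightarrow> mdeg (\<sigma> i * gs ! i) \<le> T" "p = \<sigma>0 + (\<Sum>i<length gs. \<sigma> i * gs ! i)"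
  shows "p \<in> qmd V gs T"
  using assms unfolding qmd_def by blast

lemma qmdE:
  assumes "p \<in> qmd V gs T"
  obtains \<sigma>0 \<sigma> where "sos_in V \<sigma>0" "mdeg \<sigma>0 \<le> T" "\<forall>i<length gs. sos_in V (\<sigma> i)"
    "\<forall>i<length gs. mdeg (\<sigma> i * gs ! i) \<le> T" "p = \<sigma>0 + (\<Sum>i<length gs. \<sigma> i * gs ! i)"
  using assms unfolding qmd_def by blast

lemma sum_list_zip_nth:
  "length \<sigma>s = length gs \<Longrightarrow>
    sum_list (map (\<lambda>(\<sigma>, g). \<sigma> * g) (zip \<sigma>s gs)) = (\<Sum>i<length gs. \<sigma>s ! i * gs ! i)"
  for \<sigma>s gs :: "'a :: semiring_0 list"
  by (simp add: sum_list_sum_nth atLeast0LessThan)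

lemma qmd_lists:
  assumes "p \<in> qmd V gs T"
  shows "\<exists>\<sigma>0 \<sigma>s. length \<sigma>s = length gs \<and> sos_in V \<sigma>0 \<and> (\<forall>\<sigma>\<in>set \<sigma>s. sos_in V \<sigma>)
    \<and> p = \<sigma>0 + sum_list (map (\<lambda>(\<sigma>, g). \<sigma> * g) (zip \<sigma>s gs))
    \<and> mdeg \<sigma>0 \<le> T \<and> (\<forall>(\<sigma>, g)\<in>set (zip \<sigma>s gs). mdeg (\<sigma> * g) \<le> T)"
proof -
  obtain \<sigma>0 \<sigma> where *: "sos_in V \<sigma>0" "mdeg \<sigma>0 \<le> T" "\<forall>i<length gs. sos_in V (\<sigma> i)"
    "\<forall>i<length gs. mdeg (\<sigma> i * gs ! i) \<le> T" "p = \<sigma>0 + (\<Sum>i<length gs. \<sigma> i * gs ! i)"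
    using assms by (rule qmdE)
  show ?thesis
    using * by (intro exI[of _ \<sigma>0] exI[of _ "map \<sigma> [0..<length gs]"])
      (auto simp: sum_list_zip_nth set_zip)
qed

lemma qmodule_qmd:
  assumes "p \<in> qmodule V gs" shows "\<exists>T. p \<in> qmd V gs T"
proof -
  obtain \<sigma>0 \<sigma>s where *: "length \<sigma>s = length gs" "sos_in V \<sigma>0" "\<forall>\<sigma>\<in>set \<sigma>s. sos_in V \<sigma>"
    "p = \<sigma>0 + sum_list (map (\<lambda>(\<sigma>, g). \<sigma> * g) (zip \<sigma>s gs))"
    using assms unfolding qmodule_def by blast
  let ?T = "mdeg \<sigma>0 + (\<Sum>i<length gs. mdeg (\<sigma>s ! i * gs ! i))"
  have "p \<in> qmd V gs ?T"
    using * by (intro qmdI[of V \<sigma>0 ?T gs "\<lambda>i. \<sigma>s ! i"])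
      (auto simp: sum_list_zip_nth intro!: trans_le_add2 member_le_sum)
  then show ?thesis ..
qed

lemma qmd_mono: "p \<in> qmd V gs T \<Longrightarrow> V \<subseteq> W \<Longrightarrow> T \<le> T' \<Longrightarrow> p \<in> qmd W gs T'"
  by (elim qmdE, rule qmdI) (auto intro: sos_mono order_trans)

lemma qmd_add:
  assumes "p \<in> qmd V gs T" "q \<in> qmd V gs T" shows "p + q \<in> qmd V gs T"
proof -
  obtain \<sigma>0 \<sigma> where 1: "sos_in V \<sigma>0" "mdeg \<sigma>0 \<le> T" "\<forall>i<length gs. sos_in V (\<sigma> i)"
    "\<forall>i<length gs. mdeg (\<sigma> i * gs ! i) \<le> T" "p = \<sigma>0 + (\<Sum>i<length gs. \<sigma> i * gs ! i)"
    using assms(1) by (rule qmdE)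
  obtain \<tau>0 \<tau> where 2: "sos_in V \<tau>0" "mdeg \<tau>0 \<le> T" "\<forall>i<length gs. sos_in V (\<tau> i)"
    "\<forall>i<length gs. mdeg (\<tau> i * gs ! i) \<le> T" "q = \<tau>0 + (\<Sum>i<length gs. \<tau> i * gs ! i)"
    using assms(2) by (rule qmdE)
  show ?thesis
    using 1 2 by (intro qmdI[of V "\<sigma>0 + \<tau>0" T gs "\<lambda>i. \<sigma> i + \<tau> i"])
      (auto simp: mdeg_le_iff distrib_right sum.distrib intro: sos_add polys_add)
qed

lemma qmd_zero [simp]: "0 \<in> qmd V gs T"
  by (rule qmdI[of V 0 T gs "\<lambda>_. 0"]) (auto simp: mdeg_le_iff)

lemma qmd_sum: "(\<And>i. i \<in> S \<Longrightarrow> f i \<in> qmd V gs T) \<Longrightarrow> sum f S \<in> qmd V gs T"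
  by (induction S rule: infinite_finite_induct) (auto intro: qmd_add)

lemma qmd_sum_list: "(\<And>a. a \<in> set xs \<Longrightarrow> f a \<in> qmd V gs T) \<Longrightarrow> sum_list (map f xs) \<in> qmd V gs T"
  by (induction xs) (auto intro: qmd_add)

lemma qmd_sos: "sos_in V p \<Longrightarrow> mdeg p \<le> T \<Longrightarrow> p \<in> qmd V gs T"
  by (rule qmdI[of V p T gs "\<lambda>_. 0"]) (auto simp: mdeg_le_iff)

lemma mdeg_mult: "mdeg p \<le> T \<Longrightarrow> mdeg q \<le> T' \<Longrightarrow> mdeg (p * q) \<le> T + T'"
  by (simp add: mdeg_le_iff polys_mult)

lemma qmd_mult_sos:
  assumes "sos_in V \<tau>" "mdeg \<tau> \<le> T'" "p \<in> qmd V gs T"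
  shows "\<tau> * p \<in> qmd V gs (T' + T)"
proof -
  obtain \<sigma>0 \<sigma> where 1: "sos_in V \<sigma>0" "mdeg \<sigma>0 \<le> T" "\<forall>i<length gs. sos_in V (\<sigma> i)"
    "\<forall>i<length gs. mdeg (\<sigma> i * gs ! i) \<le> T" "p = \<sigma>0 + (\<Sum>i<length gs. \<sigma> i * gs ! i)"
    using assms(3) by (rule qmdE)
  have "mdeg (\<tau> * \<sigma> i * gs ! i) \<le> T' + T" if "i < length gs" for i
    using mdeg_mult[OF assms(2), of "\<sigma> i * gs ! i" T] 1(4) that by (simp add: mult.assoc)
  then show ?thesis
    using 1 assms by (intro qmdI[of V "\<tau> * \<sigma>0" "T' + T" gs "\<lambda>i. \<tau> * \<sigma> i"])
      (auto simp: distrib_left sum_distrib_left mult.assoc intro!: sos_mult mdeg_mult)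
qed

lemma qmd_mult_gen:
  assumes "g \<in> set gs" "sos_in V \<tau>" "mdeg (\<tau> * g) \<le> T"
  shows "\<tau> * g \<in> qmd V gs T"
proof -
  obtain k where k: "k < length gs" "g = gs ! k" using assms(1) by (metis in_set_conv_nth)
  have "(\<Sum>i<length gs. (if i = k then \<tau> else 0) * gs ! i) = \<tau> * g"
    using k by (subst sum.remove[of _ k]) auto
  then show ?thesis
    using assms k by (intro qmdI[of V 0 T gs "\<lambda>i. if i = k then \<tau> else 0"]) (auto simp: mdeg_le_iff)
qed

lemma qmd_mult_const: "c \<ge> 0 \<Longrightarrow> p \<in> qmd V gs T \<Longrightarrow> mconst c * p \<in> qmd V gs T"
  using qmd_mult_sos[of V "mconst c" 0 p gs T] mdeg_polys[OF polys_mconst[of c V 0]]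
  by (simp add: sos_mconst)

section \<open>Consequences of the archimedean property\<close>

definition qm :: "nat set \<Rightarrow> mpoly list \<Rightarrow> mpoly set" where
  "qm V gs = (\<Union>T. qmd V gs T)"

lemma qm_add: "p \<in> qm V gs \<Longrightarrow> q \<in> qm V gs \<Longrightarrow> p + q \<in> qm V gs"
proof -
  assume "p \<in> qm V gs" "q \<in> qm V gs"
  then obtain T T' where "p \<in> qmd V gs T" "q \<in> qmd V gs T'" by (auto simp: qm_def)
  then have "p \<in> qmd V gs (max T T')" "q \<in> qmd V gs (max T T')" by (auto intro: qmd_mono)
  then show ?thesis by (auto simp: qm_def intro: qmd_add)
qed

lemma qm_sos: "sos_in V p \<Longrightarrow> p \<in> qm V gs"
  by (auto simp: qm_def intro: qmd_sos)

lemma qm_mult_sos: "sos_in V p \<Longrightarrow> q \<in> qm V gs \<Longrightarrow> p * q \<in> qm V gs"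
  by (auto simp: qm_def intro: qmd_mult_sos)

lemma qm_mconst: "c \<ge> 0 \<Longrightarrow> mconst c \<in> qm V gs"
  by (simp add: qm_sos sos_mconst)

text \<open>The inequality |a| <= c in the preorder given by the quadratic module. These bounded
  elements are closed under sums and products, which replaces the missing closure of the module
  itself under products.\<close>

definition bounded_by :: "nat set \<Rightarrow> mpoly list \<Rightarrow> mpoly \<Rightarrow> real \<Rightarrow> bool" where
  "bounded_by V gs a c \<longleftrightarrow> mvars a \<subseteq> V \<and> c > 0 \<and> mconst c + a \<in> qm V gs \<and> mconst c - a \<in> qm V gs"

lemma bounded_by_uminus: "bounded_by V gs a c \<Longrightarrow> bounded_by V gs (- a) c"
  using mvars_polys[OF polys_uminus, of a V "mdeg a"] by (auto simp: bounded_by_def polys_def)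

lemma bounded_by_add:
  assumes "bounded_by V gs a c" "bounded_by V gs b d" shows "bounded_by V gs (a + b) (c + d)"
proof -
  have "mvars (a + b) \<subseteq> V"
    using assms mvars_polys[OF polys_add, of a V "max (mdeg a) (mdeg b)" b]
    by (auto simp: bounded_by_def polys_def)
  moreover have eq: "mconst (c + d) + (a + b) = (mconst c + a) + (mconst d + b)"
    "mconst (c + d) - (a + b) = (mconst c - a) + (mconst d - b)"
    by (simp_all add: mconst_hom)
  have "mconst (c + d) + (a + b) \<in> qm V gs" "mconst (c + d) - (a + b) \<in> qm V gs"
    unfolding eq using assms[unfolded bounded_by_def] by (blast intro: qm_add)+
  ultimately show ?thesis using assms by (auto simp: bounded_by_def)
qed

text \<open>c + ta is the convex combination of c and c + a. That the bound does not change with t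
  keeps the constant in \<open>near_one\<close> uniform.\<close>

lemma bounded_by_scale:
  assumes "bounded_by V gs a c" "0 \<le> t" "t \<le> 1" shows "bounded_by V gs (mconst t * a) c"
proof -
  have "mconst c + mconst t * a = mconst ((1 - t) * c) + mconst t * (mconst c + a)"
    "mconst c - mconst t * a = mconst ((1 - t) * c) + mconst t * (mconst c - a)"
    by (simp_all add: mconst_hom algebra_simps)
  moreover have "mvars (mconst t * a) \<subseteq> V"
    using assms by (intro mvars_mult mvars_polys[OF polys_mconst]) (simp add: bounded_by_def)
  ultimately show ?thesis
    using assms by (auto simp: bounded_by_def intro!: qm_add qm_mconst qm_mult_sos sos_mconst)
qed

text \<open>With p = c + a and q = c - a, the product pq is not visibly in the module, but pq = (p^2
  q + q^2 p) / (2c) because p + q = 2c, and here only squares multiply module elements.\<close>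

lemma bounded_by_square:
  assumes "bounded_by V gs a c" shows "mconst (c\<^sup>2) - a * a \<in> qm V gs"
proof -
  have c: "c > 0" and a: "mvars a \<subseteq> V" using assms by (auto simp: bounded_by_def)
  define p where "p = mconst c + a"
  define q where "q = mconst c - a"
  have pq: "p \<in> qm V gs" "q \<in> qm V gs" using assms by (auto simp: bounded_by_def p_def q_def)
  have "a \<in> polys V (mdeg a)" using a by (simp add: polys_def)
  then have "p \<in> polys V (mdeg a)" "q \<in> polys V (mdeg a)"
    unfolding p_def q_def by (auto intro: polys_add polys_diff)
  then have sq: "sos_in V (p * p)" "sos_in V (q * q)" by (auto intro!: sos_square mvars_polys)
  have "mconst (1 / (2 * c)) * (p * p * q + q * q * p) \<in> qm V gs"
    using c pq sq by (intro qm_mult_sos qm_add sos_mconst) auto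
  also have "mconst (1 / (2 * c)) * (p * p * q + q * q * p) = (mconst (1 / (2 * c)) * (p + q)) * (p * q)"
    by (simp add: algebra_simps)
  also have "p + q = mconst (2 * c)" using mconst_hom(3)[of c c] by (simp add: p_def q_def)
  also have "mconst (1 / (2 * c)) * mconst (2 * c) = 1"
    using c mconst_hom(4)[of "1 / (2 * c)" "2 * c"] by (simp add: mconst_hom)
  also have "1 * (p * q) = mconst (c\<^sup>2) - a * a"
    by (simp add: p_def q_def algebra_simps mconst_hom power2_eq_square)
  finally show ?thesis .
qed

text \<open>Polarization, 4ab = (a + b)^2 - (a - b)^2, where both a + b and a - b are bounded by c +
  d.\<close>

lemma bounded_by_mult:
  assumes "bounded_by V gs a c" "bounded_by V gs b d"
  shows "bounded_by V gs (a * b) ((c + d)\<^sup>2 / 4)"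
proof -
  have 1: "mconst ((c + d)\<^sup>2) - (a + b) * (a + b) \<in> qm V gs"
    using bounded_by_add[OF assms] by (rule bounded_by_square)
  have bm: "bounded_by V gs (a - b) (c + d)"
    using bounded_by_add[OF assms(1) bounded_by_uminus[OF assms(2)]] by simp
  then have 2: "mconst ((c + d)\<^sup>2) - (a - b) * (a - b) \<in> qm V gs"
    by (rule bounded_by_square)
  have sq: "sos_in V ((a + b) * (a + b))" "sos_in V ((a - b) * (a - b))"
    using bounded_by_add[OF assms] bm by (auto simp: bounded_by_def intro: sos_square)
  define K where "K = mconst ((c + d)\<^sup>2)"
  define Q where "Q = mconst (1 / 4)"
  have Q: "Q * 4 = 1"
    unfolding Q_def using mconst_hom(4)[of "1/4" "4"] mconst_of_nat[of 4] by (simp add: mconst_hom)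
  have KQ: "mconst ((c + d)\<^sup>2 / 4) = Q * K"
    unfolding K_def Q_def by (simp add: mconst_hom(4)[symmetric])
  have "Q * (K - (a + b) * (a + b) + (a - b) * (a - b)) = Q * K - (Q * 4) * (a * b)"
    "Q * (K - (a - b) * (a - b) + (a + b) * (a + b)) = Q * K + (Q * 4) * (a * b)"
    by (simp_all add: algebra_simps)
  then have eq: "mconst ((c + d)\<^sup>2 / 4) - a * b = Q * (K - (a + b) * (a + b) + (a - b) * (a - b))"
    "mconst ((c + d)\<^sup>2 / 4) + a * b = Q * (K - (a - b) * (a - b) + (a + b) * (a + b))"
    by (simp_all add: Q KQ)
  have "sos_in V Q" by (simp add: Q_def sos_mconst)
  then have "mconst ((c + d)\<^sup>2 / 4) - a * b \<in> qm V gs" "mconst ((c + d)\<^sup>2 / 4) + a * b \<in> qm V gs"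
    unfolding eq K_def using 1 2 sq by (blast intro: qm_mult_sos qm_add qm_sos)+
  moreover have "mvars (a * b) \<subseteq> V"
    using assms by (intro mvars_mult) (simp_all add: bounded_by_def)
  moreover have "(c + d)\<^sup>2 / 4 > 0"
    using assms by (simp add: bounded_by_def)
  ultimately show ?thesis by (simp add: bounded_by_def)
qed

text \<open>The constant c is chosen before t, whereas q may vary with t. Hence for t < 1/c the
  value (1 - tc) + t(c + q) lies in the module.\<close>

definition near_one :: "nat set \<Rightarrow> mpoly list \<Rightarrow> (real \<Rightarrow> mpoly) \<Rightarrow> bool" where
  "near_one V gs P \<longleftrightarrow> (\<exists>c. \<forall>t. 0 \<le> t \<longrightarrow> t \<le> 1 \<longrightarrow>
     (\<exists>q. P t = 1 + mconst t * q \<and> bounded_by V gs q c))"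

lemma near_one_linear: "bounded_by V gs a c \<Longrightarrow> near_one V gs (\<lambda>t. 1 + mconst t * a)"
  by (auto simp: near_one_def)

lemma bounded_by_zero: "c > 0 \<Longrightarrow> bounded_by V gs 0 c"
  using mvars_polys[OF polys_zero] by (simp add: bounded_by_def qm_mconst)

lemma near_one_one: "near_one V gs (\<lambda>t. 1)"
  unfolding near_one_def using bounded_by_zero[of 1] by (intro exI[of _ 1] allI impI exI[of _ 0]) auto

lemma near_one_mult:
  assumes "near_one V gs P" "near_one V gs Q" shows "near_one V gs (\<lambda>t. P t * Q t)"
proof -
  obtain c where c: "\<And>t. 0 \<le> t \<Longrightarrow> t \<le> 1 \<Longrightarrow> \<exists>q. P t = 1 + mconst t * q \<and> bounded_by V gs q c"
    using assms(1) by (auto simp: near_one_def)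
  obtain d where d: "\<And>t. 0 \<le> t \<Longrightarrow> t \<le> 1 \<Longrightarrow> \<exists>q. Q t = 1 + mconst t * q \<and> bounded_by V gs q d"
    using assms(2) by (auto simp: near_one_def)
  show ?thesis unfolding near_one_def
  proof (intro exI[of _ "c + d + (c + d)\<^sup>2 / 4"] allI impI)
    fix t :: real assume t: "0 \<le> t" "t \<le> 1"
    obtain p q where pq: "P t = 1 + mconst t * p" "bounded_by V gs p c"
      "Q t = 1 + mconst t * q" "bounded_by V gs q d"
      using c d t by blast
    have "bounded_by V gs (p + q + mconst t * (p * q)) (c + d + (c + d)\<^sup>2 / 4)"
      using pq t by (intro bounded_by_add bounded_by_scale bounded_by_mult)
    then show "\<exists>q. P t * Q t = 1 + mconst t * q \<and> bounded_by V gs q (c + d + (c + d)\<^sup>2 / 4)"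
      by (intro exI[of _ "p + q + mconst t * (p * q)"]) (simp add: pq algebra_simps)
  qed
qed

lemma near_one_prod:
  "(\<And>i. i \<in> I \<Longrightarrow> near_one V gs (P i)) \<Longrightarrow> near_one V gs (\<lambda>t. \<Prod>i\<in>I. P i t)"
  by (induction I rule: infinite_finite_induct) (auto intro: near_one_mult near_one_one)

lemma near_one_qm:
  assumes "near_one V gs P" shows "eventually (\<lambda>t. P t \<in> qm V gs) (at_right 0)"
proof -
  obtain c where c: "\<And>t. 0 \<le> t \<Longrightarrow> t \<le> 1 \<Longrightarrow> \<exists>q. P t = 1 + mconst t * q \<and> bounded_by V gs q c"
    using assms(1) by (auto simp: near_one_def)
  have c0: "c > 0" using c[of 0] unfolding bounded_by_def by (metis order_refl zero_le_one)
  have "P t \<in> qm V gs" if t: "0 < t" "t < min 1 (1 / c)" for t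
  proof -
    obtain q where q: "P t = 1 + mconst t * q" "bounded_by V gs q c" using c[of t] t by auto
    have "P t = mconst (1 - t * c) + mconst t * (mconst c + q)"
      by (simp add: q mconst_hom algebra_simps)
    also have "\<dots> \<in> qm V gs"
      using q t c0 by (intro qm_add[OF qm_mconst qm_mult_sos[OF sos_mconst]])
        (auto simp: bounded_by_def field_simps)
    finally show ?thesis .
  qed
  then show ?thesis
    using c0 by (intro eventually_at_rightI[of 0 "min 1 (1 / c)"]) auto
qed

text \<open>\<open>box_u\<close> and \<open>box_v\<close> are the barycentric coordinates of
  [-R, R]: nonnegative there, with sum 1. Up to the factor 1/2 both have the form 1 + t a with t =
  1/R, as \<open>near_one_linear\<close> expects.\<close>

definition box_u :: "real \<Rightarrow> nat \<Rightarrow> mpoly" where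
  "box_u R j = mconst (1 / 2) * (1 + mconst (1 / R) * mvar j)"

definition box_v :: "real \<Rightarrow> nat \<Rightarrow> mpoly" where
  "box_v R j = mconst (1 / 2) * (1 + mconst (1 / R) * (- mvar j))"

text \<open>Adding back the squares of the other variables leaves N - X_j^2, and N + 1/4 + a = (N -
  a^2) + (1/2 + a)^2 for a = X_j and a = -X_j.\<close>

lemma archimedean_bounded_var:
  assumes "archimedean_qm n gs" "j < n"
  shows "\<exists>c. bounded_by {..<n} gs (mvar j) c"
proof -
  obtain N :: nat where N: "mconst (real N) - (\<Sum>i<n. mvar i * mvar i) \<in> qm {..<n} gs"
    using assms(1) qmodule_qmd[of _ "{..<n}" gs] unfolding archimedean_qm_def qm_def UN_iff by blast
  have mv: "mvar i \<in> polys {..<n} 1" if "i < n" for i using that by (intro polys_mvar) simp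
  have rest: "(\<Sum>i\<in>{..<n} - {j}. mvar i * mvar i) \<in> qm {..<n} gs"
    by (rule qm_sos, rule sos_sum, rule sos_square, rule mvars_polys, rule mv) simp
  have split: "(\<Sum>i<n. mvar i * mvar i) = mvar j * mvar j + (\<Sum>i\<in>{..<n} - {j}. mvar i * mvar i)"
    using assms(2) by (intro sum.remove) auto
  have 1: "mconst (real N) - mvar j * mvar j \<in> qm {..<n} gs"
    using qm_add[OF N rest] by (simp add: split)
  have 2: "mconst (real N + 1/4) + a \<in> qm {..<n} gs"
    if a: "a * a = mvar j * mvar j" "a \<in> polys {..<n} 1" for a
  proof -
    define h where "h = mconst (1 / 2)"
    have h: "h + h = 1" "h * h = mconst (1 / 4)"
      by (simp_all add: h_def mconst_hom(2-4)[symmetric])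
    have "(h + a) * (h + a) = h * h + (h + h) * a + a * a" by (simp add: algebra_simps)
    then have "(h + a) * (h + a) = mconst (1/4) + a + mvar j * mvar j" unfolding h a by simp
    moreover have "sos_in {..<n} ((h + a) * (h + a))"
      unfolding h_def using a(2) by (intro sos_square mvars_polys[OF polys_add]) auto
    ultimately have "mconst (1/4) + a + mvar j * mvar j \<in> qm {..<n} gs" by (simp add: qm_sos)
    from qm_add[OF 1 this] show ?thesis by (simp add: mconst_hom(3) add_ac)
  qed
  have "mvar j \<in> polys {..<n} 1" using assms(2) by (rule mv)
  then have "bounded_by {..<n} gs (mvar j) (real N + 1/4)"
    using 2[of "mvar j"] 2[of "- mvar j"] polys_uminus[of "mvar j" "{..<n}" 1]
      mvars_polys[of "mvar j" "{..<n}" 1]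
    by (simp add: bounded_by_def)
  then show ?thesis ..
qed

text \<open>Up to a positive constant each product is a perturbation of 1 with parameter t = 1/R.
  There are finitely many pairs J, J', so one small t and one degree serve all of them.\<close>

lemma archimedean_box:
  assumes "archimedean_qm n gs"
  shows "\<exists>R\<ge>R0. \<exists>T. \<forall>J\<subseteq>{..<n}. \<forall>J'\<subseteq>{..<n}.
    prod (box_u R) J * prod (box_v R) J' \<in> qmd {..<n} gs T"
proof -
  define P where "P J J' t = (\<Prod>j\<in>J. 1 + mconst t * mvar j) * (\<Prod>j\<in>J'. 1 + mconst t * (- mvar j))" for J J' t
  have lin: "near_one {..<n} gs (\<lambda>t. 1 + mconst t * mvar j)"
    "near_one {..<n} gs (\<lambda>t. 1 + mconst t * (- mvar j))" if "j < n" for j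
    using archimedean_bounded_var[OF assms that] by (blast intro: near_one_linear bounded_by_uminus)+
  have "eventually (\<lambda>t. P J J' t \<in> qm {..<n} gs) (at_right 0)"
    if "J \<subseteq> {..<n}" "J' \<subseteq> {..<n}" for J J'
    unfolding P_def using that by (intro near_one_qm near_one_mult near_one_prod lin) auto
  then have "eventually (\<lambda>t. \<forall>(J, J')\<in>Pow {..<n} \<times> Pow {..<n}. P J J' t \<in> qm {..<n} gs) (at_right 0)"
    by (intro eventually_ball_finite) auto
  moreover have "eventually (\<lambda>t::real. t < 1 / max 1 R0) (at_right 0)"
    by (rule eventually_at_rightI[of 0 "1 / max 1 R0"]) auto
  moreover have "eventually (\<lambda>t::real. t > 0) (at_right 0)"
    by (rule eventually_at_rightI[of 0 1]) auto
  ultimately have "eventually (\<lambda>t. (\<forall>(J, J')\<in>Pow {..<n} \<times> Pow {..<n}. P J J' t \<in> qm {..<n} gs)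
      \<and> t < 1 / max 1 R0 \<and> t > 0) (at_right 0)"
    by eventually_elim auto
  then obtain t where t: "\<And>J J'. J \<subseteq> {..<n} \<Longrightarrow> J' \<subseteq> {..<n} \<Longrightarrow> P J J' t \<in> qm {..<n} gs"
    "t < 1 / max 1 R0" "t > 0"
    using eventually_happens[of _ "at_right (0::real)"] by fastforce
  define R where "R = 1 / t"
  have "max 1 R0 < 1 / t" using t by (simp add: less_divide_eq mult.commute pos_less_divide_eq)
  then have R: "R \<ge> R0" "1 / R = t" by (simp_all add: R_def)
  have eq: "prod (box_u R) J * prod (box_v R) J' = mconst ((1/2) ^ card J * (1/2) ^ card J') * P J J' t" for J J'
    by (simp add: box_u_def [abs_def] box_v_def[abs_def] R P_def prod.distrib mconst_hom mconst_power mult_ac)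
  have "\<exists>T. prod (box_u R) J * prod (box_v R) J' \<in> qmd {..<n} gs T"
    if "J \<subseteq> {..<n}" "J' \<subseteq> {..<n}" for J J'
  proof -
    have "mconst ((1/2) ^ card J * (1/2) ^ card J') * P J J' t \<in> qm {..<n} gs"
      using t(1)[OF that] by (intro qm_mult_sos sos_mconst) auto
    then show ?thesis by (simp add: eq qm_def)
  qed
  then obtain T where T: "\<And>J J'. J \<subseteq> {..<n} \<Longrightarrow> J' \<subseteq> {..<n} \<Longrightarrow>
      prod (box_u R) J * prod (box_v R) J' \<in> qmd {..<n} gs (T J J')" by metis
  define T' where "T' = (\<Sum>(J, J')\<in>Pow {..<n} \<times> Pow {..<n}. T J J')"
  have "T J J' \<le> T'" if "J \<subseteq> {..<n}" "J' \<subseteq> {..<n}" for J J'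
    using member_le_sum[of "(J, J')" "Pow {..<n} \<times> Pow {..<n}" "\<lambda>(J, J'). T J J'"] that
    by (simp add: T'_def)
  then show ?thesis
    using R(1) T by (intro exI[of _ R] conjI exI[of _ T']) (blast intro: qmd_mono)+
qed

section \<open>Bernstein expansion on a box\<close>

lemma power_bernstein:
  fixes u v :: "'a :: comm_ring_1"
  assumes "u + v = 1" "i \<le> N"
  shows "u ^ i = (\<Sum>k\<le>N. (if i \<le> k then of_nat ((N - i) choose (k - i)) else 0) * (u ^ k * v ^ (N - k)))"
proof -
  have "u ^ i = u ^ i * (u + v) ^ (N - i)" using assms by simp
  also have "\<dots> = (\<Sum>l\<le>N - i. of_nat ((N - i) choose l) * (u ^ (l + i) * v ^ (N - i - l)))"
    by (simp add: binomial_ring sum_distrib_left power_add mult_ac)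
  also have "\<dots> = (\<Sum>k\<in>{i..N}. of_nat ((N - i) choose (k - i)) * (u ^ k * v ^ (N - k)))"
    by (rule sum.reindex_bij_witness[of _ "\<lambda>k. k - i" "\<lambda>l. l + i"]) (use assms in \<open>auto simp: add.commute\<close>)
  also have "\<dots> = (\<Sum>k\<le>N. (if i \<le> k then of_nat ((N - i) choose (k - i)) else 0) * (u ^ k * v ^ (N - k)))"
    by (rule sum.mono_neutral_cong_left) auto
  finally show ?thesis .
qed

text \<open>Coefficient of u^i with respect to \<open>(N choose k) * u ^ k * v ^ (N - k)\<close>; it
  discretizes (k/N)^i.\<close>

definition bern_coeff :: "nat \<Rightarrow> nat \<Rightarrow> nat \<Rightarrow> real" where
  "bern_coeff N k i = real (k choose i) / real (N choose i)"

lemma bern_coeff_mult: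
  assumes "i \<le> N" "k \<le> N"
  shows "bern_coeff N k i * real (N choose k) = (if i \<le> k then real ((N - i) choose (k - i)) else 0)"
proof (cases "i \<le> k")
  case True
  have "(N choose k) * (k choose i) = (N choose i) * ((N - i) choose (k - i))"
    using choose_mult[OF True assms(2)] .
  then have "real (k choose i) * real (N choose k) = real (N choose i) * real ((N - i) choose (k - i))"
    by (metis of_nat_mult mult.commute)
  moreover have "real (N choose i) > 0" using assms by simp
  ultimately show ?thesis using True by (simp add: bern_coeff_def field_simps)
qed (simp add: bern_coeff_def)

text \<open>Natural subtraction makes a factor vanish as soon as k < i, in agreement with
  \<open>k choose i\<close> being 0.\<close>

lemma bern_coeff_prod:
  assumes "i \<le> N"
  shows "bern_coeff N k i = (\<Prod>l<i. real (k - l) / real (N - l))"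
proof -
  have *: "real (m choose i) = (\<Prod>l<i. real (m - l)) / fact i" for m
  proof (cases "i \<le> m")
    case True
    then show ?thesis
      by (simp add: binomial_gbinomial gbinomial_prod_rev atLeast0LessThan of_nat_diff)
  next
    case False
    then have "(\<Prod>l<i. real (m - l)) = 0" "m choose i = 0" by (auto intro!: prod_zero bexI[of _ m])
    then show ?thesis by (metis div_0 of_nat_0)
  qed
  show ?thesis by (simp add: bern_coeff_def * prod_dividef)
qed

text \<open>There are i factors of modulus at most 1, each within i/N of k/N; telescoping gives
  i^2/N.\<close>

lemma bern_coeff_approx:
  assumes "i \<le> N" "k \<le> N"
  shows "\<bar>bern_coeff N k i - (real k / real N) ^ i\<bar> \<le> real i ^ 2 / real N"
    and "\<bar>bern_coeff N k i\<bar> \<le> 1"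
proof -
  have factor: "\<bar>real (k - l) / real (N - l) - real k / real N\<bar> \<le> real i / real N" if "l < i" for l
  proof -
    have lN: "l < N" using that assms by simp
    have "\<bar>real (k - l) / real (N - l) - real k / real N\<bar> \<le> real l / real N"
    proof (cases "l \<le> k")
      case True
      define q where "q = (real N - real k) / (real N - real l)"
      have eq: "real (k - l) / real (N - l) - real k / real N = - (real l / real N * q)"
        using True lN by (simp add: q_def of_nat_diff field_simps)
      have q: "0 \<le> q" "q \<le> 1" using True lN assms by (auto simp: q_def)
      have "\<bar>real (k - l) / real (N - l) - real k / real N\<bar> = real l / real N * q"
        unfolding eq using q by (simp add: abs_mult)
      also have "\<dots> \<le> real l / real N" using q by (intro mult_left_le) auto
      finally show ?thesis .
    next
      case False
      then show ?thesis by (simp add: divide_right_mono)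
    qed
    also have "\<dots> \<le> real i / real N" using that by (simp add: divide_right_mono)
    finally show ?thesis .
  qed
  have le1: "norm (real (k - l) / real (N - l)) \<le> 1" if "l < i" for l
    using that assms by (simp add: divide_le_eq)
  have "norm ((\<Prod>l<i. real (k - l) / real (N - l)) - (\<Prod>l<i. real k / real N))
      \<le> (\<Sum>l<i. norm (real (k - l) / real (N - l) - real k / real N))"
    using assms le1 by (intro norm_prod_diff) (auto simp: divide_le_eq)
  also have "\<dots> \<le> (\<Sum>l<i. real i / real N)" using factor by (intro sum_mono) auto
  finally show "\<bar>bern_coeff N k i - (real k / real N) ^ i\<bar> \<le> real i ^ 2 / real N"
    using assms by (simp add: bern_coeff_prod power2_eq_square)
  show "\<bar>bern_coeff N k i\<bar> \<le> 1"
    using assms le1 unfolding bern_coeff_prod[OF assms(1)] abs_prod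
    by (intro prod_le_1) auto
qed

definition bern1 :: "real \<Rightarrow> nat \<Rightarrow> nat \<Rightarrow> nat \<Rightarrow> mpoly" where
  "bern1 R N j k = of_nat (N choose k) * (box_u R j ^ k * box_v R j ^ (N - k))"

lemma box_uv:
  assumes "R > 0"
  shows "box_u R j + box_v R j = 1" "mvar j = mconst R * (2 * box_u R j - 1)"
proof -
  define h where "h = mconst (1 / 2)"
  have h: "h + h = 1" by (simp add: h_def mconst_hom(2-4)[symmetric])
  have "box_u R j + box_v R j = h + h" by (simp add: box_u_def box_v_def h_def algebra_simps)
  then show "box_u R j + box_v R j = 1" by (simp add: h)
  have "2 * box_u R j - 1 = (h + h) * (1 + mconst (1 / R) * mvar j) - 1"
    by (simp add: box_u_def h_def algebra_simps)
  then have "mconst R * (2 * box_u R j - 1) = (mconst R * mconst (1 / R)) * mvar j"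
    by (simp add: h)
  then show "mvar j = mconst R * (2 * box_u R j - 1)"
    using assms by (simp add: mconst_hom(2,4)[symmetric])
qed

lemma power_binomial_expand:
  fixes u :: "'a :: comm_ring_1"
  shows "(2 * u - 1) ^ a = (\<Sum>i\<le>a. of_nat (a choose i) * 2 ^ i * (-1) ^ (a - i) * u ^ i)"
  using binomial_ring[of "2 * u" "-1" a] by (simp add: power_mult_distrib mult_ac)

text \<open>Substitute X = R(2u - 1) and expand. The absolute coefficients of (2u - 1)^a add up to
  (2 + 1)^a, which is the origin of the factor (3R)^a in all Bernstein estimates.\<close>

lemma monomial_bernstein1:
  assumes "R \<ge> 1" "a \<le> N" "N > 0"
  shows "\<exists>\<beta>. mvar j ^ a = (\<Sum>k\<le>N. mconst (\<beta> k) * bern1 R N j k) \<and>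
    (\<forall>k\<le>N. \<bar>\<beta> k\<bar> \<le> (3 * R) ^ a \<and>
      \<bar>\<beta> k - (R * (2 * real k / real N - 1)) ^ a\<bar> \<le> (3 * R) ^ a * (real a ^ 2 / real N))"
proof -
  define w where "w i = R ^ a * (real (a choose i) * 2 ^ i * (-1) ^ (a - i))" for i
  define \<beta> where "\<beta> k = (\<Sum>i\<le>a. w i * bern_coeff N k i)" for k
  have m: "mconst 2 = 2" "mconst (-1) = -1" using mconst_of_nat[of 2] mconst_hom(6)[of 1] by (simp_all add: mconst_hom(2))
  have wsum: "(\<Sum>i\<le>a. \<bar>w i\<bar>) = (3 * R) ^ a"
    using binomial_ring[of "2::real" 1 a] assms
    by (simp add: w_def abs_mult power_mult_distrib sum_distrib_left[symmetric] mult.commute)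
  have ui: "box_u R j ^ i = (\<Sum>k\<le>N. mconst (bern_coeff N k i) * bern1 R N j k)" if "i \<le> a" for i
  proof -
    have "box_u R j ^ i = (\<Sum>k\<le>N. (if i \<le> k then of_nat ((N - i) choose (k - i)) else 0)
        * (box_u R j ^ k * box_v R j ^ (N - k)))"
      using assms that by (intro power_bernstein box_uv) auto
    also have "\<dots> = (\<Sum>k\<le>N. mconst (bern_coeff N k i * real (N choose k)) * (box_u R j ^ k * box_v R j ^ (N - k)))"
      using assms that by (intro sum.cong refl) (auto simp: bern_coeff_mult mconst_of_nat mconst_hom(1))
    finally show ?thesis by (simp add: bern1_def mconst_hom(4) mconst_of_nat mult.assoc)
  qed
  have "mvar j ^ a = mconst R ^ a * (2 * box_u R j - 1) ^ a"
    using assms box_uv(2)[of R j] by (simp add: power_mult_distrib[symmetric])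
  also have "\<dots> = (\<Sum>i\<le>a. mconst (w i) * box_u R j ^ i)"
    unfolding power_binomial_expand
    by (simp add: sum_distrib_left w_def mconst_hom(4) mconst_power mconst_of_nat m mult_ac)
  also have "\<dots> = (\<Sum>i\<le>a. \<Sum>k\<le>N. mconst (w i) * (mconst (bern_coeff N k i) * bern1 R N j k))"
    by (intro sum.cong refl) (simp add: ui sum_distrib_left)
  also have "\<dots> = (\<Sum>k\<le>N. \<Sum>i\<le>a. mconst (w i) * (mconst (bern_coeff N k i) * bern1 R N j k))"
    by (rule sum.swap)
  also have "\<dots> = (\<Sum>k\<le>N. mconst (\<beta> k) * bern1 R N j k)"
    by (simp add: \<beta>_def mconst_sum mconst_hom(4) sum_distrib_right mult.assoc)
  finally have 1: "mvar j ^ a = (\<Sum>k\<le>N. mconst (\<beta> k) * bern1 R N j k)" .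
  have 2: "\<bar>\<beta> k\<bar> \<le> (3 * R) ^ a" if "k \<le> N" for k
  proof -
    have "\<bar>\<beta> k\<bar> \<le> (\<Sum>i\<le>a. \<bar>w i * bern_coeff N k i\<bar>)" unfolding \<beta>_def by (rule sum_abs)
    also have "\<dots> \<le> (\<Sum>i\<le>a. \<bar>w i\<bar>)"
      using bern_coeff_approx(2)[OF _ that] assms by (intro sum_mono) (auto simp: abs_mult intro!: mult_left_le)
    finally show ?thesis by (simp add: wsum)
  qed
  have 3: "\<bar>\<beta> k - (R * (2 * real k / real N - 1)) ^ a\<bar> \<le> (3 * R) ^ a * (real a ^ 2 / real N)"
    if "k \<le> N" for k
  proof -
    have "(R * (2 * real k / real N - 1)) ^ a = R ^ a * (2 * (real k / real N) - 1) ^ a"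
      by (simp add: power_mult_distrib)
    also have "\<dots> = (\<Sum>i\<le>a. w i * (real k / real N) ^ i)"
      unfolding power_binomial_expand by (simp add: w_def sum_distrib_left mult_ac)
    finally have "\<beta> k - (R * (2 * real k / real N - 1)) ^ a
        = (\<Sum>i\<le>a. w i * (bern_coeff N k i - (real k / real N) ^ i))"
      by (simp add: \<beta>_def sum_subtractf right_diff_distrib)
    also have "\<bar>\<dots>\<bar> \<le> (\<Sum>i\<le>a. \<bar>w i * (bern_coeff N k i - (real k / real N) ^ i)\<bar>)" by (rule sum_abs)
    also have "\<dots> \<le> (\<Sum>i\<le>a. \<bar>w i\<bar> * (real a ^ 2 / real N))"
    proof (rule sum_mono)
      fix i assume "i \<in> {..a}"
      then have "\<bar>bern_coeff N k i - (real k / real N) ^ i\<bar> \<le> real i ^ 2 / real N"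
        using assms that by (intro bern_coeff_approx) auto
      also have "\<dots> \<le> real a ^ 2 / real N"
        using \<open>i \<in> {..a}\<close> by (intro divide_right_mono power_mono) auto
      finally show "\<bar>w i * (bern_coeff N k i - (real k / real N) ^ i)\<bar> \<le> \<bar>w i\<bar> * (real a ^ 2 / real N)"
        unfolding abs_mult by (rule mult_left_mono) simp
    qed
    finally show ?thesis unfolding sum_distrib_right[symmetric] wsum .
  qed
  show ?thesis using 1 2 3 by blast
qed

section \<open>Bernstein expansion in several variables\<close>

abbreviation multi :: "nat \<Rightarrow> nat \<Rightarrow> (nat \<Rightarrow> nat) set" where
  "multi n N \<equiv> {..<n} \<rightarrow>\<^sub>E {..N}"

definition bern :: "nat \<Rightarrow> real \<Rightarrow> nat \<Rightarrow> (nat \<Rightarrow> nat) \<Rightarrow> mpoly" where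
  "bern n R N K = (\<Prod>j<n. bern1 R N j (K j))"

text \<open>The node of the box attached to a multi-index: the Bernstein coefficient at
  \<open>K\<close> approximates the value of the polynomial there.\<close>

definition grid :: "real \<Rightarrow> nat \<Rightarrow> (nat \<Rightarrow> nat) \<Rightarrow> nat \<Rightarrow> real" where
  "grid R N K j = R * (2 * real (K j) / real N - 1)"

lemma grid_bound:
  assumes "R \<ge> 0" "N > 0" "K j \<le> N" shows "\<bar>grid R N K j\<bar> \<le> R"
proof -
  have q: "0 \<le> real (K j) / real N" "real (K j) / real N \<le> 1"
    using assms by (auto simp: divide_le_eq)
  have "\<bar>2 * real (K j) / real N - 1\<bar> \<le> 1" using q by (simp add: abs_le_iff)
  then have "\<bar>grid R N K j\<bar> \<le> R * 1" unfolding grid_def abs_mult using assms by (intro mult_mono) auto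
  then show ?thesis by simp
qed

lemma single_as_prod:
  assumes "finite S" "keys mo \<subseteq> S"
  shows "single mo 1 = (\<Prod>j\<in>S. mvar j ^ lookup mo j)"
proof -
  have pow: "mvar j ^ k = single (single j k) 1" for j k
    by (induction k) (simp_all add: mvar_def mult_single single_add[symmetric])
  have "(\<Prod>j\<in>S. mvar j ^ lookup mo j) = single (\<Sum>j\<in>S. single j (lookup mo j)) 1"
    using assms(1) by induction (simp_all add: pow mult_single)
  also have "(\<Sum>j\<in>S. single j (lookup mo j)) = mo"
    using assms by (intro poly_mapping_eqI) (auto simp: lookup_sum lookup_single when_def in_keys_iff)
  finally show ?thesis by simp
qed

text \<open>The coefficients are products of the univariate ones. Dividing the j-th factor by
  (3R)^(e_j) brings all factors into [-1, 1], where telescoping applies; the errors e_j^2/N then add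
  up to at most D^2/N, since each e_j is at most D and their sum is at most D.\<close>

lemma monomial_bernstein:
  assumes "R \<ge> 1" "keys mo \<subseteq> {..<n}" "mon_deg_in UNIV mo \<le> D" "D \<le> N" "N > 0"
  shows "\<exists>b. single mo 1 = (\<Sum>K\<in>multi n N. mconst (b K) * bern n R N K) \<and>
    (\<forall>K\<in>multi n N. \<bar>b K - mon (grid R N K) mo\<bar> \<le> (3 * R) ^ D * (real D ^ 2 / real N))"
proof -
  let ?e = "lookup mo"
  have deg: "mon_deg_in UNIV mo = (\<Sum>j<n. ?e j)" using assms by (subst mon_deg_superset[of "{..<n}"]) auto
  have le: "?e j \<le> D" if "j < n" for j
    using assms member_le_sum[of j "{..<n}" ?e] that by (simp add: deg)
  have "\<forall>j\<in>{..<n}. \<exists>\<beta>. mvar j ^ ?e j = (\<Sum>k\<le>N. mconst (\<beta> k) * bern1 R N j k) \<and>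
    (\<forall>k\<le>N. \<bar>\<beta> k\<bar> \<le> (3 * R) ^ ?e j \<and>
      \<bar>\<beta> k - (R * (2 * real k / real N - 1)) ^ ?e j\<bar> \<le> (3 * R) ^ ?e j * (real (?e j) ^ 2 / real N))"
    using assms le by (intro ballI monomial_bernstein1) (auto intro: order_trans)
  from bchoice[OF this] obtain \<beta> where \<beta>: "\<And>j. j < n \<Longrightarrow> mvar j ^ ?e j = (\<Sum>k\<le>N. mconst (\<beta> j k) * bern1 R N j k)"
    "\<And>j k. j < n \<Longrightarrow> k \<le> N \<Longrightarrow> \<bar>\<beta> j k\<bar> \<le> (3 * R) ^ ?e j"
    "\<And>j k. j < n \<Longrightarrow> k \<le> N \<Longrightarrow> \<bar>\<beta> j k - (R * (2 * real k / real N - 1)) ^ ?e j\<bar>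
       \<le> (3 * R) ^ ?e j * (real (?e j) ^ 2 / real N)"
    unfolding lessThan_iff Ball_def by blast
  define b where "b K = (\<Prod>j<n. \<beta> j (K j))" for K
  have "single mo 1 = (\<Prod>j<n. \<Sum>k\<le>N. mconst (\<beta> j k) * bern1 R N j k)"
    using assms \<beta>(1) by (subst single_as_prod[of "{..<n}"]) auto
  also have "\<dots> = (\<Sum>K\<in>multi n N. \<Prod>j<n. mconst (\<beta> j (K j)) * bern1 R N j (K j))"
    by (subst prod_sum_PiE) auto
  also have "\<dots> = (\<Sum>K\<in>multi n N. mconst (b K) * bern n R N K)"
    by (simp add: prod.distrib b_def mconst_prod bern_def)
  finally have 1: "single mo 1 = (\<Sum>K\<in>multi n N. mconst (b K) * bern n R N K)" .
  have 2: "\<bar>b K - mon (grid R N K) mo\<bar> \<le> (3 * R) ^ D * (real D ^ 2 / real N)"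
    if "K \<in> multi n N" for K
  proof -
    have K: "K j \<le> N" if "j < n" for j using that \<open>K \<in> _\<close> by auto
    define s where "s j = (3 * R) ^ ?e j" for j
    have s: "s j > 0" for j using assms by (simp add: s_def)
    define g where "g j = grid R N K j ^ ?e j" for j
    have gle: "\<bar>g j\<bar> \<le> s j" if "j < n" for j
    proof -
      have "\<bar>grid R N K j\<bar> \<le> R" using K[OF that] assms by (intro grid_bound) auto
      also have "\<dots> \<le> 3 * R" using assms by simp
      finally have "\<bar>grid R N K j\<bar> ^ ?e j \<le> (3 * R) ^ ?e j" by (intro power_mono) auto
      then show ?thesis by (simp add: g_def s_def power_abs)
    qed
    have \<beta>s: "\<bar>\<beta> j (K j)\<bar> \<le> s j" "\<bar>\<beta> j (K j) - g j\<bar> \<le> s j * (real (?e j) ^ 2 / real N)" if "j < n" for j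
      using \<beta>(2,3)[OF that K[OF that]] by (auto simp: s_def g_def grid_def)
    have prod_s: "(\<Prod>j<n. s j) \<le> (3 * R) ^ D"
      using assms unfolding s_def power_sum[symmetric] deg[symmetric] by (intro power_increasing) auto
    have div1: "norm (x / s j) \<le> 1" if "\<bar>x\<bar> \<le> s j" for x j
      using that s[of j] by (simp add: abs_of_pos)
    have "norm ((\<Prod>j<n. \<beta> j (K j) / s j) - (\<Prod>j<n. g j / s j))
        \<le> (\<Sum>j<n. norm (\<beta> j (K j) / s j - g j / s j))"
      using \<beta>s(1) gle by (intro norm_prod_diff div1) auto
    also have "\<dots> \<le> (\<Sum>j<n. real (?e j) ^ 2 / real N)"
    proof (rule sum_mono)
      fix j assume "j \<in> {..<n}"
      then show "norm (\<beta> j (K j) / s j - g j / s j) \<le> real (?e j) ^ 2 / real N"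
        using \<beta>s(2)[of j] s[of j] by (simp add: diff_divide_distrib[symmetric] pos_divide_le_eq mult.commute)
    qed
    also have "\<dots> \<le> (\<Sum>j<n. real D * real (?e j) / real N)"
      using le by (intro sum_mono divide_right_mono) (auto simp: power2_eq_square intro: mult_right_mono)
    also have "\<dots> = real D * real (\<Sum>j<n. ?e j) / real N"
      by (simp add: sum_divide_distrib[symmetric] sum_distrib_left)
    also have "\<dots> \<le> real D ^ 2 / real N"
      using assms(3) unfolding power2_eq_square deg
      by (intro divide_right_mono mult_left_mono) (auto simp del: of_nat_sum)
    finally have d: "\<bar>(\<Prod>j<n. \<beta> j (K j) / s j) - (\<Prod>j<n. g j / s j)\<bar> \<le> real D ^ 2 / real N" by simp
    have "(\<Prod>j<n. s j) \<noteq> 0" using s by (simp add: less_le)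
    then have "(\<Prod>j<n. s j) * ((\<Prod>j<n. \<beta> j (K j) / s j) - (\<Prod>j<n. g j / s j)) = b K - (\<Prod>j<n. g j)"
      by (simp add: prod_dividef b_def right_diff_distrib)
    moreover have "(\<Prod>j<n. g j) = mon (grid R N K) mo"
      using assms by (simp add: mon_superset[of "{..<n}"] g_def)
    ultimately have "\<bar>b K - mon (grid R N K) mo\<bar>
        = (\<Prod>j<n. s j) * \<bar>(\<Prod>j<n. \<beta> j (K j) / s j) - (\<Prod>j<n. g j / s j)\<bar>"
      using s by (metis abs_mult abs_of_pos prod_pos)
    also have "\<dots> \<le> (3 * R) ^ D * (real D ^ 2 / real N)"
      using prod_s d assms by (intro mult_mono) auto
    finally show ?thesis .
  qed
  show ?thesis using 1 2 by blast
qed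

text \<open>Linear extension over the monomials. The error decays like 1/N, so a positive margin at
  the nodes survives in the coefficients once N is large.\<close>

lemma poly_bernstein:
  assumes "R \<ge> 1" "p \<in> polys {..<n} D" "D \<le> N" "N > 0"
  shows "\<exists>b. p = (\<Sum>K\<in>multi n N. mconst (b K) * bern n R N K) \<and>
    (\<forall>K\<in>multi n N. \<bar>b K - meval p (grid R N K)\<bar> \<le> l1 p * ((3 * R) ^ D * (real D ^ 2 / real N)))"
proof -
  let ?E = "(3 * R) ^ D * (real D ^ 2 / real N)"
  have "\<forall>mo\<in>keys p. \<exists>b. single mo 1 = (\<Sum>K\<in>multi n N. mconst (b K) * bern n R N K) \<and>
    (\<forall>K\<in>multi n N. \<bar>b K - mon (grid R N K) mo\<bar> \<le> ?E)"
    using assms by (intro ballI monomial_bernstein) (auto simp: polys_iff)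
  from bchoice[OF this] obtain b where b: "\<And>mo. mo \<in> keys p \<Longrightarrow>
      single mo 1 = (\<Sum>K\<in>multi n N. mconst (b mo K) * bern n R N K)"
    "\<And>mo K. mo \<in> keys p \<Longrightarrow> K \<in> multi n N \<Longrightarrow> \<bar>b mo K - mon (grid R N K) mo\<bar> \<le> ?E"
    by blast
  define B where "B K = (\<Sum>mo\<in>keys p. lookup p mo * b mo K)" for K
  have "p = (\<Sum>mo\<in>keys p. mconst (lookup p mo) * single mo 1)"
    by (subst mpoly_sum_singles[of p]) (simp add: mconst_def mult_single)
  also have "\<dots> = (\<Sum>mo\<in>keys p. \<Sum>K\<in>multi n N. mconst (lookup p mo) * (mconst (b mo K) * bern n R N K))"
    by (intro sum.cong refl) (simp add: b(1) sum_distrib_left)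
  also have "\<dots> = (\<Sum>K\<in>multi n N. \<Sum>mo\<in>keys p. mconst (lookup p mo) * (mconst (b mo K) * bern n R N K))"
    by (rule sum.swap)
  also have "\<dots> = (\<Sum>K\<in>multi n N. mconst (B K) * bern n R N K)"
    by (simp add: B_def mconst_sum mconst_hom(4) sum_distrib_right mult.assoc)
  finally have 1: "p = (\<Sum>K\<in>multi n N. mconst (B K) * bern n R N K)" .
  have 2: "\<bar>B K - meval p (grid R N K)\<bar> \<le> l1 p * ?E" if "K \<in> multi n N" for K
  proof -
    have "\<bar>B K - meval p (grid R N K)\<bar> \<le> (\<Sum>mo\<in>keys p. \<bar>lookup p mo * (b mo K - mon (grid R N K) mo)\<bar>)"
      unfolding meval_alt B_def sum_subtractf[symmetric] right_diff_distrib[symmetric] by (rule sum_abs)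
    also have "\<dots> \<le> (\<Sum>mo\<in>keys p. \<bar>lookup p mo\<bar> * ?E)"
      unfolding abs_mult by (intro sum_mono mult_left_mono b(2)[OF _ that]) auto
    finally show ?thesis by (simp only: l1_def sum_distrib_right)
  qed
  show ?thesis using 1 2 by blast
qed

lemma box_polys: "j < n \<Longrightarrow> box_u R j \<in> polys {..<n} 1" "j < n \<Longrightarrow> box_v R j \<in> polys {..<n} 1"
  unfolding box_u_def box_v_def
  by (intro polys_mult_const polys_add polys_uminus polys_mvar polys_one; simp)+

text \<open>Modulo squares, a Bernstein basis polynomial is one of finitely many squarefree products.\<close>

lemma bern_qmd:
  assumes T: "\<And>J J'. J \<subseteq> {..<n} \<Longrightarrow> J' \<subseteq> {..<n} \<Longrightarrow> prod (box_u R) J * prod (box_v R) J' \<in> qmd {..<n} gs T"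
    and K: "\<And>j. j < n \<Longrightarrow> K j \<le> N"
  shows "bern n R N K \<in> qmd {..<n} gs (2 * n * N + T)"
proof -
  define s where "s = (\<Prod>j<n. box_u R j ^ (K j div 2) * box_v R j ^ ((N - K j) div 2))"
  define J where "J = {j\<in>{..<n}. odd (K j)}"
  define J' where "J' = {j\<in>{..<n}. odd (N - K j)}"
  define C where "C = (\<Prod>j<n. real (N choose K j))"
  have pw: "x ^ k = x ^ (k div 2) * x ^ (k div 2) * (if odd k then x else 1)" for x :: mpoly and k
  proof -
    have "x ^ k = x ^ (k div 2 + k div 2 + k mod 2)" by (simp add: mult_2[symmetric])
    then show ?thesis by (simp add: power_add mod2_eq_if)
  qed
  have uJ: "prod (box_u R) J = (\<Prod>j<n. if odd (K j) then box_u R j else 1)"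
    and vJ: "prod (box_v R) J' = (\<Prod>j<n. if odd (N - K j) then box_v R j else 1)"
    unfolding J_def J'_def by (simp_all only: prod.inter_filter[OF finite_lessThan])
  have "bern n R N K = (\<Prod>j<n. mconst (real (N choose K j)) *
      ((box_u R j ^ (K j div 2) * box_u R j ^ (K j div 2) * (if odd (K j) then box_u R j else 1)) *
       (box_v R j ^ ((N - K j) div 2) * box_v R j ^ ((N - K j) div 2) * (if odd (N - K j) then box_v R j else 1))))"
    unfolding bern_def bern1_def pw[symmetric] mconst_of_nat ..
  also have "\<dots> = mconst C * (s * s) * (prod (box_u R) J * prod (box_v R) J')"
    unfolding uJ vJ C_def mconst_prod s_def prod.distrib[symmetric]
    by (rule prod.cong) (simp_all only: mult_ac)
  finally have eq: "bern n R N K = mconst C * (s * s) * (prod (box_u R) J * prod (box_v R) J')" .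
  have "s \<in> polys {..<n} (\<Sum>j<n. N)"
    unfolding s_def
  proof (rule polys_prod)
    fix j assume "j \<in> {..<n}"
    then have "box_u R j ^ (K j div 2) * box_v R j ^ ((N - K j) div 2)
        \<in> polys {..<n} (K j div 2 * 1 + (N - K j) div 2 * 1)"
      by (intro polys_mult polys_power box_polys) auto
    moreover have "K j div 2 * 1 + (N - K j) div 2 * 1 \<le> N" using K[of j] \<open>j \<in> _\<close> by auto
    ultimately show "box_u R j ^ (K j div 2) * box_v R j ^ ((N - K j) div 2) \<in> polys {..<n} N"
      by (rule polys_mono[OF _ order_refl])
  qed
  then have s: "s \<in> polys {..<n} (n * N)" by simp
  have "mconst C * (s * s) \<in> polys {..<n} (n * N + n * N)"
    by (intro polys_mult_const polys_mult s)
  then have deg: "mdeg (mconst C * (s * s)) \<le> 2 * n * N"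
    using mdeg_polys by (fastforce simp: algebra_simps)
  have "C \<ge> 0" unfolding C_def by (intro prod_nonneg) auto
  then have "sos_in {..<n} (mconst C * (s * s))"
    by (intro sos_mult sos_mconst sos_square mvars_polys[OF s])
  then show ?thesis unfolding eq using deg by (intro qmd_mult_sos T) (auto simp: J_def J'_def)
qed

section \<open>Positive semidefinite quadratic forms are sums of squares\<close>

text \<open>Elimination of the last coordinate. A zero pivot forces its whole column to vanish; a
  positive pivot splits off one rank-one term and leaves the Schur complement, which is again
  positive semidefinite.\<close>

lemma psd_rank_one_sum:
  fixes a :: "nat \<Rightarrow> nat \<Rightarrow> real"
  assumes "\<And>i j. i < m \<Longrightarrow> j < m \<Longrightarrow> a i j = a j i"
    and "\<And>w. (\<Sum>i<m. \<Sum>j<m. a i j * w i * w j) \<ge> 0"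
  shows "\<exists>W. \<forall>i<m. \<forall>j<m. a i j = (\<Sum>w\<leftarrow>W. w i * w j)"
  using assms
proof (induction m arbitrary: a)
  case (Suc m)
  have expand: "(\<Sum>i<Suc m. \<Sum>j<Suc m. a i j * w i * w j)
      = (\<Sum>i<m. \<Sum>j<m. a i j * w i * w j) + 2 * w m * (\<Sum>i<m. a i m * w i) + a m m * w m ^ 2" for w
  proof -
    have "(\<Sum>j<m. a m j * w m * w j) = (\<Sum>i<m. a i m * w i * w m)"
      using Suc.prems(1) by (intro sum.cong) auto
    then show ?thesis
      by (simp add: sum.distrib sum_distrib_left sum_distrib_right power2_eq_square mult_ac)
  qed
  have amm: "a m m \<ge> 0"
  proof -
    have "(\<Sum>i<m. \<Sum>j<m. a i j * (if i = m then 1 else 0 :: real) * (if j = m then 1 else 0)) = 0"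
      by (intro sum.neutral ballI) auto
    moreover have "(\<Sum>i<m. a i m * (if i = m then 1 else 0 :: real)) = 0"
      by (intro sum.neutral ballI) auto
    ultimately show ?thesis using Suc.prems(2)[of "\<lambda>i. if i = m then 1 else 0"] unfolding expand by simp
  qed
  show ?case
  proof (cases "a m m = 0")
    case True
    have am: "a i m = 0" if "i < m" for i
    proof (rule ccontr)
      assume ne: "a i m \<noteq> 0"
      \<comment> \<open>Chosen so that the form takes the value a_ii + 2 t a_im = -1.\<close>
      define t where "t = - (a i i + 1) / (2 * a i m)"
      define w where "w k = (if k = i then 1 else if k = m then t else 0)" for k
      have "(\<Sum>k<m. a k m * w k) = a i m"
        using that by (subst sum.remove[of _ i]) (auto simp: w_def intro!: sum.neutral)
      moreover have "(\<Sum>k<m. \<Sum>j<m. a k j * w k * w j) = a i i"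
      proof -
        have "(\<Sum>j<m. a k j * w k * w j) = a k i * w k" if "k < m" for k
          using \<open>i < m\<close> by (subst sum.remove[of _ i]) (auto simp: w_def intro!: sum.neutral)
        then have "(\<Sum>k<m. \<Sum>j<m. a k j * w k * w j) = (\<Sum>k<m. a k i * w k)" by simp
        also have "\<dots> = a i i" using that by (subst sum.remove[of _ i]) (auto simp: w_def intro!: sum.neutral)
        finally show ?thesis .
      qed
      ultimately have "a i i + 2 * t * a i m \<ge> 0"
        using Suc.prems(2)[of w] that unfolding expand by (simp add: True w_def)
      then show False using ne by (simp add: t_def field_simps)
    qed
    have "(\<Sum>i<m. \<Sum>j<m. a i j * w i * w j) \<ge> 0" for w
      using Suc.prems(2)[of w] am unfolding expand by (simp add: True)
    then obtain W where W: "\<forall>i<m. \<forall>j<m. a i j = (\<Sum>w\<leftarrow>W. w i * w j)"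
      using Suc.IH[of a] Suc.prems(1) by auto
    \<comment> \<open>The vectors given by the induction hypothesis are arbitrary at index m, so
      that coordinate is reset to 0.\<close>
    have "a i j = (\<Sum>w\<leftarrow>map (\<lambda>w. w(m := 0)) W. w i * w j)" if "i < Suc m" "j < Suc m" for i j
    proof (cases "i < m \<and> j < m")
      case True
      then show ?thesis using W by (simp add: o_def)
    next
      case False
      then have "a i j = 0" "i = m \<or> j = m"
        using am that Suc.prems(1)[of i j] \<open>a m m = 0\<close> by (auto simp: less_Suc_eq)
      then show ?thesis by (auto simp: o_def)
    qed
    then show ?thesis by blast
  next
    case False
    then have pos: "a m m > 0" using amm by simp
    define b where "b i j = a i j - a i m * a j m / a m m" for i j
    have "(\<Sum>i<m. \<Sum>j<m. b i j * w i * w j) \<ge> 0" for w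
    proof -
      define L where "L = (\<Sum>i<m. a i m * w i)"
      \<comment> \<open>This last coordinate minimizes the form for fixed remaining ones; the
        minimum is the Schur complement form.\<close>
      define w' where "w' = w(m := - L / a m m)"
      have "(\<Sum>i<m. \<Sum>j<m. a i m * a j m / a m m * w i * w j) = L ^ 2 / a m m"
        by (simp add: L_def power2_eq_square sum_product sum_divide_distrib mult_ac)
      then have b: "(\<Sum>i<m. \<Sum>j<m. b i j * w i * w j) = (\<Sum>i<m. \<Sum>j<m. a i j * w i * w j) - L ^ 2 / a m m"
        by (simp add: b_def left_diff_distrib sum_subtractf)
      have "(\<Sum>i<m. \<Sum>j<m. a i j * w' i * w' j) = (\<Sum>i<m. \<Sum>j<m. a i j * w i * w j)"
        "(\<Sum>i<m. a i m * w' i) = L"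
        by (simp_all add: w'_def L_def)
      then have "0 \<le> (\<Sum>i<m. \<Sum>j<m. a i j * w i * w j) + 2 * w' m * L + a m m * w' m ^ 2"
        using Suc.prems(2)[of w'] unfolding expand by simp
      moreover have "2 * w' m * L + a m m * w' m ^ 2 = - (L ^ 2 / a m m)"
        using pos by (simp add: w'_def field_simps power2_eq_square)
      ultimately show ?thesis using b by linarith
    qed
    moreover have "b i j = b j i" if "i < m" "j < m" for i j
      using Suc.prems(1)[of i j] that by (simp add: b_def)
    ultimately obtain W where W: "\<forall>i<m. \<forall>j<m. b i j = (\<Sum>w\<leftarrow>W. w i * w j)"
      using Suc.IH[of b] by auto
    define v where "v i = a i m / sqrt (a m m)" for i
    have v: "v i * v j = a i m * a j m / a m m" for i j
      using pos by (simp add: v_def)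
    have "a i j = (\<Sum>w\<leftarrow>v # map (\<lambda>w. w(m := 0)) W. w i * w j)" if "i < Suc m" "j < Suc m" for i j
    proof (cases "i < m \<and> j < m")
      case True
      then have "a i j = v i * v j + b i j" by (simp add: v b_def)
      then show ?thesis using W True by (simp add: o_def)
    next
      case False
      then have "i = m \<or> j = m" using that by auto
      then have "v i * v j = a i j" using pos Suc.prems(1)[of i j] that by (auto simp: v)
      then show ?thesis using \<open>i = m \<or> j = m\<close> by (auto simp: o_def)
    qed
    then show ?thesis by blast
  qed
qed simp

text \<open>The matrix need not be symmetric, as the coefficient matrices used later are not:
  symmetrization leaves the form unchanged because the \<open>Y i\<close> commute.\<close>

lemma psd_sos:
  fixes a :: "nat \<Rightarrow> nat \<Rightarrow> real" and Y :: "nat \<Rightarrow> mpoly"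
  assumes psd: "\<And>w. (\<Sum>i<m. \<Sum>j<m. a i j * w i * w j) \<ge> 0"
    and Y: "\<And>i. i < m \<Longrightarrow> Y i \<in> polys V 1"
  defines "p \<equiv> \<Sum>i<m. \<Sum>j<m. mconst (a i j) * (Y i * Y j)"
  shows "sos_in V p" "p \<in> polys V 2"
proof -
  define b where "b i j = (a i j + a j i) / 2" for i j
  have swap: "(\<Sum>i<m. \<Sum>j<m. a j i * w i * w j) = (\<Sum>i<m. \<Sum>j<m. a i j * w i * w j)" for w
    by (subst sum.swap) (simp add: mult_ac)
  have "(\<Sum>i<m. \<Sum>j<m. b i j * w i * w j) = (\<Sum>i<m. \<Sum>j<m. a i j * w i * w j)" for w
  proof -
    have "(\<Sum>i<m. \<Sum>j<m. b i j * w i * w j)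
        = ((\<Sum>i<m. \<Sum>j<m. a i j * w i * w j) + (\<Sum>i<m. \<Sum>j<m. a j i * w i * w j)) / 2"
      by (simp add: b_def add_divide_distrib distrib_right sum.distrib sum_divide_distrib)
    then show ?thesis by (simp add: swap)
  qed
  then have "\<exists>W. \<forall>i<m. \<forall>j<m. b i j = (\<Sum>w\<leftarrow>W. w i * w j)"
    using psd by (intro psd_rank_one_sum) (auto simp: b_def add.commute)
  then obtain W where W: "\<And>i j. i < m \<Longrightarrow> j < m \<Longrightarrow> b i j = (\<Sum>w\<leftarrow>W. w i * w j)" by blast
  define h where "h = mconst (1/2)"
  have h: "h + h = 1" by (simp add: h_def mconst_hom(2-4)[symmetric])
  have "(\<Sum>i<m. \<Sum>j<m. mconst (b i j) * (Y i * Y j))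
      = h * p + h * (\<Sum>i<m. \<Sum>j<m. mconst (a j i) * (Y i * Y j))"
  proof -
    have "mconst (b i j) = h * mconst (a i j) + h * mconst (a j i)" for i j
      by (simp add: b_def h_def mconst_hom(3,4)[symmetric] add_divide_distrib)
    then show ?thesis by (simp add: p_def distrib_right sum.distrib sum_distrib_left mult.assoc)
  qed
  also have "(\<Sum>i<m. \<Sum>j<m. mconst (a j i) * (Y i * Y j)) = p"
    unfolding p_def by (subst sum.swap) (simp add: mult_ac)
  also have "h * p + h * p = p" using h by (metis distrib_right mult_1)
  finally have p: "p = (\<Sum>i<m. \<Sum>j<m. mconst (b i j) * (Y i * Y j))" by simp
  define l where "l w = (\<Sum>i<m. mconst (w i) * Y i)" for w
  have sq: "(\<Sum>i<m. \<Sum>j<m. mconst (w i * w j) * (Y i * Y j)) = l w * l w" for w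
    by (simp add: l_def sum_product mconst_hom(4) mult_ac)
  have lsum: "(\<Sum>i<m. \<Sum>j<m. mconst (\<Sum>w\<leftarrow>W. w i * w j) * (Y i * Y j)) = (\<Sum>w\<leftarrow>W. l w * l w)" for W
    by (induction W) (simp_all add: mconst_hom(1,3) distrib_right sum.distrib sq)
  have "p = (\<Sum>i<m. \<Sum>j<m. mconst (\<Sum>w\<leftarrow>W. w i * w j) * (Y i * Y j))"
    unfolding p by (intro sum.cong refl) (simp add: W)
  then have p2: "p = (\<Sum>w\<leftarrow>W. l w * l w)" by (simp add: lsum)
  have l: "l w \<in> polys V 1" for w
    unfolding l_def using Y by (intro polys_sum polys_mult_const) auto
  show "sos_in V p" unfolding p2 by (intro sos_sum_list sos_square mvars_polys[OF l])
  have "(\<Sum>w\<leftarrow>W. l w * l w) \<in> polys V (1 + 1)" by (intro polys_sum_list polys_mult l)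
  then show "p \<in> polys V 2" by (simp add: p2 numeral_2_eq_2)
qed

section \<open>Lifting residues in a Henselian ring\<close>

definition subring_set :: "'a :: comm_ring_1 set \<Rightarrow> bool" where
  "subring_set A \<longleftrightarrow> 1 \<in> A \<and> (\<forall>a\<in>A. \<forall>b\<in>A. a + b \<in> A \<and> a * b \<in> A \<and> - a \<in> A)"

lemma subring_setD:
  assumes "subring_set A"
  shows "1 \<in> A" "a \<in> A \<Longrightarrow> b \<in> A \<Longrightarrow> a + b \<in> A" "a \<in> A \<Longrightarrow> b \<in> A \<Longrightarrow> a * b \<in> A"
    "a \<in> A \<Longrightarrow> - a \<in> A" "0 \<in> A" "a \<in> A \<Longrightarrow> b \<in> A \<Longrightarrow> a - b \<in> A"
proof -
  show *: "1 \<in> A" "a \<in> A \<Longrightarrow> b \<in> A \<Longrightarrow> a + b \<in> A" "a \<in> A \<Longrightarrow> b \<in> A \<Longrightarrow> a * b \<in> A"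
    "a \<in> A \<Longrightarrow> - a \<in> A" for a b using assms by (auto simp: subring_set_def)
  show "0 \<in> A" using *(2)[OF *(1) *(4)[OF *(1)]] by simp
  show "a \<in> A \<Longrightarrow> b \<in> A \<Longrightarrow> a - b \<in> A" using *(2)[of a "- b"] *(4)[of b] by simp
qed

lemma subring_set_sum: "subring_set A \<Longrightarrow> (\<And>i. i \<in> S \<Longrightarrow> f i \<in> A) \<Longrightarrow> sum f S \<in> A"
  by (induction S rule: infinite_finite_induct) (auto intro: subring_setD)

lemma subring_set_power: "subring_set A \<Longrightarrow> a \<in> A \<Longrightarrow> a ^ k \<in> A"
  by (induction k) (auto intro: subring_setD)

lemma subring_set_of_nat: "subring_set A \<Longrightarrow> of_nat k \<in> A"
  by (induction k) (auto intro: subring_setD)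

definition coeffs_in :: "'a :: comm_ring_1 set \<Rightarrow> 'a poly set" where
  "coeffs_in A = {p. \<forall>i. coeff p i \<in> A}"

lemma subring_coeffs_in: "subring_set A \<Longrightarrow> subring_set (coeffs_in A)"
  unfolding subring_set_def[of "coeffs_in A"]
  by (auto simp: coeffs_in_def coeff_mult coeff_1 intro!: subring_setD subring_set_sum)

lemma poly_coeffs_in:
  assumes "subring_set A" "p \<in> coeffs_in A" "x \<in> A" shows "poly p x \<in> A"
proof -
  have "poly p x = (\<Sum>i\<le>degree p. coeff p i * x ^ i)" by (rule poly_altdef)
  then show ?thesis using assms
    by (auto simp: coeffs_in_def intro!: subring_set_sum subring_setD(3) subring_set_power)
qed

lemma coeffs_in_pCons: "pCons a p \<in> coeffs_in A \<longleftrightarrow> a \<in> A \<and> p \<in> coeffs_in A"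
  unfolding coeffs_in_def mem_Collect_eq
  by (metis coeff_pCons_0 coeff_pCons_Suc not0_implies_Suc)

lemma coeffs_in_const: "subring_set A \<Longrightarrow> a \<in> A \<Longrightarrow> [:a:] \<in> coeffs_in A"
  by (auto simp: coeffs_in_def coeff_pCons split: nat.split intro: subring_setD)

lemma coeffs_in_monom: "subring_set A \<Longrightarrow> a \<in> A \<Longrightarrow> monom a k \<in> coeffs_in A"
  by (auto simp: coeffs_in_def intro: subring_setD)

lemma coeffs_in_smult: "subring_set A \<Longrightarrow> a \<in> A \<Longrightarrow> p \<in> coeffs_in A \<Longrightarrow> smult a p \<in> coeffs_in A"
  by (auto simp: coeffs_in_def intro: subring_setD)

lemma coeffs_in_pderiv: 
  fixes p :: "'a :: {comm_ring_1, semiring_no_zero_divisors} poly"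
  shows "subring_set A \<Longrightarrow> p \<in> coeffs_in A \<Longrightarrow> pderiv p \<in> coeffs_in A"
  unfolding coeffs_in_def mem_Collect_eq coeff_pderiv
  by (intro allI subring_setD(3) subring_set_of_nat) auto

definition adjoin :: "'a :: comm_ring_1 set \<Rightarrow> 'a \<Rightarrow> 'a set" where
  "adjoin A x = (\<lambda>p. poly p x) ` coeffs_in A"

lemma adjoin_props:
  assumes "subring_set A"
  shows "subring_set (adjoin A x)" "A \<subseteq> adjoin A x" "x \<in> adjoin A x"
proof -
  note * = subring_setD[OF subring_coeffs_in[OF assms]]
  show "subring_set (adjoin A x)"
    unfolding subring_set_def adjoin_def
    using * by (auto simp: image_iff) (metis poly_1, metis poly_add, metis poly_mult, metis poly_minus)
  show "A \<subseteq> adjoin A x"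
  proof
    fix a assume "a \<in> A"
    then show "a \<in> adjoin A x"
      using coeffs_in_const[OF assms, of a] by (force simp: adjoin_def image_iff)
  qed
  have "[:0, 1:] \<in> coeffs_in A"
    using * assms by (auto simp: coeffs_in_pCons intro: subring_setD)
  then show "x \<in> adjoin A x" by (force simp: adjoin_def image_iff)
qed

text \<open>A is only a subring, so the leading coefficient of p need not be invertible in it;
  multiplying q by a power of that coefficient replaces the division. Only the remainder has to have
  coefficients in A.\<close>

lemma pseudo_division:
  fixes p q :: "'a :: field poly"
  assumes A: "subring_set A" and p: "p \<in> coeffs_in A" "degree p > 0" and "q \<in> coeffs_in A"
  shows "\<exists>e s r. smult (lead_coeff p ^ e) q = s * p + r \<and> r \<in> coeffs_in A \<and> degree r < degree p"
  using assms(4)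
proof (induction "degree q" arbitrary: q rule: less_induct)
  case less
  show ?case
  proof (cases "degree q < degree p")
    case True
    then show ?thesis using less by (intro exI[of _ 0] exI[of _ 0] exI[of _ q]) auto
  next
    case False
    define k where "k = degree q - degree p"
    define q' where "q' = smult (lead_coeff p) q - monom (lead_coeff q) k * p"
    have lc: "lead_coeff p \<in> A" "lead_coeff q \<in> A" using p less by (auto simp: coeffs_in_def)
    have q': "q' \<in> coeffs_in A"
      unfolding q'_def using A lc p less
      by (intro subring_setD[OF subring_coeffs_in[OF A]] coeffs_in_smult coeffs_in_monom)
    have "degree (monom (lead_coeff q) k * p) \<le> k + degree p"
      by (rule order_trans[OF degree_mult_le]) (simp add: degree_monom_le)
    then have "degree q' \<le> degree q"
      unfolding q'_def using False by (intro degree_diff_le) (auto simp: k_def degree_smult_le)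
    moreover have "coeff q' (degree q) = 0"
      using False by (simp add: q'_def k_def coeff_monom_mult)
    ultimately have "q' = 0 \<or> degree q' < degree q" by (rule eq_zero_or_degree_less)
    then have "\<exists>e s r. smult (lead_coeff p ^ e) q' = s * p + r \<and> r \<in> coeffs_in A \<and> degree r < degree p"
    proof
      assume "q' = 0"
      then show ?thesis using p q' by (intro exI[of _ 0] exI[of _ 0] exI[of _ 0]) auto
    next
      assume "degree q' < degree q"
      then show ?thesis using less.hyps q' by blast
    qed
    then obtain e s r where *: "smult (lead_coeff p ^ e) q' = s * p + r" "r \<in> coeffs_in A"
      "degree r < degree p" by blast
    have "smult (lead_coeff p ^ Suc e) q
        = smult (lead_coeff p ^ e) q' + smult (lead_coeff p ^ e) (monom (lead_coeff q) k) * p"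
      by (simp add: q'_def smult_diff_right mult.commute)
    also have "\<dots> = (s + smult (lead_coeff p ^ e) (monom (lead_coeff q) k)) * p + r"
      by (simp add: * distrib_right)
    finally show ?thesis using * by blast
  qed
qed

text \<open>Simple roots modulo m lift. Simplicity is expressed as "not in m"; in the intended
  instance the elements outside m are exactly the units of V.\<close>

locale hensel_ring =
  fixes V m :: "'a :: field_char_0 set"
  assumes V: "subring_set V" and m_V: "m \<subseteq> V"
    and m_add: "a \<in> m \<Longrightarrow> b \<in> m \<Longrightarrow> a + b \<in> m"
    and m_mult: "a \<in> V \<Longrightarrow> b \<in> m \<Longrightarrow> a * b \<in> m"
    and zero_m: "0 \<in> m"
    and hensel: "p \<in> coeffs_in V \<Longrightarrow> u \<in> V \<Longrightarrow> poly p u \<in> m \<Longrightarrow> poly (pderiv p) u \<notin> m \<Longrightarrow>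
      \<exists>u'. poly p u' = 0 \<and> u' - u \<in> m"
begin

lemma poly_diff_m:
  assumes "p \<in> coeffs_in V" "x \<in> V" "y \<in> V" "x - y \<in> m"
  shows "poly p x - poly p y \<in> m"
  using assms(1)
proof (induction p)
  case (pCons a p)
  then have "poly p x - poly p y \<in> m" "poly p x \<in> V"
    using assms by (auto simp: coeffs_in_pCons intro: poly_coeffs_in V)
  then have "poly p x * (x - y) + y * (poly p x - poly p y) \<in> m"
    using assms by (intro m_add m_mult)
  then show ?case by (simp add: algebra_simps)
qed (simp add: zero_m)

text \<open>A maximal subring meeting the ideal trivially represents all residues: a residue that is
  transcendental over it could be adjoined, and a root of its minimal polynomial lifts.\<close>

lemma coefficient_ring:
  assumes R0: "subring_set R0" "R0 \<subseteq> V" "R0 \<inter> m \<subseteq> {0}"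
  shows "\<exists>A. subring_set A \<and> R0 \<subseteq> A \<and> A \<inter> m \<subseteq> {0} \<and> (\<forall>v\<in>V. \<exists>a\<in>A. a - v \<in> m)"
proof -
  define \<A> where "\<A> = {A. subring_set A \<and> R0 \<subseteq> A \<and> A \<subseteq> V \<and> A \<inter> m \<subseteq> {0}}"
  have "\<exists>A\<in>\<A>. \<forall>B\<in>\<A>. A \<subseteq> B \<longrightarrow> B = A"
  proof (rule subset_Zorn_nonempty)
    show "\<A> \<noteq> {}" using R0 by (auto simp: \<A>_def)
  next
    fix C assume C: "C \<noteq> {}" "subset.chain \<A> C"
    then have sub: "A \<in> \<A>" if "A \<in> C" for A using that by (auto simp: subset_chain_def)
    have "subring_set (\<Union>C)"
      unfolding subring_set_def
    proof (intro conjI ballI)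
      obtain A where "A \<in> C" using C by blast
      then have "subring_set A" using sub by (auto simp: \<A>_def)
      then show "1 \<in> \<Union>C" using \<open>A \<in> C\<close> subring_setD(1) by blast
    next
      fix a b assume "a \<in> \<Union>C" "b \<in> \<Union>C"
      then obtain A B where AB: "A \<in> C" "B \<in> C" "a \<in> A" "b \<in> B" by blast
      then have "A \<subseteq> B \<or> B \<subseteq> A" using C by (auto simp: subset_chain_def)
      then obtain D where D: "D \<in> C" "a \<in> D" "b \<in> D" using AB by blast
      then have "subring_set D" using sub by (auto simp: \<A>_def)
      note * = subring_setD[OF this]
      show "a + b \<in> \<Union>C" "a * b \<in> \<Union>C" "- a \<in> \<Union>C"
        using *(2)[OF D(2,3)] *(3)[OF D(2,3)] *(4)[OF D(2)] D(1) by blast+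
    qed
    moreover have "R0 \<subseteq> \<Union>C" "\<Union>C \<subseteq> V" "\<Union>C \<inter> m \<subseteq> {0}"
      using C(1) sub unfolding \<A>_def by blast+
    ultimately show "\<Union>C \<in> \<A>" by (simp add: \<A>_def)
  qed
  then obtain A where A: "A \<in> \<A>" "\<And>B. B \<in> \<A> \<Longrightarrow> A \<subseteq> B \<Longrightarrow> B = A" by blast
  have sA: "subring_set A" and AV: "A \<subseteq> V" and Am: "A \<inter> m \<subseteq> {0}" and R0A: "R0 \<subseteq> A"
    using A by (auto simp: \<A>_def)
  have pV: "p \<in> coeffs_in V" if "p \<in> coeffs_in A" for p using that AV by (auto simp: coeffs_in_def)
  \<comment> \<open>If no nonzero value at x of a polynomial over A lies in m, then A[x] still meets
    m trivially, and maximality of A gives x in A.\<close>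
  have max: "x \<in> A" if x: "x \<in> V" "\<And>q. q \<in> coeffs_in A \<Longrightarrow> poly q x \<in> m \<Longrightarrow> poly q x = 0" for x
  proof -
    have "adjoin A x \<subseteq> V" using pV x by (auto simp: adjoin_def intro: poly_coeffs_in V)
    then have "adjoin A x \<in> \<A>"
      using x(2) adjoin_props[OF sA, of x] R0A by (auto simp: \<A>_def adjoin_def)
    then show ?thesis using A(2) adjoin_props[OF sA, of x] by blast
  qed
  have "\<exists>a\<in>A. a - v \<in> m" if v: "v \<in> V" for v
  proof (cases "\<exists>p. p \<in> coeffs_in A \<and> p \<noteq> 0 \<and> poly p v \<in> m")
    case False
    then have "v \<in> A" using v by (intro max) auto
    then show ?thesis by (intro bexI[of _ v]) (auto simp: zero_m)
  next
    case True
    define p where "p = (ARG_MIN degree p. p \<in> coeffs_in A \<and> p \<noteq> 0 \<and> poly p v \<in> m)"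
    have p: "p \<in> coeffs_in A" "p \<noteq> 0" "poly p v \<in> m"
      and min: "\<And>q. q \<in> coeffs_in A \<Longrightarrow> q \<noteq> 0 \<Longrightarrow> poly q v \<in> m \<Longrightarrow> degree p \<le> degree q"
      using arg_min_nat_lemma[of "\<lambda>p. p \<in> coeffs_in A \<and> p \<noteq> 0 \<and> poly p v \<in> m" _ degree] True
      unfolding p_def by blast+
    have deg: "degree p > 0"
    proof (rule ccontr)
      assume "\<not> degree p > 0"
      then obtain c where c: "p = [:c:]" using degree_eq_zeroE by blast
      then have "c \<in> A" "c \<in> m" using p by (auto simp: coeffs_in_pCons)
      then show False using Am p c by auto
    qed
    \<comment> \<open>In characteristic 0 the derivative is a nonzero polynomial of smaller degree,
      so minimality keeps its value at v out of m: v is a simple root modulo m.\<close>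
    have "pderiv p \<noteq> 0" using deg by (simp add: pderiv_eq_0_iff)
    moreover have "degree (pderiv p) < degree p" using deg by (simp add: degree_pderiv)
    ultimately have "poly (pderiv p) v \<notin> m"
      using min[of "pderiv p"] coeffs_in_pderiv[OF sA p(1)] by auto
    then obtain v' where v': "poly p v' = 0" "v' - v \<in> m"
      using hensel[OF pV[OF p(1)] v p(3)] by blast
    have "v + (v' - v) \<in> V" using v v' m_V by (intro subring_setD(2)[OF V]) auto
    then have v'V: "v' \<in> V" by simp
    have neg: "v - v' \<in> m"
      using m_mult[OF subring_setD(4)[OF V subring_setD(1)[OF V]] v'(2)] by simp
    \<comment> \<open>Modulo p, any q becomes a remainder r of smaller degree. If q(v') lies in m,
      so does r(v'), hence r(v) by congruence; minimality of p makes r zero, and then q(v') =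
      0.\<close>
    have "v' \<in> A"
    proof (rule max[OF v'V])
      fix q assume q: "q \<in> coeffs_in A" "poly q v' \<in> m"
      obtain e s r where r: "smult (lead_coeff p ^ e) q = s * p + r" "r \<in> coeffs_in A"
        "degree r < degree p"
        using pseudo_division[OF sA p(1) deg q(1)] by blast
      have "poly (smult (lead_coeff p ^ e) q) v' = poly r v'"
        unfolding r by (simp add: v')
      then have rv: "lead_coeff p ^ e * poly q v' = poly r v'" by simp
      have "lead_coeff p ^ e \<in> V"
        using p pV by (intro subring_set_power V) (auto simp: coeffs_in_def)
      then have "poly r v' \<in> m" using m_mult q rv by metis
      then have "poly r v \<in> m"
        using m_add[OF poly_diff_m[OF pV[OF r(2)] v v'V neg]] by fastforce
      then have "r = 0" using min[OF r(2)] r(3) by force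
      then show "poly q v' = 0" using rv p by simp
    qed
    then show ?thesis using v' by blast
  qed
  then show ?thesis using sA R0A Am by blast
qed

end

section \<open>An ultrapower of the reals\<close>

text \<open>Zorn's lemma for proper filters. In the order on filters a finer filter is smaller, so
  \<open>r\<close> reverses that order and an upper bound of a chain is its infimum. A P that meets
  the maximal filter U can be added to U, and therefore already holds eventually.\<close>

lemma ultrafilter_exists:
  "\<exists>U. U \<le> sequentially \<and> U \<noteq> bot \<and> (\<forall>P. eventually P U \<or> eventually (\<lambda>k. \<not> P k) U)"
proof -
  define \<F> where "\<F> = {F. F \<le> sequentially \<and> F \<noteq> bot}"
  define r where "r = {(F, G). F \<in> \<F> \<and> G \<in> \<F> \<and> G \<le> F}"
  have "\<exists>U\<in>Field r. \<forall>F\<in>Field r. (U, F) \<in> r \<longrightarrow> F = U"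
  proof (rule Zorns_po_lemma)
    show "Partial_order r"
      by (auto simp: r_def partial_order_on_def preorder_on_def refl_on_def Field_def trans_def antisym_def)
  next
    fix C assume C: "C \<in> Chains r"
    then have CF: "F \<in> \<F>" if "F \<in> C" for F using that by (auto simp: Chains_def r_def)
    show "\<exists>u\<in>Field r. \<forall>F\<in>C. (F, u) \<in> r"
    proof (cases "C = {}")
      case True
      have "(sequentially, sequentially) \<in> r" by (auto simp: r_def \<F>_def)
      then show ?thesis using True by (auto simp: Field_def)
    next
      case False
      have "eventually P (Inf C) \<longleftrightarrow> (\<exists>F\<in>C. eventually P F)" for P
        using False C by (intro eventually_Inf_base) (auto simp: Chains_def r_def inf_absorb1 inf_absorb2)
      then have "Inf C \<noteq> bot"
        using CF by (metis (mono_tags, lifting) \<F>_def mem_Collect_eq trivial_limit_def)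
      moreover have "Inf C \<le> sequentially"
        using False CF by (metis (mono_tags, lifting) Inf_lower2 \<F>_def all_not_in_conv mem_Collect_eq)
      ultimately have "Inf C \<in> \<F>" by (simp add: \<F>_def)
      then have "(Inf C, Inf C) \<in> r" "\<forall>F\<in>C. (F, Inf C) \<in> r"
        using CF by (auto simp: r_def intro: Inf_lower)
      then show ?thesis by (auto simp: Field_def)
    qed
  qed
  then obtain U where U: "U \<in> Field r" "\<And>F. (U, F) \<in> r \<Longrightarrow> F = U"
    by (auto simp: Field_def)
  then have UF: "U \<in> \<F>" by (auto simp: Field_def r_def)
  have "eventually P U \<or> eventually (\<lambda>k. \<not> P k) U" for P
  proof (cases "inf U (principal {k. P k}) = bot")
    case True
    then have "eventually (\<lambda>k. False) (inf U (principal {k. P k}))" by simp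
    then show ?thesis by (simp add: eventually_inf_principal)
  next
    case False
    then have "(U, inf U (principal {k. P k})) \<in> r"
      using UF by (auto simp: r_def \<F>_def intro: le_infI1)
    then have "inf U (principal {k. P k}) = U" by (rule U(2))
    moreover have "eventually P (inf U (principal {k. P k}))" by (simp add: eventually_inf_principal)
    ultimately show ?thesis by simp
  qed
  then show ?thesis using UF by (auto simp: \<F>_def)
qed

definition ultra :: "nat filter" where
  "ultra = (SOME U. U \<le> sequentially \<and> U \<noteq> bot \<and> (\<forall>P. eventually P U \<or> eventually (\<lambda>k. \<not> P k) U))"

lemma ultra:
  "ultra \<le> sequentially" "ultra \<noteq> bot" "\<not> eventually P ultra \<Longrightarrow> eventually (\<lambda>k. \<not> P k) ultra"
  using someI_ex[OF ultrafilter_exists] unfolding ultra_def by blast+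

lemma ultra_sequentially: "eventually P sequentially \<Longrightarrow> eventually P ultra"
  using ultra(1) by (rule filter_leD)

\<comment> \<open>Only the field operations are lifted. Order statements are kept as inequalities
  between representatives that hold eventually along \<open>ultra\<close>.\<close>
quotient_type hyper = "nat \<Rightarrow> real" / "\<lambda>x y. eventually (\<lambda>k. x k = y k) ultra"
proof (rule equivpI)
  show "transp (\<lambda>x y. eventually (\<lambda>k. (x k :: real) = y k) ultra)"
    by (auto simp: transp_def elim: eventually_elim2)
qed (auto simp: reflp_def symp_def eq_commute)

instantiation hyper :: "{zero, one, plus, times, minus, uminus, inverse}"
begin

lift_definition zero_hyper :: hyper is "\<lambda>_. 0" .
lift_definition one_hyper :: hyper is "\<lambda>_. 1" .
lift_definition plus_hyper :: "hyper \<Rightarrow> hyper \<Rightarrow> hyper" is "\<lambda>x y k. x k + y k"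
  by (auto elim: eventually_elim2)
lift_definition times_hyper :: "hyper \<Rightarrow> hyper \<Rightarrow> hyper" is "\<lambda>x y k. x k * y k"
  by (auto elim: eventually_elim2)
lift_definition minus_hyper :: "hyper \<Rightarrow> hyper \<Rightarrow> hyper" is "\<lambda>x y k. x k - y k"
  by (auto elim: eventually_elim2)
lift_definition uminus_hyper :: "hyper \<Rightarrow> hyper" is "\<lambda>x k. - x k"
  by (auto elim: eventually_mono)
lift_definition inverse_hyper :: "hyper \<Rightarrow> hyper" is "\<lambda>x k. inverse (x k)"
  by (auto elim: eventually_mono)
lift_definition divide_hyper :: "hyper \<Rightarrow> hyper \<Rightarrow> hyper" is "\<lambda>x y k. x k / y k"
  by (auto elim: eventually_elim2)

instance ..

end

instance hyper :: field
proof
  fix a b c :: hyper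
  show "a * b * c = a * (b * c)" "a * b = b * a" "1 * a = a" "a + b + c = a + (b + c)"
    "a + b = b + a" "0 + a = a" "- a + a = 0" "a - b = a + - b" "(a + b) * c = a * c + b * c"
    "a / b = a * inverse b" "inverse (0 :: hyper) = 0"
    by (transfer, simp add: algebra_simps divide_inverse)+
  show "0 \<noteq> (1 :: hyper)" by transfer (simp add: ultra)
  show "inverse a * a = 1" if "a \<noteq> 0" using that
    by transfer (auto dest!: ultra(3) elim: eventually_mono)
qed

lemma hyper_of_nat: "of_nat n = abs_hyper (\<lambda>_. real n)"
  by (induction n) (simp_all add: zero_hyper.abs_eq one_hyper.abs_eq plus_hyper.abs_eq add.commute)

lemma abs_hyper_eq: "abs_hyper x = abs_hyper y \<longleftrightarrow> eventually (\<lambda>k. x k = y k) ultra"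
  by (simp add: hyper.abs_eq_iff)

instance hyper :: field_char_0
proof
  show "inj (of_nat :: nat \<Rightarrow> hyper)"
    by (rule injI) (simp add: hyper_of_nat abs_hyper_eq ultra)
qed

lemma hyper_cases: obtains x where "a = abs_hyper x"
  by (metis Quotient3_abs_rep Quotient3_hyper)

text \<open>A polynomial over the ultrapower is a sequence of real polynomials, so the intermediate
  value theorem can be applied in each component.\<close>

lemma poly_hyper: "\<exists>P. \<forall>x. poly p (abs_hyper x) = abs_hyper (\<lambda>k. poly (P k) (x k))"
proof (induction p)
  case 0
  show ?case by (intro exI[of _ "\<lambda>_. 0"]) (simp add: zero_hyper.abs_eq)
next
  case (pCons a p)
  then obtain P where P: "\<And>x. poly p (abs_hyper x) = abs_hyper (\<lambda>k. poly (P k) (x k))" by blast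
  obtain b where "a = abs_hyper b" by (rule hyper_cases)
  then show ?case
    by (intro exI[of _ "\<lambda>k. pCons (b k) (P k)"]) (simp add: P plus_hyper.abs_eq times_hyper.abs_eq)
qed

text \<open>The bound 1/(k+1) is a convenient way to make \<open>\<eta>\<close> infinitesimal: its
  reciprocal eventually exceeds every real constant.\<close>

locale infinitesimal =
  fixes \<eta> :: "nat \<Rightarrow> real"
  assumes \<eta>_pos: "0 < \<eta> k" and \<eta>_le: "\<eta> k \<le> 1 / real (Suc k)"
begin

text \<open>\<open>moderate\<close> modulo \<open>negligible\<close> is Robinson's field of
  asymptotic numbers for the scale \<open>\<eta>\<close>.\<close>

definition moderate :: "hyper set" where
  "moderate = abs_hyper ` {x. \<exists>N. eventually (\<lambda>k. \<bar>x k\<bar> \<le> (1 / \<eta> k) ^ N) ultra}"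

definition negligible :: "hyper set" where
  "negligible = abs_hyper ` {x. \<forall>N. eventually (\<lambda>k. \<bar>x k\<bar> \<le> \<eta> k ^ N) ultra}"

lemma moderate_iff: "abs_hyper x \<in> moderate \<longleftrightarrow> (\<exists>N. eventually (\<lambda>k. \<bar>x k\<bar> \<le> (1 / \<eta> k) ^ N) ultra)"
proof
  assume "abs_hyper x \<in> moderate"
  then obtain y N where y: "eventually (\<lambda>k. x k = y k) ultra" "eventually (\<lambda>k. \<bar>y k\<bar> \<le> (1 / \<eta> k) ^ N) ultra"
    by (auto simp: moderate_def abs_hyper_eq)
  then have "eventually (\<lambda>k. \<bar>x k\<bar> \<le> (1 / \<eta> k) ^ N) ultra" by eventually_elim auto
  then show "\<exists>N. eventually (\<lambda>k. \<bar>x k\<bar> \<le> (1 / \<eta> k) ^ N) ultra" ..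
qed (auto simp: moderate_def)

lemma negligible_iff: "abs_hyper x \<in> negligible \<longleftrightarrow> (\<forall>N. eventually (\<lambda>k. \<bar>x k\<bar> \<le> \<eta> k ^ N) ultra)"
proof
  assume "abs_hyper x \<in> negligible"
  then obtain y where y: "eventually (\<lambda>k. x k = y k) ultra" "\<forall>N. eventually (\<lambda>k. \<bar>y k\<bar> \<le> \<eta> k ^ N) ultra"
    by (auto simp: negligible_def abs_hyper_eq)
  show "\<forall>N. eventually (\<lambda>k. \<bar>x k\<bar> \<le> \<eta> k ^ N) ultra"
  proof
    fix N
    from y(1) y(2)[rule_format, of N] show "eventually (\<lambda>k. \<bar>x k\<bar> \<le> \<eta> k ^ N) ultra"
      by eventually_elim auto
  qed
qed (auto simp: negligible_def)

lemma \<eta>_le1: "\<eta> k \<le> 1"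
  using \<eta>_le[of k] by (rule order_trans) simp

lemma inv_\<eta>: "1 / \<eta> k \<ge> real (Suc k)" "1 / \<eta> k \<ge> 1"
proof -
  show *: "1 / \<eta> k \<ge> real (Suc k)"
    using \<eta>_le[of k] \<eta>_pos[of k] by (simp add: field_simps)
  show "1 / \<eta> k \<ge> 1" by (rule order_trans[OF _ *]) simp
qed

lemma \<eta>_power_mono: "M \<le> N \<Longrightarrow> \<eta> k ^ N \<le> \<eta> k ^ M"
  using \<eta>_pos[of k] \<eta>_le1[of k] by (intro power_decreasing) auto

text \<open>Lets a constant factor be traded for one extra power of \<open>\<eta>\<close> in the
  closure proofs.\<close>

lemma \<eta>_small: "eventually (\<lambda>k. K * \<eta> k \<le> 1) ultra"
proof (rule ultra_sequentially)
  have "eventually (\<lambda>k. real k \<ge> \<bar>K\<bar>) sequentially"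
    by (rule eventually_sequentiallyI[of "nat \<lceil>\<bar>K\<bar>\<rceil>"]) linarith
  then show "eventually (\<lambda>k. K * \<eta> k \<le> 1) sequentially"
  proof eventually_elim
    case (elim k)
    have "K * \<eta> k \<le> real (Suc k) * \<eta> k" using elim \<eta>_pos[of k] by (intro mult_right_mono) auto
    also have "\<dots> \<le> 1" using \<eta>_le[of k] by (simp add: field_simps)
    finally show ?case .
  qed
qed

lemma const_moderate: "abs_hyper (\<lambda>_. c) \<in> moderate"
proof -
  have "eventually (\<lambda>k. \<bar>c\<bar> \<le> (1 / \<eta> k) ^ 1) ultra"
    using \<eta>_small[of "\<bar>c\<bar>"] by eventually_elim (use \<eta>_pos in \<open>simp add: field_simps\<close>)
  then show ?thesis unfolding moderate_iff ..
qed

lemma add_moderate: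
  assumes "a \<in> moderate" "b \<in> moderate" shows "a + b \<in> moderate"
proof -
  obtain x y where xy: "a = abs_hyper x" "b = abs_hyper y" by (metis hyper_cases)
  then obtain M N where "eventually (\<lambda>k. \<bar>x k\<bar> \<le> (1 / \<eta> k) ^ M) ultra"
    "eventually (\<lambda>k. \<bar>y k\<bar> \<le> (1 / \<eta> k) ^ N) ultra"
    using assms by (auto simp: moderate_iff)
  then have "eventually (\<lambda>k. \<bar>x k + y k\<bar> \<le> (1 / \<eta> k) ^ Suc (max M N)) ultra"
    using \<eta>_small[of 2]
  proof eventually_elim
    case (elim k)
    have "(1 / \<eta> k) ^ M \<le> (1 / \<eta> k) ^ max M N" "(1 / \<eta> k) ^ N \<le> (1 / \<eta> k) ^ max M N"
      using inv_\<eta>[of k] by (auto intro: power_increasing)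
    then have "\<bar>x k + y k\<bar> \<le> 2 * (1 / \<eta> k) ^ max M N" using elim by linarith
    also have "\<dots> \<le> 1 / \<eta> k * (1 / \<eta> k) ^ max M N"
      using elim(3) \<eta>_pos[of k] by (intro mult_right_mono) (auto simp: field_simps)
    finally show ?case by simp
  qed
  then show ?thesis unfolding xy plus_hyper.abs_eq moderate_iff ..
qed

lemma mult_moderate:
  assumes "a \<in> moderate" "b \<in> moderate" shows "a * b \<in> moderate"
proof -
  obtain x y where xy: "a = abs_hyper x" "b = abs_hyper y" by (metis hyper_cases)
  then obtain M N where "eventually (\<lambda>k. \<bar>x k\<bar> \<le> (1 / \<eta> k) ^ M) ultra"
    "eventually (\<lambda>k. \<bar>y k\<bar> \<le> (1 / \<eta> k) ^ N) ultra"
    using assms by (auto simp: moderate_iff)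
  then have "eventually (\<lambda>k. \<bar>x k * y k\<bar> \<le> (1 / \<eta> k) ^ (M + N)) ultra"
  proof eventually_elim
    case (elim k)
    then show ?case unfolding abs_mult power_add using \<eta>_pos[of k] by (intro mult_mono) auto
  qed
  then show ?thesis unfolding xy times_hyper.abs_eq moderate_iff ..
qed

lemma uminus_moderate:
  assumes "a \<in> moderate" shows "- a \<in> moderate"
proof -
  obtain x where "a = abs_hyper x" by (rule hyper_cases)
  then show ?thesis using assms by (simp add: moderate_iff uminus_hyper.abs_eq)
qed

lemma add_negligible:
  assumes "a \<in> negligible" "b \<in> negligible" shows "a + b \<in> negligible"
proof -
  obtain x y where xy: "a = abs_hyper x" "b = abs_hyper y" by (metis hyper_cases)
  show ?thesis unfolding xy plus_hyper.abs_eq negligible_iff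
  proof
    fix N
    have "eventually (\<lambda>k. \<bar>x k\<bar> \<le> \<eta> k ^ Suc N) ultra" "eventually (\<lambda>k. \<bar>y k\<bar> \<le> \<eta> k ^ Suc N) ultra"
      using assms unfolding xy negligible_iff by blast+
    then show "eventually (\<lambda>k. \<bar>x k + y k\<bar> \<le> \<eta> k ^ N) ultra"
      using \<eta>_small[of 2]
    proof eventually_elim
      case (elim k)
      have "\<bar>x k + y k\<bar> \<le> 2 * \<eta> k ^ Suc N" using elim by linarith
      also have "\<dots> = (2 * \<eta> k) * \<eta> k ^ N" by simp
      also have "\<dots> \<le> 1 * \<eta> k ^ N" using elim \<eta>_pos[of k] by (intro mult_right_mono) auto
      finally show ?case by simp
    qed
  qed
qed

lemma mult_negligible:
  assumes "a \<in> moderate" "b \<in> negligible" shows "a * b \<in> negligible"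
proof -
  obtain x y where xy: "a = abs_hyper x" "b = abs_hyper y" by (metis hyper_cases)
  then obtain M where M: "eventually (\<lambda>k. \<bar>x k\<bar> \<le> (1 / \<eta> k) ^ M) ultra"
    using assms by (auto simp: moderate_iff)
  show ?thesis unfolding xy times_hyper.abs_eq negligible_iff
  proof
    fix N
    have "eventually (\<lambda>k. \<bar>y k\<bar> \<le> \<eta> k ^ (M + N)) ultra"
      using assms unfolding xy negligible_iff by blast
    with M show "eventually (\<lambda>k. \<bar>x k * y k\<bar> \<le> \<eta> k ^ N) ultra"
    proof eventually_elim
      case (elim k)
      have "\<bar>x k * y k\<bar> \<le> (1 / \<eta> k) ^ M * \<eta> k ^ (M + N)"
        unfolding abs_mult using elim \<eta>_pos[of k] by (intro mult_mono) auto
      also have "\<dots> = \<eta> k ^ N" using \<eta>_pos[of k] by (simp add: power_add power_one_over)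
      finally show ?case .
    qed
  qed
qed

lemma zero_negligible: "0 \<in> negligible"
  unfolding zero_hyper.abs_eq negligible_iff using \<eta>_pos by (simp add: less_imp_le)

lemma negligible_moderate: "negligible \<subseteq> moderate"
proof
  fix a assume a: "a \<in> negligible"
  obtain x where x: "a = abs_hyper x" by (rule hyper_cases)
  then have "eventually (\<lambda>k. \<bar>x k\<bar> \<le> \<eta> k ^ 0) ultra" using a unfolding x negligible_iff by blast
  then have "eventually (\<lambda>k. \<bar>x k\<bar> \<le> (1 / \<eta> k) ^ 0) ultra" by simp
  then show "a \<in> moderate" unfolding x moderate_iff by blast
qed

lemma not_negligible:
  assumes "abs_hyper x \<notin> negligible"
  shows "\<exists>N. eventually (\<lambda>k. \<bar>x k\<bar> > \<eta> k ^ N) ultra"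
proof -
  obtain N where "\<not> eventually (\<lambda>k. \<bar>x k\<bar> \<le> \<eta> k ^ N) ultra"
    using assms unfolding negligible_iff by blast
  then have "eventually (\<lambda>k. \<not> \<bar>x k\<bar> \<le> \<eta> k ^ N) ultra" by (rule ultra(3))
  then have "eventually (\<lambda>k. \<bar>x k\<bar> > \<eta> k ^ N) ultra" by eventually_elim simp
  then show ?thesis ..
qed

text \<open>The ultrafilter supplies the dichotomy: an element that is not below all powers of
  \<open>\<eta>\<close> is eventually above one of them. Hence everything outside
  \<open>negligible\<close> is a unit of \<open>moderate\<close>.\<close>

lemma inverse_moderate:
  assumes "a \<notin> negligible" shows "inverse a \<in> moderate"
proof -
  obtain x where x: "a = abs_hyper x" by (rule hyper_cases)
  then obtain N where "eventually (\<lambda>k. \<bar>x k\<bar> > \<eta> k ^ N) ultra" using assms not_negligible by blast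
  then have "eventually (\<lambda>k. \<bar>inverse (x k)\<bar> \<le> (1 / \<eta> k) ^ N) ultra"
  proof eventually_elim
    case (elim k)
    have "inverse \<bar>x k\<bar> \<le> inverse (\<eta> k ^ N)" using elim \<eta>_pos[of k] by (intro le_imp_inverse_le) auto
    then show ?case by (simp add: power_one_over inverse_eq_divide)
  qed
  then show ?thesis unfolding x inverse_hyper.abs_eq moderate_iff ..
qed

lemma subring_moderate: "subring_set moderate"
  unfolding subring_set_def one_hyper.abs_eq
  using add_moderate mult_moderate uminus_moderate const_moderate by blast

lemma poly_taylor2:
  assumes "p \<in> coeffs_in moderate" "u \<in> moderate" "h \<in> moderate"
  shows "\<exists>c\<in>moderate. poly p (u + h) = poly p u + poly (pderiv p) u * h + h * h * c"
  using assms(1)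
proof (induction p)
  case 0
  show ?case using zero_negligible negligible_moderate by (intro bexI[of _ 0]) auto
next
  case (pCons a p)
  note M = subring_setD[OF subring_moderate]
  have p: "p \<in> coeffs_in moderate" using pCons by (simp add: coeffs_in_pCons)
  then obtain c where c: "c \<in> moderate" "poly p (u + h) = poly p u + poly (pderiv p) u * h + h * h * c"
    using pCons by blast
  have d: "poly (pderiv p) u \<in> moderate"
    using assms p by (intro poly_coeffs_in[OF subring_moderate] coeffs_in_pderiv[OF subring_moderate])
  show ?case
  proof (intro bexI[of _ "u * c + poly (pderiv p) u + h * c"])
    show "poly (pCons a p) (u + h) = poly (pCons a p) u + poly (pderiv (pCons a p)) u * h
        + h * h * (u * c + poly (pderiv p) u + h * c)"
      unfolding poly_pCons c(2) pderiv_pCons poly_add by (simp add: algebra_simps)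
    show "u * c + poly (pderiv p) u + h * c \<in> moderate"
      using assms c d by (intro M(2,3))
  qed
qed

text \<open>A sign change replaces Newton iteration. With e = p(u), d = p'(u) and h = 2e/d, twice
  the Newton step in size, p(u + h) is about 3e and p(u - h) about -e. The intermediate value
  theorem then gives a root within |h| of u in almost every component, and h is negligible.\<close>

lemma hyper_hensel:
  assumes p: "p \<in> coeffs_in moderate" and u: "u \<in> moderate" and pu: "poly p u \<in> negligible"
    and du: "poly (pderiv p) u \<notin> negligible"
  shows "\<exists>u'. poly p u' = 0 \<and> u' - u \<in> negligible"
proof -
  note M = subring_setD[OF subring_moderate]
  define d where "d = poly (pderiv p) u"
  define e where "e = poly p u"
  have d0: "d \<noteq> 0" using du zero_negligible by (auto simp: d_def)
  have id: "inverse d \<in> moderate" using du unfolding d_def by (rule inverse_moderate)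
  define h where "h = 2 * inverse d * e"
  have two: "2 \<in> moderate" using M(2)[OF M(1) M(1)] by simp
  have h: "h \<in> negligible" "- h \<in> negligible"
    using mult_negligible[OF M(3)[OF two id] pu]
      mult_negligible[OF M(3)[OF M(4)[OF two] id] pu] by (auto simp: h_def e_def)
  have *: "\<exists>\<delta>\<in>negligible. poly p (u + s * h) = e * (1 + s * 2 + \<delta>)" if "s \<in> {1, - 1}" for s
  proof -
    have s: "s * s = 1" "s \<in> moderate" "s * h \<in> moderate"
      using that h negligible_moderate M(1) M(4)[OF M(1)] by auto
    obtain c where c: "c \<in> moderate"
      "poly p (u + s * h) = poly p u + poly (pderiv p) u * (s * h) + (s * h) * (s * h) * c"
      using poly_taylor2[OF p u s(3)] by blast
    have q1: "poly (pderiv p) u * (s * h) = e * (s * 2)"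
      using d0 by (simp add: h_def d_def[symmetric])
    \<comment> \<open>One factor h is written as 2e/d, so the quadratic remainder is e times
      something negligible and cannot spoil the signs.\<close>
    have q2: "(s * h) * (s * h) * c = e * (2 * inverse d * c * h)"
    proof -
      have "(s * h) * (s * h) * c = (s * s) * (h * h * c)" by (simp only: mult_ac)
      also have "\<dots> = h * h * c" by (simp only: s(1) mult_1)
      also have "\<dots> = e * (2 * inverse d * c * h)" by (simp add: h_def)
      finally show ?thesis .
    qed
    have "poly p (u + s * h) = e * (1 + s * 2 + 2 * inverse d * c * h)"
      by (simp only: c(2) q1 q2 e_def[symmetric]) (simp add: algebra_simps)
    moreover have "2 * inverse d * c * h \<in> negligible"
      using c id two h by (intro mult_negligible M(3))
    ultimately show ?thesis by blast
  qed
  obtain \<delta>1 where \<delta>1: "\<delta>1 \<in> negligible" "poly p (u + h) = e * (3 + \<delta>1)"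
    using *[of 1] by auto
  obtain \<delta>2 where \<delta>2: "\<delta>2 \<in> negligible" "poly p (u + - h) = e * (- 1 + \<delta>2)"
    using *[of "-1"] by auto
  obtain P where P: "\<And>x. poly p (abs_hyper x) = abs_hyper (\<lambda>k. poly (P k) (x k))"
    using poly_hyper by blast
  obtain x where x: "u = abs_hyper x" by (rule hyper_cases)
  obtain y where y: "h = abs_hyper y" by (rule hyper_cases)
  obtain E where E: "e = abs_hyper E" by (rule hyper_cases)
  obtain D1 where D1: "\<delta>1 = abs_hyper D1" by (rule hyper_cases)
  obtain D2 where D2: "\<delta>2 = abs_hyper D2" by (rule hyper_cases)
  have three: "3 = abs_hyper (\<lambda>_. 3)" using hyper_of_nat[of 3] by simp
  have e1: "eventually (\<lambda>k. poly (P k) (x k + y k) = E k * (3 + D1 k)) ultra"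
    using \<delta>1(2) unfolding x y E D1 three plus_hyper.abs_eq times_hyper.abs_eq P abs_hyper_eq .
  have e2: "eventually (\<lambda>k. poly (P k) (x k + - y k) = E k * (- 1 + D2 k)) ultra"
    using \<delta>2(2) unfolding x y E D2 one_hyper.abs_eq plus_hyper.abs_eq uminus_hyper.abs_eq times_hyper.abs_eq P abs_hyper_eq .
  \<comment> \<open>The zeroth power suffices: |D1| and |D2| at most 1 already give 3 + D1 >= 0 and
    -1 + D2 <= 0.\<close>
  have e3: "eventually (\<lambda>k. \<bar>D1 k\<bar> \<le> \<eta> k ^ 0) ultra" "eventually (\<lambda>k. \<bar>D2 k\<bar> \<le> \<eta> k ^ 0) ultra"
    using \<delta>1(1) \<delta>2(1) unfolding D1 D2 negligible_iff by blast+
  from e1 e2 e3 have "eventually (\<lambda>k. \<exists>z. \<bar>z - x k\<bar> \<le> \<bar>y k\<bar> \<and> poly (P k) z = 0) ultra"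
  proof eventually_elim
    case (elim k)
    define f where "f t = poly (P k) (x k + t * y k)" for t
    have f: "f 1 = E k * (3 + D1 k)" "f (- 1) = E k * (- 1 + D2 k)"
      using elim by (simp_all add: f_def)
    have "f 1 * f (- 1) = E k ^ 2 * ((3 + D1 k) * (- 1 + D2 k))"
      by (simp add: f power2_eq_square)
    also have "\<dots> \<le> 0" using elim by (intro mult_nonneg_nonpos) auto
    finally have "f (- 1) \<le> 0 \<and> 0 \<le> f 1 \<or> 0 \<le> f (- 1) \<and> f 1 \<le> 0"
      by (auto simp: mult_le_0_iff)
    moreover have "continuous_on {- 1..1} f" unfolding f_def by (intro continuous_intros)
    ultimately obtain t where t: "- 1 \<le> t" "t \<le> 1" "f t = 0"
      using IVT'[of f "-1" 0 1] IVT2'[of f 1 0 "-1"] by auto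
    then have "\<bar>t\<bar> * \<bar>y k\<bar> \<le> 1 * \<bar>y k\<bar>" by (intro mult_right_mono) auto
    then show ?case using t by (intro exI[of _ "x k + t * y k"]) (auto simp: f_def abs_mult)
  qed
  then obtain z where z: "eventually (\<lambda>k. \<bar>z k - x k\<bar> \<le> \<bar>y k\<bar> \<and> poly (P k) (z k) = 0) ultra"
    unfolding eventually_ex by blast
  have "poly p (abs_hyper z) = 0"
    unfolding P zero_hyper.abs_eq abs_hyper_eq using z by eventually_elim auto
  moreover have "abs_hyper z - u \<in> negligible"
    unfolding x minus_hyper.abs_eq negligible_iff
  proof
    fix N
    have "eventually (\<lambda>k. \<bar>y k\<bar> \<le> \<eta> k ^ N) ultra" using h(1) unfolding y negligible_iff by blast
    with z show "eventually (\<lambda>k. \<bar>z k - x k\<bar> \<le> \<eta> k ^ N) ultra" by eventually_elim auto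
  qed
  ultimately show ?thesis by blast
qed

sublocale hensel_ring moderate negligible
  by (unfold_locales; fact subring_moderate negligible_moderate add_negligible mult_negligible
      zero_negligible hyper_hensel)

end


lemma subring_const_hyper: "subring_set (range (\<lambda>c. abs_hyper (\<lambda>_. c)))"
  unfolding subring_set_def one_hyper.abs_eq
  by (auto simp: plus_hyper.abs_eq times_hyper.abs_eq uminus_hyper.abs_eq)

lemma subring_hyper_sum:
  "subring_set A \<Longrightarrow> (\<And>i. i \<in> S \<Longrightarrow> abs_hyper (f i) \<in> A) \<Longrightarrow> abs_hyper (\<lambda>k. \<Sum>i\<in>S. f i k) \<in> A"
  by (induction S rule: infinite_finite_induct)
    (auto simp: zero_hyper.abs_eq[symmetric] plus_hyper.abs_eq[symmetric] intro: subring_setD)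

lemma subring_hyper_prod:
  "subring_set A \<Longrightarrow> (\<And>i. i \<in> S \<Longrightarrow> abs_hyper (f i) \<in> A) \<Longrightarrow> abs_hyper (\<lambda>k. \<Prod>i\<in>S. f i k) \<in> A"
  by (induction S rule: infinite_finite_induct)
    (auto simp: one_hyper.abs_eq[symmetric] times_hyper.abs_eq[symmetric] intro: subring_setD)

lemma subring_hyper_power:
  "subring_set A \<Longrightarrow> abs_hyper f \<in> A \<Longrightarrow> abs_hyper (\<lambda>k. f k ^ N) \<in> A"
  by (induction N)
    (auto simp: one_hyper.abs_eq[symmetric] times_hyper.abs_eq[symmetric] intro: subring_setD)

section \<open>A Lojasiewicz inequality\<close>

text \<open>The useful property of the subring A is a gap: an element of A is either exactly 0 or
  larger than some power of \<open>\<eta>\<close>, whereas the counterexamples violate the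
  constraints by less than any power.\<close>

lemma lojasiewicz:
  assumes gs: "\<And>g. g \<in> set gs \<Longrightarrow> mvars g \<subseteq> {..<n}"
  shows "\<exists>L. \<exists>C\<ge>1. \<forall>x \<epsilon>. (\<forall>i<n. \<bar>x i\<bar> \<le> R) \<longrightarrow> 0 < \<epsilon> \<longrightarrow> \<epsilon> \<le> 1 \<longrightarrow>
    (\<forall>g\<in>set gs. meval g x \<ge> - (\<epsilon> ^ L / C)) \<longrightarrow> (\<exists>s. inS gs s \<and> (\<forall>i<n. \<bar>x i - s i\<bar> \<le> \<epsilon>))"
proof (rule ccontr)
  assume contra: "\<not> ?thesis"
  \<comment> \<open>The k-th counterexample is taken for L = k and C = (k+1)^k simultaneously, so
    that its defect is at most the k-th power of \<open>\<epsilon>\<close> / (k+1).\<close>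
  have "\<exists>x \<epsilon>. (\<forall>i<n. \<bar>x i\<bar> \<le> R) \<and> 0 < \<epsilon> \<and> \<epsilon> \<le> 1 \<and>
      (\<forall>g\<in>set gs. meval g x \<ge> - (\<epsilon> ^ k / real (Suc k) ^ k)) \<and>
      \<not> (\<exists>s. inS gs s \<and> (\<forall>i<n. \<bar>x i - s i\<bar> \<le> \<epsilon>))" for k
  proof (rule ccontr)
    assume *: "\<not> ?thesis"
    have "real (Suc k) ^ k \<ge> 1" by (rule one_le_power) simp
    with * contra show False by blast
  qed
  then obtain x \<epsilon> where x: "\<And>k i. i < n \<Longrightarrow> \<bar>x k i\<bar> \<le> R" and \<epsilon>: "\<And>k. 0 < \<epsilon> k" "\<And>k. \<epsilon> k \<le> 1"
    and gx: "\<And>k g. g \<in> set gs \<Longrightarrow> meval g (x k) \<ge> - (\<epsilon> k ^ k / real (Suc k) ^ k)"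
    and far: "\<And>k s. inS gs s \<Longrightarrow> \<not> (\<forall>i<n. \<bar>x k i - s i\<bar> \<le> \<epsilon> k)"
    by metis
  \<comment> \<open>The division by k + 1 makes \<open>\<eta>\<close> infinitesimal even if
    \<open>\<epsilon>\<close> is not. Since \<open>\<eta>\<close> <= \<open>\<epsilon>\<close>, a
    displacement by at most \<open>\<eta>\<close> contradicts the choice of the point.\<close>
  define \<eta> where "\<eta> k = \<epsilon> k / real (Suc k)" for k
  interpret infinitesimal \<eta>
    by unfold_locales (use \<epsilon> in \<open>simp_all add: \<eta>_def divide_right_mono\<close>)
  have \<eta>\<epsilon>: "\<eta> k \<le> \<epsilon> k" for k
    using \<epsilon>(1)[of k] by (simp add: \<eta>_def divide_le_eq)
  have "range (\<lambda>c. abs_hyper (\<lambda>_. c)) \<inter> negligible \<subseteq> {0}"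
  proof
    fix a assume a: "a \<in> range (\<lambda>c. abs_hyper (\<lambda>_. c)) \<inter> negligible"
    then obtain c where c: "a = abs_hyper (\<lambda>_. c)" by auto
    show "a \<in> {0}"
    proof (rule ccontr)
      assume "a \<notin> {0}"
      then have "c \<noteq> 0" using c by (auto simp: zero_hyper.abs_eq)
      have "eventually (\<lambda>k. \<bar>c\<bar> \<le> \<eta> k ^ 1) ultra" using a unfolding c Int_iff negligible_iff by blast
      then have "eventually (\<lambda>k. False) ultra"
        using \<eta>_small[of "2 / \<bar>c\<bar>"] by eventually_elim (use \<open>c \<noteq> 0\<close> in \<open>auto simp: field_simps\<close>)
      then show False using ultra(2) by simp
    qed
  qed
  \<comment> \<open>Starting from the real constants puts all coefficients of the \<open>g\<close>'s
    into A, so their values at points with coordinates in A stay in A.\<close>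
  then obtain A where A: "subring_set A" "range (\<lambda>c. abs_hyper (\<lambda>_. c)) \<subseteq> A" "A \<inter> negligible \<subseteq> {0}"
    and res: "\<forall>v\<in>moderate. \<exists>a\<in>A. a - v \<in> negligible"
    using coefficient_ring[OF subring_const_hyper] const_moderate by blast
  have "\<exists>t. abs_hyper t \<in> A \<and> abs_hyper t - abs_hyper (\<lambda>k. x k i) \<in> negligible" if "i < n" for i
  proof -
    have "abs_hyper (\<lambda>_. R) \<in> moderate" by (rule const_moderate)
    then obtain N where "eventually (\<lambda>k. \<bar>R\<bar> \<le> (1 / \<eta> k) ^ N) ultra" by (auto simp: moderate_iff)
    then have "eventually (\<lambda>k. \<bar>x k i\<bar> \<le> (1 / \<eta> k) ^ N) ultra"
    proof eventually_elim
      case (elim k)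
      then show ?case using x[OF that, of k] by linarith
    qed
    then have "abs_hyper (\<lambda>k. x k i) \<in> moderate" unfolding moderate_iff ..
    then obtain a where "a \<in> A" "a - abs_hyper (\<lambda>k. x k i) \<in> negligible" using res by blast
    then show ?thesis using hyper_cases[of a] by metis
  qed
  then obtain t where t: "\<And>i. i < n \<Longrightarrow> abs_hyper (t i) \<in> A"
    "\<And>i. i < n \<Longrightarrow> abs_hyper (t i) - abs_hyper (\<lambda>k. x k i) \<in> negligible" by metis
  define s where "s k i = t i k" for k i
  have close: "eventually (\<lambda>k. \<forall>i<n. \<bar>s k i - x k i\<bar> \<le> \<eta> k ^ N) ultra" for N
  proof -
    have "eventually (\<lambda>k. \<bar>s k i - x k i\<bar> \<le> \<eta> k ^ N) ultra" if "i < n" for i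
      using t(2)[OF that] unfolding minus_hyper.abs_eq negligible_iff s_def by blast
    then have "eventually (\<lambda>k. \<forall>i\<in>{..<n}. \<bar>s k i - x k i\<bar> \<le> \<eta> k ^ N) ultra"
      by (intro eventually_ball_finite) auto
    then show ?thesis by eventually_elim auto
  qed
  \<comment> \<open>By the gap, g(s) is 0 or has modulus above the N-th power of
    \<open>\<eta>\<close> for some N. In the second case g(s) differs from g(x) by a multiple of the
    (N+1)-st power, and g(x) is at least minus the k-th power with k > N; so g(s) cannot be
    negative.\<close>
  have "eventually (\<lambda>k. meval g (s k) \<ge> 0) ultra" if g: "g \<in> set gs" for g
  proof -
    have mon: "abs_hyper (\<lambda>k. mon (s k) mo) \<in> A" if "mo \<in> keys g" for mo
    proof -
      have "keys mo \<subseteq> {..<n}" using gs[OF g] that by (auto simp: mvars_def)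
      then show ?thesis
        unfolding mon_def s_def
        by (intro subring_hyper_prod subring_hyper_power A(1)) (auto intro: t(1))
    qed
    have "abs_hyper (\<lambda>k. lookup g mo * mon (s k) mo) \<in> A" if "mo \<in> keys g" for mo
      using subring_setD(3)[OF A(1) _ mon[OF that], of "abs_hyper (\<lambda>_. lookup g mo)"] A(2)
      by (auto simp: times_hyper.abs_eq)
    then have GA: "abs_hyper (\<lambda>k. meval g (s k)) \<in> A"
      unfolding meval_alt by (intro subring_hyper_sum A(1))
    show ?thesis
    proof (cases "abs_hyper (\<lambda>k. meval g (s k)) \<in> negligible")
      case True
      then have "abs_hyper (\<lambda>k. meval g (s k)) = 0" using A(3) GA by blast
      then have "eventually (\<lambda>k. meval g (s k) = 0) ultra" by (simp add: zero_hyper.abs_eq abs_hyper_eq)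
      then show ?thesis by eventually_elim simp
    next
      case False
      then obtain N where N: "eventually (\<lambda>k. \<bar>meval g (s k)\<bar> > \<eta> k ^ N) ultra"
        using not_negligible by blast
      define R' where "R' = \<bar>R\<bar> + 1"
      define K where "K = l1 g * (R' ^ mdeg g * real (mdeg g))"
      have gp: "g \<in> polys {..<n} (mdeg g)" using gs[OF g] by (simp add: polys_def)
      have "eventually (\<lambda>k. k \<ge> Suc N) ultra"
        by (rule ultra_sequentially) (rule eventually_ge_at_top)
      with N close[of "Suc N"] \<eta>_small[of "K + 1"] show ?thesis
      proof eventually_elim
        case (elim k)
        have \<eta>p: "\<eta> k ^ M \<le> 1" "0 \<le> \<eta> k ^ M" for M
          using \<eta>_pos[of k] \<eta>_le1[of k] by (auto intro: power_le_one)
        have sx: "\<bar>s k i - x k i\<bar> \<le> \<eta> k ^ Suc N" "\<bar>x k i\<bar> \<le> R" if "i < n" for i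
          using elim(2) x that by auto
        have "\<bar>s k i\<bar> \<le> R'" "\<bar>x k i\<bar> \<le> R'" if "i < n" for i
          using sx[OF that] \<eta>p(1)[of "Suc N"] by (auto simp: R'_def)
        then have "\<bar>meval g (s k) - meval g (x k)\<bar> \<le> l1 g * (R' ^ mdeg g * mdeg g * \<eta> k ^ Suc N)"
          using sx(1) \<eta>p(2)[of "Suc N"] by (intro meval_lipschitz[OF gp]) (auto simp: R'_def)
        also have "\<dots> = K * \<eta> k ^ Suc N" by (simp add: K_def)
        finally have 1: "\<bar>meval g (s k) - meval g (x k)\<bar> \<le> K * \<eta> k ^ Suc N" .
        have "meval g (x k) \<ge> - (\<eta> k ^ k)" using gx[OF g, of k] by (simp add: \<eta>_def power_divide)
        moreover have "\<eta> k ^ k \<le> \<eta> k ^ Suc N" using elim(4) by (rule \<eta>_power_mono)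
        ultimately have "- meval g (s k) \<le> (K + 1) * \<eta> k ^ Suc N" using 1 by (simp only: distrib_right)
        also have "\<dots> = ((K + 1) * \<eta> k) * \<eta> k ^ N" by simp
        also have "\<dots> \<le> 1 * \<eta> k ^ N" using elim(3) \<eta>p by (intro mult_right_mono) auto
        finally show ?case using elim(1) by linarith
      qed
    qed
  qed
  then have "eventually (\<lambda>k. \<forall>g\<in>set gs. meval g (s k) \<ge> 0) ultra"
    by (intro eventually_ball_finite) auto
  with close[of 1] have "eventually (\<lambda>k. False) ultra"
  proof eventually_elim
    case (elim k)
    then have "inS gs (s k)" by (simp add: inS_def)
    moreover have "\<forall>i<n. \<bar>x k i - s k i\<bar> \<le> \<epsilon> k"
      using elim(1) \<eta>\<epsilon>[of k] by (auto simp: abs_minus_commute intro: order_trans)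
    ultimately show ?case using far by blast
  qed
  then show False using ultra(2) by simp
qed

section \<open>Quantitative positivity after subtracting weighted generators\<close>

abbreviation form_at :: "nat \<Rightarrow> (nat \<Rightarrow> nat \<Rightarrow> mpoly) \<Rightarrow> (nat \<Rightarrow> real) \<Rightarrow> (nat \<Rightarrow> real) \<Rightarrow> real" where
  "form_at m A x w \<equiv> \<Sum>i<m. \<Sum>j<m. meval (A i j) x * w i * w j"

abbreviation form :: "nat \<Rightarrow> (nat \<Rightarrow> nat \<Rightarrow> mpoly) \<Rightarrow> (nat \<Rightarrow> mpoly) \<Rightarrow> mpoly" where
  "form m A Y \<equiv> \<Sum>i<m. \<Sum>j<m. A i j * (Y i * Y j)"

text \<open>Cauchy-Schwarz bounds the square of the sum of the |w_i| by m times the sum of their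
  squares; this is where the matrix size enters.\<close>

lemma quadratic_form_bound:
  fixes a :: "nat \<Rightarrow> nat \<Rightarrow> real" and w :: "nat \<Rightarrow> real"
  assumes "\<And>i j. i < m \<Longrightarrow> j < m \<Longrightarrow> \<bar>a i j\<bar> \<le> b"
  shows "\<bar>\<Sum>i<m. \<Sum>j<m. a i j * w i * w j\<bar> \<le> real m * b * (\<Sum>i<m. (w i)\<^sup>2)"
proof (cases "m = 0")
  case False
  then have b: "b \<ge> 0" using assms[of 0 0] by auto
  have "\<bar>\<Sum>i<m. \<Sum>j<m. a i j * w i * w j\<bar> \<le> (\<Sum>i<m. \<bar>\<Sum>j<m. a i j * w i * w j\<bar>)" by (rule sum_abs)
  also have "\<dots> \<le> (\<Sum>i<m. \<Sum>j<m. \<bar>a i j * w i * w j\<bar>)" by (intro sum_mono sum_abs)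
  also have "\<dots> \<le> (\<Sum>i<m. \<Sum>j<m. b * (\<bar>w i\<bar> * \<bar>w j\<bar>))"
    using assms by (intro sum_mono) (auto simp: abs_mult mult.assoc intro!: mult_right_mono)
  also have "\<dots> = b * (\<Sum>i<m. \<bar>w i\<bar> * 1)\<^sup>2"
    unfolding power2_eq_square sum_product by (simp add: sum_distrib_left)
  also have "\<dots> \<le> b * ((\<Sum>i<m. \<bar>w i\<bar>\<^sup>2) * (\<Sum>i<m. 1\<^sup>2))"
    using b by (intro mult_left_mono Cauchy_Schwarz_ineq_sum)
  finally show ?thesis by (simp add: mult_ac)
qed simp

text \<open>For q > 0, Bernoulli's inequality gives (1 - q)^(2k) (1 + 2kq) <= (1 - q^2)^(2k) <= 1.
  For q <= 0 the even exponent makes the left side nonpositive.\<close>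

lemma times_power_one_minus:
  fixes q :: real
  assumes "\<bar>q\<bar> \<le> 1" "k > 0"
  shows "q * (1 - q) ^ (2 * k) \<le> 1 / (2 * real k)"
proof (cases "q \<le> 0")
  case True
  have "q * (1 - q) ^ (2 * k) \<le> 0" using True by (intro mult_nonpos_nonneg) auto
  also have "0 \<le> 1 / (2 * real k)" by simp
  finally show ?thesis .
next
  case False
  let ?N = "2 * k"
  have "1 + real ?N * q \<le> (1 + q) ^ ?N" using assms False by (intro Bernoulli_inequality) auto
  then have "(1 - q) ^ ?N * (1 + real ?N * q) \<le> (1 - q) ^ ?N * (1 + q) ^ ?N"
    using assms by (intro mult_left_mono) auto
  also have "\<dots> = (1 - q * q) ^ ?N" by (simp add: power_mult_distrib[symmetric] algebra_simps)
  also have "\<dots> \<le> 1" using assms False by (intro power_le_one) (auto simp: mult_le_one)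
  finally have "(1 - q) ^ ?N + (1 - q) ^ ?N * (real ?N * q) \<le> 1" by (simp only: distrib_left mult_1_right)
  moreover have "(1 - q) ^ ?N \<ge> 0" by simp
  ultimately have "(1 - q) ^ ?N * (real ?N * q) \<le> 1" by linarith
  then show ?thesis using assms by (simp add: field_simps)
qed

text \<open>The even exponent also makes each multiplier of q a square, so the penalty belongs to
  the quadratic module generated by \<open>qs\<close>.\<close>

definition penalty :: "mpoly list \<Rightarrow> nat \<Rightarrow> mpoly" where
  "penalty qs k = (\<Sum>q\<leftarrow>qs. q * (1 - q) ^ (2 * k))"

lemma meval_penalty: "meval (penalty qs k) x = (\<Sum>q\<leftarrow>qs. meval q x * (1 - meval q x) ^ (2 * k))"
  by (simp add: penalty_def meval_sum_list meval_mult meval_power meval_diff)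

lemma sum_list_le_length: "(\<And>a. a \<in> set xs \<Longrightarrow> f a \<le> c) \<Longrightarrow> (\<Sum>a\<leftarrow>xs. f a) \<le> real (length xs) * c"
  by (induction xs) (auto simp: algebra_simps add_mono)

lemma sum_list_le_length_except:
  assumes "\<And>a. a \<in> set xs \<Longrightarrow> f a \<le> c" "b \<in> set xs" "f b \<le> - d" "c \<ge> 0"
  shows "(\<Sum>a\<leftarrow>xs. f a) \<le> - d + real (length xs) * c"
proof -
  obtain ys zs where xs: "xs = ys @ b # zs" using assms(2) by (meson split_list)
  have "(\<Sum>a\<leftarrow>ys. f a) \<le> real (length ys) * c" "(\<Sum>a\<leftarrow>zs. f a) \<le> real (length zs) * c"
    using assms(1) by (auto simp: xs intro!: sum_list_le_length)
  then show ?thesis using assms(3,4) by (simp add: xs algebra_simps)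
qed

text \<open>All data determined by the generators alone: Lojasiewicz constants L and C, degree T for
  the box products, degree bound G and norm bound \<open>\<gamma>\<close>. They are absorbed into
  the final constant.\<close>

locale normalized =
  fixes n :: nat and qs :: "mpoly list" and R C :: real and L T G :: nat and \<gamma> :: real
  assumes R: "R \<ge> 1" and C: "C \<ge> 1" and \<gamma>: "\<gamma> \<ge> 1"
    and Sbox: "\<And>x i. inS qs x \<Longrightarrow> i < n \<Longrightarrow> \<bar>x i\<bar> \<le> R"
    and le1: "\<And>q x. q \<in> set qs \<Longrightarrow> (\<And>i. i < n \<Longrightarrow> \<bar>x i\<bar> \<le> R) \<Longrightarrow> \<bar>meval q x\<bar> \<le> 1"
    and loj: "\<And>x \<epsilon>. (\<And>i. i < n \<Longrightarrow> \<bar>x i\<bar> \<le> R) \<Longrightarrow> 0 < \<epsilon> \<Longrightarrow> \<epsilon> \<le> 1 \<Longrightarrow>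
      (\<And>q. q \<in> set qs \<Longrightarrow> meval q x \<ge> - (\<epsilon> ^ L / C)) \<Longrightarrow> \<exists>s. inS qs s \<and> (\<forall>i<n. \<bar>x i - s i\<bar> \<le> \<epsilon>)"
    and T: "\<And>J J'. J \<subseteq> {..<n} \<Longrightarrow> J' \<subseteq> {..<n} \<Longrightarrow> prod (box_u R) J * prod (box_v R) J' \<in> qmd {..<n} qs T"
    and G: "\<And>q. q \<in> set qs \<Longrightarrow> q \<in> polys {..<n} G"
    and l1q: "\<And>q. q \<in> set qs \<Longrightarrow> 1 + l1 q \<le> \<gamma>"
begin

text \<open>E bounds both the form on the box and its Lipschitz constant, relative to the sum of
  squares of w. With \<open>\<epsilon>\<close> = 1/(4E), a point within \<open>\<epsilon>\<close> of
  S loses at most 1/4. \<open>\<mu>\<close> satisfies \<open>\<mu>\<close> \<open>\<delta>\<close> =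
  E + 1, enough to beat the value -E where some q is below -\<open>\<delta>\<close>. The choice of k
  keeps the other penalty terms below 1/4 in total. The margins are 1 - 1/4 - 1/4 near S and -E + (E
  + 1) - 1/4 elsewhere.\<close>

lemma positive_on_box:
  fixes A :: "nat \<Rightarrow> nat \<Rightarrow> mpoly" and a E \<mu> :: real and w :: "nat \<Rightarrow> real"
  assumes A: "\<And>i j. i < m \<Longrightarrow> j < m \<Longrightarrow> A i j \<in> polys {..<n} d"
    and l1A: "\<And>i j. i < m \<Longrightarrow> j < m \<Longrightarrow> l1 (A i j) \<le> a"
    and pos: "\<And>x (w :: nat \<Rightarrow> real). inS qs x \<Longrightarrow> form_at m A x w \<ge> (\<Sum>i<m. (w i)\<^sup>2)"
    and x: "\<And>i. i < n \<Longrightarrow> \<bar>x i\<bar> \<le> R"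
    and ads: "a \<ge> 1" "d \<ge> 1" "m \<ge> 1"
    and E: "E = real m * a * R ^ d * real d"
    and \<mu>: "\<mu> = (E + 1) * C * (4 * E) ^ L"
    and k: "k > 0" "real k \<ge> 2 * \<mu> * length qs"
  shows "form_at m A x w - \<mu> * meval (penalty qs k) x * (\<Sum>i<m. (w i)\<^sup>2)
    \<ge> (\<Sum>i<m. (w i)\<^sup>2) / 2"
proof -
  let ?W = "\<Sum>i<m. (w i)\<^sup>2"
  let ?Q = "\<lambda>x. form_at m A x w"
  let ?P = "meval (penalty qs k) x"
  have W: "?W \<ge> 0" by (intro sum_nonneg) auto
  have aR: "a * R ^ d \<ge> 1" using ads R by (metis mult_mono' one_le_power mult_1 zero_le_one)
  have E1: "E \<ge> 1"
  proof -
    have "1 * 1 * 1 \<le> real m * (a * R ^ d) * real d" using ads aR by (intro mult_mono) auto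
    then show ?thesis by (simp add: E mult_ac)
  qed
  have maR: "real m * (a * R ^ d) \<le> E"
  proof -
    have "real m * (a * R ^ d) * 1 \<le> real m * (a * R ^ d) * real d"
      using ads aR by (intro mult_left_mono) auto
    then show ?thesis by (simp add: E mult_ac)
  qed
  define \<epsilon> where "\<epsilon> = 1 / (4 * E)"
  have \<epsilon>: "0 < \<epsilon>" "\<epsilon> \<le> 1" "E * \<epsilon> = 1 / 4" using E1 by (auto simp: \<epsilon>_def)
  define \<delta> where "\<delta> = \<epsilon> ^ L / C"
  have \<delta>: "\<delta> > 0" using \<epsilon> C by (simp add: \<delta>_def)
  have \<mu>\<delta>: "\<mu> * \<delta> = E + 1"
    using E1 C by (simp add: \<mu> \<delta>_def \<epsilon>_def power_divide)
  have \<mu>0: "\<mu> > 0" using \<mu>\<delta> \<delta> E1 by (metis add_pos_pos less_le_trans zero_less_mult_pos2 zero_less_one)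
  have \<mu>k: "\<mu> * (real (length qs) * (1 / (2 * real k))) \<le> 1 / 4"
    using k by (simp add: field_simps)
  have summand: "meval q x * (1 - meval q x) ^ (2 * k) \<le> 1 / (2 * real k)" if "q \<in> set qs" for q
    using le1[OF that] x k by (intro times_power_one_minus) auto
  have main: "?Q x - \<mu> * ?P * ?W \<ge> ?W / 2" if "?Q x \<ge> \<alpha> * ?W" "\<mu> * ?P \<le> \<beta>" "\<alpha> - \<beta> \<ge> 1 / 2" for \<alpha> \<beta>
  proof -
    have "\<mu> * ?P * ?W \<le> \<beta> * ?W" using that W by (intro mult_right_mono) auto
    moreover have "(\<alpha> - \<beta>) * ?W \<ge> 1 / 2 * ?W" using that W by (intro mult_right_mono) auto
    ultimately show ?thesis using that(1) by (simp add: left_diff_distrib)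
  qed
  show ?thesis
  proof (cases "\<forall>q\<in>set qs. meval q x \<ge> - \<delta>")
    case True
    then obtain s where s: "inS qs s" "\<forall>i<n. \<bar>x i - s i\<bar> \<le> \<epsilon>"
      using loj[of x \<epsilon>] x \<epsilon> by (auto simp: \<delta>_def)
    have lip: "\<bar>meval (A i j) x - meval (A i j) s\<bar> \<le> a * (R ^ d * d * \<epsilon>)" if "i < m" "j < m" for i j
    proof -
      have "\<bar>meval (A i j) x - meval (A i j) s\<bar> \<le> l1 (A i j) * (R ^ d * d * \<epsilon>)"
        using A[OF that] R x s Sbox \<epsilon> by (intro meval_lipschitz) auto
      also have "\<dots> \<le> a * (R ^ d * d * \<epsilon>)"
        using l1A[OF that] R \<epsilon> by (intro mult_right_mono) auto
      finally show ?thesis .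
    qed
    have "\<bar>?Q x - ?Q s\<bar> \<le> real m * (a * (R ^ d * d * \<epsilon>)) * ?W"
      using quadratic_form_bound[of m "\<lambda>i j. meval (A i j) x - meval (A i j) s", OF lip, of w]
      by (simp add: left_diff_distrib sum_subtractf)
    also have "\<dots> = (E * \<epsilon>) * ?W" by (simp add: E mult_ac)
    finally have "?Q x \<ge> 3 / 4 * ?W" using pos[OF s(1), of w] unfolding \<epsilon>(3) by linarith
    moreover have "\<mu> * ?P \<le> 1 / 4"
    proof -
      have "?P \<le> real (length qs) * (1 / (2 * real k))"
        unfolding meval_penalty by (rule sum_list_le_length) (rule summand)
      then have "\<mu> * ?P \<le> \<mu> * (real (length qs) * (1 / (2 * real k)))"
        using \<mu>0 by (intro mult_left_mono) auto
      then show ?thesis using \<mu>k by linarith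
    qed
    ultimately show ?thesis by (intro main[of "3 / 4" "1 / 4"]) auto
  next
    case False
    then obtain q where q: "q \<in> set qs" "meval q x < - \<delta>" by auto
    have "1 \<le> (1 - meval q x) ^ (2 * k)" using q \<delta> by (intro one_le_power) auto
    then have "(- meval q x) * 1 \<le> (- meval q x) * (1 - meval q x) ^ (2 * k)"
      using q \<delta> by (intro mult_left_mono) auto
    then have "meval q x * (1 - meval q x) ^ (2 * k) \<le> - \<delta>" using q by simp
    then have "?P \<le> - \<delta> + real (length qs) * (1 / (2 * real k))"
      unfolding meval_penalty using q summand by (intro sum_list_le_length_except) auto
    then have "\<mu> * ?P \<le> \<mu> * (- \<delta> + real (length qs) * (1 / (2 * real k)))"
      using \<mu>0 by (intro mult_left_mono) auto
    then have "\<mu> * ?P \<le> - (E + 1) + 1 / 4" using \<mu>k \<mu>\<delta> unfolding distrib_left by linarith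
    moreover have "?Q x \<ge> - E * ?W"
    proof -
      have "\<bar>meval (A i j) x\<bar> \<le> a * R ^ d" if "i < m" "j < m" for i j
      proof -
        have "\<bar>meval (A i j) x\<bar> \<le> l1 (A i j) * R ^ d" using A[OF that] R x by (intro meval_bound) auto
        also have "\<dots> \<le> a * R ^ d" using l1A[OF that] R by (intro mult_right_mono) auto
        finally show ?thesis .
      qed
      then have "\<bar>?Q x\<bar> \<le> real m * (a * R ^ d) * ?W" by (rule quadratic_form_bound)
      also have "\<dots> \<le> E * ?W" using maR W by (intro mult_right_mono) auto
      finally show ?thesis by simp
    qed
    ultimately show ?thesis by (intro main[of "- E" "- (E + 1) + 1 / 4"]) auto
  qed
qed

lemma penalty_polys: "penalty qs k \<in> polys {..<n} ((2 * k + 1) * G)"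
proof -
  have "q * (1 - q) ^ (2 * k) \<in> polys {..<n} (G + 2 * k * G)" if "q \<in> set qs" for q
    using G[OF that] by (intro polys_mult polys_power polys_diff) auto
  then show ?thesis unfolding penalty_def by (intro polys_sum_list) (simp add: algebra_simps)
qed

text \<open>One of the two factors exponential in k that enter the Bernstein degree; the other is
  (3R)^D.\<close>

lemma l1_penalty: "l1 (penalty qs k) \<le> length qs * \<gamma> ^ (2 * k + 1)"
proof -
  have "l1 (q * (1 - q) ^ (2 * k)) \<le> \<gamma> ^ (2 * k + 1)" if "q \<in> set qs" for q
  proof -
    have q: "l1 q \<le> \<gamma>" "l1 (1 - q) \<le> \<gamma>" using l1q[OF that] l1_diff[of 1 q] by auto
    have "l1 ((1 - q) ^ (2 * k)) \<le> l1 (1 - q) ^ (2 * k)" by (rule l1_power)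
    also have "\<dots> \<le> \<gamma> ^ (2 * k)" using q by (intro power_mono) auto
    finally have "l1 ((1 - q) ^ (2 * k)) \<le> \<gamma> ^ (2 * k)" .
    then have "l1 q * l1 ((1 - q) ^ (2 * k)) \<le> \<gamma> * \<gamma> ^ (2 * k)"
      using q \<gamma> by (intro mult_mono) auto
    then show ?thesis using l1_mult[of q "(1 - q) ^ (2 * k)"] by simp
  qed
  then show ?thesis
    unfolding penalty_def by (intro order_trans[OF l1_sum_list] sum_list_le_length)
qed

text \<open>The Bernstein expansion is applied to each entry of h, that is A minus
  \<open>\<mu>\<close> times the penalty on the diagonal. For each multi-index the coefficients form
  a positive semidefinite matrix, which gives a sum of squares times a Bernstein polynomial. The
  penalty is added back at the end as an explicit element of the module.\<close>

lemma representation: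
  fixes A :: "nat \<Rightarrow> nat \<Rightarrow> mpoly" and a E \<mu> H :: real and Y :: "nat \<Rightarrow> mpoly"
  assumes A: "\<And>i j. i < m \<Longrightarrow> j < m \<Longrightarrow> A i j \<in> polys {..<n} d"
    and l1A: "\<And>i j. i < m \<Longrightarrow> j < m \<Longrightarrow> l1 (A i j) \<le> a"
    and pos: "\<And>x (w :: nat \<Rightarrow> real). inS qs x \<Longrightarrow> form_at m A x w \<ge> (\<Sum>i<m. (w i)\<^sup>2)"
    and Y: "\<And>i. i < m \<Longrightarrow> Y i \<in> polys V 1" and V: "{..<n} \<subseteq> V"
    and ads: "a \<ge> 1" "d \<ge> 1" "m \<ge> 1"
    and E: "E = real m * a * R ^ d * real d"
    and \<mu>: "\<mu> = (E + 1) * C * (4 * E) ^ L"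
    and k: "k > 0" "real k \<ge> 2 * \<mu> * length qs"
    and D: "D = d + (2 * k + 1) * G"
    and H: "H = a + \<mu> * (length qs * \<gamma> ^ (2 * k + 1))"
    and N: "D \<le> N" "N > 0" "real N \<ge> 2 * real m * (H * ((3 * R) ^ D * real D ^ 2))"
  shows "form m A Y \<in> qmd V qs (2 + 2 * n * N + T + D)"
proof -
  define P where "P = penalty qs k"
  define h where "h i j = A i j - (if i = j then mconst \<mu> * P else 0)" for i j
  have E0: "E \<ge> 0" using R ads by (simp add: E)
  then have \<mu>0: "\<mu> \<ge> 0" using C by (simp add: \<mu>)
  have h_polys: "h i j \<in> polys {..<n} D" if "i < m" "j < m" for i j
    unfolding h_def D P_def
    by (intro polys_diff polys_mono[OF A[OF that]]) (auto intro!: polys_mult_const polys_mono[OF penalty_polys])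
  have l1h: "l1 (h i j) \<le> H" if "i < m" "j < m" for i j
  proof -
    have "l1 (mconst \<mu> * P) \<le> \<mu> * l1 P" using l1_mult[of "mconst \<mu>" P] \<mu>0 by simp
    also have "\<dots> \<le> \<mu> * (length qs * \<gamma> ^ (2 * k + 1))"
      using \<mu>0 l1_penalty[of k] by (intro mult_left_mono) (auto simp: P_def)
    finally have "l1 (if i = j then mconst \<mu> * P else 0) \<le> \<mu> * (length qs * \<gamma> ^ (2 * k + 1))"
      using \<mu>0 \<gamma> by auto
    then show ?thesis
      unfolding h_def H using l1_diff[of "A i j" "if i = j then mconst \<mu> * P else 0"] l1A[OF that] by linarith
  qed
  define B where "B i j b \<longleftrightarrow> h i j = (\<Sum>K\<in>multi n N. mconst (b K) * bern n R N K) \<and>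
    (\<forall>K\<in>multi n N. \<bar>b K - meval (h i j) (grid R N K)\<bar> \<le> l1 (h i j) * ((3 * R) ^ D * (real D ^ 2 / real N)))"
    for i j b
  define b where "b i j = (SOME b. B i j b)" for i j
  have "B i j (b i j)" if "i < m" "j < m" for i j
  proof -
    have "\<exists>b. B i j b"
      unfolding B_def using that h_polys R N by (intro poly_bernstein) auto
    then show ?thesis unfolding b_def by (rule someI_ex)
  qed
  then have b: "\<And>i j. i < m \<Longrightarrow> j < m \<Longrightarrow>
      h i j = (\<Sum>K\<in>multi n N. mconst (b i j K) * bern n R N K)"
    "\<And>i j K. i < m \<Longrightarrow> j < m \<Longrightarrow> K \<in> multi n N \<Longrightarrow>
      \<bar>b i j K - meval (h i j) (grid R N K)\<bar> \<le> l1 (h i j) * ((3 * R) ^ D * (real D ^ 2 / real N))"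
    unfolding B_def by blast+
  \<comment> \<open>An entrywise error 1/(2m) changes the form by at most half the sum of squares of
    w, exactly the margin of \<open>positive_on_box\<close>.\<close>
  have err: "\<bar>b i j K - meval (h i j) (grid R N K)\<bar> \<le> 1 / (2 * real m)"
    if "i < m" "j < m" "K \<in> multi n N" for i j K
  proof -
    have "\<bar>b i j K - meval (h i j) (grid R N K)\<bar> \<le> l1 (h i j) * ((3 * R) ^ D * (real D ^ 2 / real N))"
      using that by (rule b(2))
    also have "\<dots> \<le> H * ((3 * R) ^ D * (real D ^ 2 / real N))"
      using l1h[OF that(1,2)] R by (intro mult_right_mono) auto
    also have "\<dots> = H * ((3 * R) ^ D * real D ^ 2) / real N" by simp
    also have "\<dots> \<le> 1 / (2 * real m)"
    proof -
      have "2 * real m * (H * ((3 * R) ^ D * real D ^ 2)) / real N \<le> 1" using N by (simp add: divide_le_eq)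
      then show ?thesis using ads by (simp add: field_simps)
    qed
    finally show ?thesis .
  qed
  have psd: "(\<Sum>i<m. \<Sum>j<m. b i j K * w i * w j) \<ge> 0" if K: "K \<in> multi n N" for K and w :: "nat \<Rightarrow> real"
  proof -
    let ?W = "\<Sum>i<m. (w i)\<^sup>2"
    let ?x = "grid R N K"
    have box: "\<bar>?x j\<bar> \<le> R" if "j < n" for j using K that N R by (intro grid_bound) auto
    have mh: "meval (h i j) ?x = meval (A i j) ?x - (if i = j then \<mu> * meval P ?x else 0)" for i j
      by (simp add: h_def meval_diff meval_mult)
    have "form_at m h ?x w
        = form_at m A ?x w - (\<Sum>i<m. \<Sum>j<m. (if i = j then \<mu> * meval P ?x else 0) * w i * w j)"
      by (simp add: mh left_diff_distrib sum_subtractf)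
    also have "(\<Sum>i<m. \<Sum>j<m. (if i = j then \<mu> * meval P ?x else 0) * w i * w j) = \<mu> * meval P ?x * ?W"
    proof -
      have "(\<Sum>j<m. (if i = j then \<mu> * meval P ?x else 0) * w i * w j) = \<mu> * meval P ?x * (w i)\<^sup>2" if "i < m" for i
        using that by (subst sum.remove[of _ i]) (auto simp: power2_eq_square intro!: sum.neutral)
      then show ?thesis by (simp add: sum_distrib_left)
    qed
    finally have "form_at m h ?x w \<ge> ?W / 2"
      using positive_on_box[OF A l1A pos box ads E \<mu> k, where w = w] by (simp add: P_def)
    moreover have "\<bar>\<Sum>i<m. \<Sum>j<m. (b i j K - meval (h i j) ?x) * w i * w j\<bar> \<le> real m * (1 / (2 * real m)) * ?W"
      using err K by (intro quadratic_form_bound) auto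
    then have "\<bar>(\<Sum>i<m. \<Sum>j<m. b i j K * w i * w j) - form_at m h ?x w\<bar> \<le> ?W / 2"
      using ads by (simp add: left_diff_distrib sum_subtractf)
    ultimately show ?thesis by linarith
  qed
  define S where "S K = (\<Sum>i<m. \<Sum>j<m. mconst (b i j K) * (Y i * Y j))" for K
  have "form m h Y = (\<Sum>i<m. \<Sum>j<m. \<Sum>K\<in>multi n N. mconst (b i j K) * (Y i * Y j) * bern n R N K)"
    by (intro sum.cong refl) (simp add: b(1) sum_distrib_left mult_ac)
  also have "\<dots> = (\<Sum>i<m. \<Sum>K\<in>multi n N. \<Sum>j<m. mconst (b i j K) * (Y i * Y j) * bern n R N K)"
    by (intro sum.cong refl sum.swap)
  also have "\<dots> = (\<Sum>K\<in>multi n N. \<Sum>i<m. \<Sum>j<m. mconst (b i j K) * (Y i * Y j) * bern n R N K)"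
    by (rule sum.swap)
  also have "\<dots> = (\<Sum>K\<in>multi n N. S K * bern n R N K)"
    by (simp add: S_def sum_distrib_right)
  finally have hsum: "form m h Y = (\<Sum>K\<in>multi n N. S K * bern n R N K)" .
  have first: "form m h Y \<in> qmd V qs (2 + 2 * n * N + T + D)"
    unfolding hsum
  proof (rule qmd_sum)
    fix K assume K: "K \<in> multi n N"
    have "sos_in V (S K)" "S K \<in> polys V 2"
      unfolding S_def using psd[OF K] Y by (intro psd_sos; blast)+
    moreover have "bern n R N K \<in> qmd {..<n} qs (2 * n * N + T)"
      using K by (intro bern_qmd T) auto
    ultimately have "S K * bern n R N K \<in> qmd V qs (2 + (2 * n * N + T))"
      using V by (intro qmd_mult_sos mdeg_polys) (auto intro: qmd_mono)
    then show "S K * bern n R N K \<in> qmd V qs (2 + 2 * n * N + T + D)"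
      by (rule qmd_mono) auto
  qed
  define Y2 where "Y2 = (\<Sum>i<m. Y i * Y i)"
  have Y2: "sos_in V Y2" unfolding Y2_def using Y by (intro sos_sum sos_square mvars_polys) auto
  have Y2p: "Y2 \<in> polys V (1 + 1)" unfolding Y2_def using Y by (intro polys_sum polys_mult) auto
  \<comment> \<open>On the diagonal the penalty multiplies the sum of the Y_i^2, so each generator q
    acquires a product of sums of squares as multiplier.\<close>
  have second: "mconst \<mu> * P * Y2 \<in> qmd V qs (2 + 2 * n * N + T + D)"
  proof -
    have "mconst \<mu> * P * Y2 = (\<Sum>q\<leftarrow>qs. (mconst \<mu> * ((1 - q) ^ k * (1 - q) ^ k) * Y2) * q)"
      unfolding P_def penalty_def mult_2 power_add
      by (simp add: sum_list_const_mult[symmetric] sum_list_mult_const[symmetric] mult_ac)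
    also have "\<dots> \<in> qmd V qs (2 + 2 * n * N + T + D)"
    proof (intro qmd_sum_list qmd_mult_gen)
      fix q assume q: "q \<in> set qs"
      have qV: "q \<in> polys V G" using G[OF q] V by (rule polys_mono) simp
      then have p: "(1 - q) ^ k \<in> polys V (k * G)" by (intro polys_power polys_diff) auto
      show "sos_in V (mconst \<mu> * ((1 - q) ^ k * (1 - q) ^ k) * Y2)"
        using \<mu>0 Y2 mvars_polys[OF p] by (intro sos_mult sos_mconst sos_square)
      have "mconst \<mu> * ((1 - q) ^ k * (1 - q) ^ k) * Y2 * q \<in> polys V (((k * G + k * G) + (1 + 1)) + G)"
        using p qV Y2p by (intro polys_mult polys_mult_const)
      then have "mdeg (mconst \<mu> * ((1 - q) ^ k * (1 - q) ^ k) * Y2 * q) \<le> ((k * G + k * G) + (1 + 1)) + G"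
        by (rule mdeg_polys)
      also have "\<dots> \<le> 2 + 2 * n * N + T + D" by (simp add: D algebra_simps)
      finally show "mdeg (mconst \<mu> * ((1 - q) ^ k * (1 - q) ^ k) * Y2 * q) \<le> 2 + 2 * n * N + T + D" .
    qed auto
    finally show ?thesis .
  qed
  have "form m A Y
      = form m h Y + (\<Sum>i<m. \<Sum>j<m. (if i = j then mconst \<mu> * P else 0) * (Y i * Y j))"
    by (simp add: h_def left_diff_distrib sum_subtractf)
  also have "(\<Sum>i<m. \<Sum>j<m. (if i = j then mconst \<mu> * P else 0) * (Y i * Y j)) = mconst \<mu> * P * Y2"
  proof -
    have "(\<Sum>j<m. (if i = j then mconst \<mu> * P else 0) * (Y i * Y j)) = mconst \<mu> * P * (Y i * Y i)" if "i < m" for i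
      using that by (subst sum.remove[of _ i]) (auto intro!: sum.neutral)
    then show ?thesis by (simp add: Y2_def sum_distrib_left)
  qed
  finally show ?thesis using qmd_add[OF first second] by simp
qed

end

section \<open>Polynomial and exponential growth\<close>

text \<open>Any base bounded away from 1 would let constants be absorbed into a power of B; 3/2 is
  the smallest value of 3^d / 2 for d >= 1, the lower bound available in the application.\<close>

locale growth =
  fixes \<Omega> :: "'t set" and B :: "'t \<Rightarrow> real"
  assumes B: "t \<in> \<Omega> \<Longrightarrow> B t \<ge> 3 / 2"
begin

definition poly_bd :: "('t \<Rightarrow> real) \<Rightarrow> bool" where
  "poly_bd f \<longleftrightarrow> (\<exists>e. \<forall>t\<in>\<Omega>. 0 \<le> f t \<and> f t \<le> B t ^ e)"

definition exp_bd :: "('t \<Rightarrow> real) \<Rightarrow> bool" where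
  "exp_bd f \<longleftrightarrow> (\<exists>g. poly_bd g \<and> (\<forall>t\<in>\<Omega>. 0 \<le> f t \<and> f t \<le> exp (g t)))"

lemma poly_bd_nonneg: "poly_bd f \<Longrightarrow> t \<in> \<Omega> \<Longrightarrow> 0 \<le> f t"
  by (auto simp: poly_bd_def)

lemma B_power_mono: "t \<in> \<Omega> \<Longrightarrow> i \<le> j \<Longrightarrow> B t ^ i \<le> B t ^ j"
  using B[of t] by (intro power_increasing) auto

lemma poly_bd_const: "c \<ge> 0 \<Longrightarrow> poly_bd (\<lambda>_. c)"
proof -
  assume c: "c \<ge> 0"
  obtain e where e: "c < (3 / 2) ^ e" using real_arch_pow[of "3/2" c] by auto
  have "c \<le> B t ^ e" if "t \<in> \<Omega>" for t
    using e power_mono[OF B[OF that], of e] by simp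
  then show ?thesis using c by (auto simp: poly_bd_def)
qed

lemma poly_bd_le: "poly_bd g \<Longrightarrow> (\<And>t. t \<in> \<Omega> \<Longrightarrow> 0 \<le> f t \<and> f t \<le> g t) \<Longrightarrow> poly_bd f"
  unfolding poly_bd_def by (meson order_trans)

lemma poly_bd_B: "poly_bd B"
  unfolding poly_bd_def using B by (intro exI[of _ 1]) fastforce

lemma poly_bd_mult: "poly_bd f \<Longrightarrow> poly_bd g \<Longrightarrow> poly_bd (\<lambda>t. f t * g t)"
proof -
  assume "poly_bd f" "poly_bd g"
  then obtain i j where "\<And>t. t \<in> \<Omega> \<Longrightarrow> 0 \<le> f t \<and> f t \<le> B t ^ i" "\<And>t. t \<in> \<Omega> \<Longrightarrow> 0 \<le> g t \<and> g t \<le> B t ^ j"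
    by (auto simp: poly_bd_def)
  then show ?thesis unfolding poly_bd_def
    by (intro exI[of _ "i + j"]) (auto simp: power_add intro!: mult_mono intro: order_trans)
qed

lemma poly_bd_add: "poly_bd f \<Longrightarrow> poly_bd g \<Longrightarrow> poly_bd (\<lambda>t. f t + g t)"
proof -
  assume "poly_bd f" "poly_bd g"
  then obtain i j where ij: "\<And>t. t \<in> \<Omega> \<Longrightarrow> 0 \<le> f t \<and> f t \<le> B t ^ i" "\<And>t. t \<in> \<Omega> \<Longrightarrow> 0 \<le> g t \<and> g t \<le> B t ^ j"
    by (auto simp: poly_bd_def)
  have "f t + g t \<le> B t ^ (2 + (i + j))" if t: "t \<in> \<Omega>" for t
  proof -
    have "f t \<le> B t ^ (i + j)" "g t \<le> B t ^ (i + j)"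
      using ij[OF t] B_power_mono[OF t, of i "i + j"] B_power_mono[OF t, of j "i + j"] by auto
    then have "f t + g t \<le> 2 * B t ^ (i + j)" by simp
    also have "\<dots> \<le> B t ^ 2 * B t ^ (i + j)"
      using B[OF t] power_mono[OF B[OF t], of 2] by (intro mult_right_mono) (auto simp: power2_eq_square)
    finally show ?thesis by (simp only: power_add)
  qed
  then show ?thesis unfolding poly_bd_def using ij by (intro exI[of _ "2 + (i + j)"]) auto
qed

lemma poly_bd_power: "poly_bd f \<Longrightarrow> poly_bd (\<lambda>t. f t ^ k)"
  by (induction k) (auto intro: poly_bd_mult poly_bd_const)

lemma poly_bd_of_nat_ceiling: "poly_bd f \<Longrightarrow> poly_bd (\<lambda>t. real (nat \<lceil>f t\<rceil>))"
proof -
  assume f: "poly_bd f"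
  have "poly_bd (\<lambda>t. f t + 1)" using f by (intro poly_bd_add poly_bd_const) auto
  then show ?thesis
  proof (rule poly_bd_le)
    fix t assume "t \<in> \<Omega>"
    then have "f t \<ge> 0" using f by (rule poly_bd_nonneg[rotated])
    then show "0 \<le> real (nat \<lceil>f t\<rceil>) \<and> real (nat \<lceil>f t\<rceil>) \<le> f t + 1" by linarith
  qed
qed

lemma exp_bd_poly: "poly_bd f \<Longrightarrow> exp_bd f"
  unfolding exp_bd_def
proof (intro exI[of _ f] conjI ballI)
  fix t assume "poly_bd f" "t \<in> \<Omega>"
  then show "0 \<le> f t" by (rule poly_bd_nonneg)
  show "f t \<le> exp (f t)" using exp_ge_add_one_self[of "f t"] by linarith
qed

lemma exp_bd_mult: "exp_bd f \<Longrightarrow> exp_bd g \<Longrightarrow> exp_bd (\<lambda>t. f t * g t)"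
proof -
  assume "exp_bd f" "exp_bd g"
  then obtain u v where uv: "poly_bd u" "poly_bd v" "\<And>t. t \<in> \<Omega> \<Longrightarrow> 0 \<le> f t \<and> f t \<le> exp (u t)"
    "\<And>t. t \<in> \<Omega> \<Longrightarrow> 0 \<le> g t \<and> g t \<le> exp (v t)"
    by (auto simp: exp_bd_def)
  then show ?thesis unfolding exp_bd_def
    by (intro exI[of _ "\<lambda>t. u t + v t"]) (auto simp: exp_add intro: poly_bd_add mult_mono)
qed

lemma exp_bd_add: "exp_bd f \<Longrightarrow> exp_bd g \<Longrightarrow> exp_bd (\<lambda>t. f t + g t)"
proof -
  assume "exp_bd f" "exp_bd g"
  then obtain u v where uv: "poly_bd u" "poly_bd v" "\<And>t. t \<in> \<Omega> \<Longrightarrow> 0 \<le> f t \<and> f t \<le> exp (u t)"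
    "\<And>t. t \<in> \<Omega> \<Longrightarrow> 0 \<le> g t \<and> g t \<le> exp (v t)"
    by (auto simp: exp_bd_def)
  have "f t + g t \<le> exp (1 + (u t + v t))" if t: "t \<in> \<Omega>" for t
  proof -
    have "u t \<ge> 0" "v t \<ge> 0" using uv t by (auto dest: poly_bd_nonneg)
    then have "exp (u t) \<le> exp (u t + v t)" "exp (v t) \<le> exp (u t + v t)" by auto
    then have "f t + g t \<le> 2 * exp (u t + v t)" using uv(3,4)[OF t] by linarith
    also have "\<dots> \<le> exp 1 * exp (u t + v t)" using exp_ge_add_one_self[of 1] by (intro mult_right_mono) auto
    finally show ?thesis by (simp add: exp_add)
  qed
  moreover have "poly_bd (\<lambda>t. 1 + (u t + v t))" using uv by (intro poly_bd_add poly_bd_const) auto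
  ultimately show ?thesis unfolding exp_bd_def using uv
    by (intro exI[of _ "\<lambda>t. 1 + (u t + v t)"]) auto
qed

lemma exp_bd_power:
  assumes c: "c \<ge> 1" and k: "poly_bd (\<lambda>t. real (k t))"
  shows "exp_bd (\<lambda>t. c ^ k t)"
  unfolding exp_bd_def
proof (intro exI[of _ "\<lambda>t. real (k t) * ln c"] conjI ballI)
  show "poly_bd (\<lambda>t. real (k t) * ln c)" using c by (intro poly_bd_mult poly_bd_const k) auto
  fix t
  show "0 \<le> c ^ k t" using c by simp
  have "c ^ k t = exp (ln c) ^ k t" using c by simp
  also have "\<dots> = exp (real (k t) * ln c)" by (rule exp_of_nat_mult[symmetric])
  finally show "c ^ k t \<le> exp (real (k t) * ln c)" by simp
qed

lemma exp_bd_of_nat_ceiling: "exp_bd f \<Longrightarrow> exp_bd (\<lambda>t. real (nat \<lceil>f t\<rceil>))"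
proof -
  assume f: "exp_bd f"
  have "exp_bd (\<lambda>t. f t + 1)" by (rule exp_bd_add[OF f exp_bd_poly[OF poly_bd_const]]) simp
  then obtain g where g: "poly_bd g" "\<And>t. t \<in> \<Omega> \<Longrightarrow> f t + 1 \<le> exp (g t)" by (auto simp: exp_bd_def)
  have "real (nat \<lceil>f t\<rceil>) \<le> exp (g t)" if "t \<in> \<Omega>" for t
  proof -
    have "f t \<ge> 0" using f that by (auto simp: exp_bd_def)
    then show ?thesis using g(2)[OF that] by linarith
  qed
  then show ?thesis using g by (auto simp: exp_bd_def)
qed

lemma exp_bdD: "exp_bd f \<Longrightarrow> \<exists>e. \<forall>t\<in>\<Omega>. f t \<le> exp (B t ^ e)"
  unfolding exp_bd_def poly_bd_def by (meson exp_le_cancel_iff order_trans)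

end

section \<open>A degree bound uniform in the matrix and its size\<close>

context normalized
begin

text \<open>The exponent \<open>e\<close> is a parameter so that it can be chosen before all
  matrices. The condition on \<open>R ^ d\<close> is separate because that quantity is exponential
  in d; \<open>2 * B\<close> leaves room for the matrix size r + 1.\<close>

definition representable :: "nat \<Rightarrow> nat \<Rightarrow> real \<Rightarrow> nat \<Rightarrow> real \<Rightarrow> nat \<Rightarrow> (nat \<Rightarrow> nat \<Rightarrow> mpoly) \<Rightarrow> (nat \<Rightarrow> mpoly) \<Rightarrow> nat set \<Rightarrow> bool" where
  "representable m0 e B m a d A Y V \<longleftrightarrow> (B \<ge> 3 / 2 \<longrightarrow> 1 \<le> a \<longrightarrow> a \<le> B \<longrightarrow> 1 \<le> m \<longrightarrow> real m \<le> 2 * B \<longrightarrow> 1 \<le> d \<longrightarrow>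
    real d \<le> B \<longrightarrow> R ^ d \<le> B ^ m0 \<longrightarrow>
    (\<forall>i<m. \<forall>j<m. A i j \<in> polys {..<n} d \<and> l1 (A i j) \<le> a) \<longrightarrow>
    (\<forall>x (w :: nat \<Rightarrow> real). inS qs x \<longrightarrow> form_at m A x w \<ge> (\<Sum>i<m. (w i)\<^sup>2)) \<longrightarrow>
    (\<forall>i<m. Y i \<in> polys V 1) \<longrightarrow> {..<n} \<subseteq> V \<longrightarrow>
    (\<exists>T'. form m A Y \<in> qmd V qs T' \<and> real T' \<le> exp (B ^ e)))"

text \<open>The constants of \<open>representation\<close> are treated as functions on the set of
  admissible data. E, \<open>\<mu>\<close>, k and D are polynomially bounded because L, C and G are
  fixed; H, Q and N involve fixed bases raised to k or D and are exponentially bounded.\<close>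

lemma representation_bound: "\<exists>e. \<forall>B m a d A Y V. representable m0 e B m a d A Y V"
proof -
  define \<Omega> where "\<Omega> = {(B :: real, m :: nat, a :: real, d :: nat). B \<ge> 3 / 2 \<and> 1 \<le> a \<and> a \<le> B \<and> 1 \<le> m \<and>
    real m \<le> 2 * B \<and> 1 \<le> d \<and> real d \<le> B \<and> R ^ d \<le> B ^ m0}"
  define E where "E = (\<lambda>(B :: real, m, a, d). real m * a * R ^ d * real d)"
  define \<mu> where "\<mu> t = (E t + 1) * C * (4 * E t) ^ L" for t
  define k where "k t = nat \<lceil>2 * \<mu> t * length qs\<rceil> + 1" for t
  define D where "D t = (case t of (B :: real, m, a, d) \<Rightarrow> d + (2 * k t + 1) * G)" for t
  define H where "H t = (case t of (B :: real, m, a, d) \<Rightarrow> a) + \<mu> t * (length qs * \<gamma> ^ (2 * k t + 1))" for t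
  define Q where "Q t = 2 * real (case t of (B :: real, m, a, d) \<Rightarrow> m) * (H t * ((3 * R) ^ D t * real (D t) ^ 2))" for t
  define N where "N t = nat \<lceil>Q t\<rceil> + D t + 1" for t
  define Tm where "Tm t = 2 + 2 * n * N t + T + D t" for t
  interpret growth \<Omega> "\<lambda>(B, m, a, d). B"
    by unfold_locales (auto simp: \<Omega>_def)
  let ?B = "\<lambda>(B :: real, m :: nat, a :: real, d :: nat). B"
  have proj: "poly_bd (\<lambda>(B, m, a, d). real m)" "poly_bd (\<lambda>(B, m, a, d). a)" "poly_bd (\<lambda>(B, m, a, d). real d)"
    "poly_bd (\<lambda>(B, m, a, d). R ^ d)"
  proof -
    have "poly_bd (\<lambda>t. 2 * ?B t)" by (intro poly_bd_mult poly_bd_const poly_bd_B) auto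
    then show "poly_bd (\<lambda>(B, m, a, d). real m)" by (rule poly_bd_le) (auto simp: \<Omega>_def)
    show "poly_bd (\<lambda>(B, m, a, d). a)" "poly_bd (\<lambda>(B, m, a, d). real d)"
      by (rule poly_bd_le[OF poly_bd_B]; auto simp: \<Omega>_def)+
    have "poly_bd (\<lambda>t. ?B t ^ m0)" by (intro poly_bd_power poly_bd_B)
    then show "poly_bd (\<lambda>(B, m, a, d). R ^ d)" by (rule poly_bd_le) (use R in \<open>auto simp: \<Omega>_def\<close>)
  qed
  have pE: "poly_bd E"
    using poly_bd_mult[OF poly_bd_mult[OF poly_bd_mult[OF proj(1,2)] proj(4)] proj(3)]
    by (simp add: E_def case_prod_unfold)
  have p\<mu>: "poly_bd \<mu>" unfolding \<mu>_def [abs_def]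
    using pE C by (intro poly_bd_mult poly_bd_add poly_bd_power poly_bd_const) auto
  have pk: "poly_bd (\<lambda>t. real (k t))"
  proof -
    have "poly_bd (\<lambda>t. real (nat \<lceil>2 * \<mu> t * length qs\<rceil>) + 1)"
      using p\<mu> by (intro poly_bd_add poly_bd_of_nat_ceiling poly_bd_mult poly_bd_const) auto
    then show ?thesis by (simp add: k_def [abs_def] add.commute)
  qed
  have pk2: "poly_bd (\<lambda>t. real (2 * k t + 1))"
  proof -
    have "poly_bd (\<lambda>t. 2 * real (k t) + 1)"
      using pk by (intro poly_bd_add poly_bd_mult poly_bd_const) auto
    then show ?thesis by (simp add: add.commute)
  qed
  have pD: "poly_bd (\<lambda>t. real (D t))"
  proof -
    have "poly_bd (\<lambda>t. (case t of (B, m, a, d) \<Rightarrow> real d) + real (2 * k t + 1) * real G)"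
      using pk2 proj by (intro poly_bd_add poly_bd_mult poly_bd_const) auto
    moreover have "(case t of (B, m, a, d) \<Rightarrow> real d) + real (2 * k t + 1) * real G = real (D t)" for t
      by (simp add: D_def algebra_simps split: prod.split)
    ultimately show ?thesis by simp
  qed
  have eH: "exp_bd H" unfolding H_def [abs_def]
    using exp_bd_add[OF exp_bd_poly[OF proj(2)] exp_bd_mult[OF exp_bd_poly[OF p\<mu>]
        exp_bd_mult[OF exp_bd_poly[OF poly_bd_const] exp_bd_power[OF \<gamma> pk2]]], of "real (length qs)"]
    by simp
  have "exp_bd (\<lambda>t. 2 * (case t of (B, m, a, d) \<Rightarrow> real m) * (H t * ((3 * R) ^ D t * real (D t) ^ 2)))"
    using R by (intro exp_bd_mult[OF exp_bd_mult[OF exp_bd_poly[OF poly_bd_const] exp_bd_poly[OF proj(1)]]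
        exp_bd_mult[OF eH exp_bd_mult[OF exp_bd_power[OF _ pD] exp_bd_poly[OF poly_bd_power[OF pD]]]]]) auto
  then have eQ: "exp_bd Q"
    by (simp add: Q_def [abs_def] case_prod_unfold)
  have eN: "exp_bd (\<lambda>t. real (N t))"
  proof -
    have "exp_bd (\<lambda>t. real (nat \<lceil>Q t\<rceil>) + real (D t) + 1)"
      by (intro exp_bd_add[OF exp_bd_add[OF exp_bd_of_nat_ceiling[OF eQ] exp_bd_poly[OF pD]]
          exp_bd_poly[OF poly_bd_const]]) simp
    then show ?thesis by (simp add: N_def [abs_def] add.commute)
  qed
  have "exp_bd (\<lambda>t. 2 + 2 * real n * real (N t) + real T + real (D t))"
    by (intro exp_bd_add[OF exp_bd_add[OF exp_bd_add[OF exp_bd_poly[OF poly_bd_const]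
        exp_bd_mult[OF exp_bd_poly[OF poly_bd_const] eN]] exp_bd_poly[OF poly_bd_const]] exp_bd_poly[OF pD]]) auto
  moreover have "real (Tm t) = 2 + 2 * real n * real (N t) + real T + real (D t)" for t
    by (simp add: Tm_def)
  ultimately have "exp_bd (\<lambda>t. real (Tm t))" by (simp only:)
  then obtain e where e: "\<And>t. t \<in> \<Omega> \<Longrightarrow> real (Tm t) \<le> exp (?B t ^ e)"
    using exp_bdD by blast
  show ?thesis
    unfolding representable_def
  proof (rule exI[of _ e], intro allI impI)
    fix B a :: real and m d :: nat and A and Y :: "nat \<Rightarrow> mpoly" and V
    assume *: "B \<ge> 3 / 2" "1 \<le> a" "a \<le> B" "1 \<le> m" "real m \<le> 2 * B" "1 \<le> d" "real d \<le> B" "R ^ d \<le> B ^ m0"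
      and A: "\<forall>i<m. \<forall>j<m. A i j \<in> polys {..<n} d \<and> l1 (A i j) \<le> a"
      and pos: "\<forall>x (w :: nat \<Rightarrow> real). inS qs x \<longrightarrow> form_at m A x w \<ge> (\<Sum>i<m. (w i)\<^sup>2)"
      and Y: "\<forall>i<m. Y i \<in> polys V 1" and V: "{..<n} \<subseteq> V"
    define t where "t = (B, m, a, d)"
    have t: "t \<in> \<Omega>" using * by (simp add: t_def \<Omega>_def)
    have "form m A Y \<in> qmd V qs (2 + 2 * n * N t + T + D t)"
    proof (rule representation[where a = a and d = d and E = "E t" and \<mu> = "\<mu> t" and k = "k t" and H = "H t"])
      show "real (k t) \<ge> 2 * \<mu> t * length qs" unfolding k_def by linarith
      show "H t = a + \<mu> t * (length qs * \<gamma> ^ (2 * k t + 1))" by (simp add: H_def t_def)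
      show "real (N t) \<ge> 2 * real m * (H t * ((3 * R) ^ D t * real (D t) ^ 2))"
      proof -
        have "Q t = 2 * real m * (H t * ((3 * R) ^ D t * real (D t) ^ 2))" by (simp add: Q_def t_def)
        moreover have "real (N t) \<ge> Q t" unfolding N_def by linarith
        ultimately show ?thesis by simp
      qed
    qed (use * A pos Y V in \<open>auto simp: E_def t_def \<mu>_def k_def D_def N_def\<close>)
    then show "\<exists>T'. form m A Y \<in> qmd V qs T' \<and> real T' \<le> exp (B ^ e)"
      using e[OF t] by (intro exI[of _ "Tm t"]) (simp add: Tm_def t_def)
  qed
qed

end

section \<open>Rescaling the generators\<close>

text \<open>The factor 1/c moves into the multiplier. The degree bound concerns the products, which
  do not change.\<close>

lemma qmd_scale:
  assumes "c > 0" "p \<in> qmd V gs T" shows "p \<in> qmd V (map (\<lambda>g. mconst c * g) gs) T"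
proof -
  obtain \<sigma>0 \<sigma> where *: "sos_in V \<sigma>0" "mdeg \<sigma>0 \<le> T" "\<forall>i<length gs. sos_in V (\<sigma> i)"
    "\<forall>i<length gs. mdeg (\<sigma> i * gs ! i) \<le> T" "p = \<sigma>0 + (\<Sum>i<length gs. \<sigma> i * gs ! i)"
    using assms(2) by (rule qmdE)
  have "mconst (1 / c) * mconst c = 1" using assms(1) by (simp add: mconst_hom(2,4)[symmetric])
  then have eq: "(mconst (1 / c) * \<sigma> i) * (mconst c * g) = \<sigma> i * g" for i g
  proof -
    have "(mconst (1 / c) * \<sigma> i) * (mconst c * g) = (mconst (1 / c) * mconst c) * (\<sigma> i * g)"
      by (simp only: mult_ac)
    then show ?thesis by (simp add: \<open>mconst (1 / c) * mconst c = 1\<close>)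
  qed
  show ?thesis
  proof (rule qmdI[of V \<sigma>0 T _ "\<lambda>i. mconst (1 / c) * \<sigma> i"])
    fix i assume i: "i < length (map (\<lambda>g. mconst c * g) gs)"
    show "sos_in V (mconst (1 / c) * \<sigma> i)" using * i assms by (intro sos_mult sos_mconst) auto
    show "mdeg (mconst (1 / c) * \<sigma> i * map (\<lambda>g. mconst c * g) gs ! i) \<le> T"
      using * i by (simp add: eq)
  qed (use * in \<open>simp_all add: eq\<close>)
qed

lemma qmd_unscale:
  assumes "c > 0" "p \<in> qmd V (map (\<lambda>g. mconst c * g) gs) T" shows "p \<in> qmd V gs T"
proof -
  have "p \<in> qmd V (map (\<lambda>g. mconst (1 / c) * g) (map (\<lambda>g. mconst c * g) gs)) T"
    by (rule qmd_scale[OF _ assms(2)]) (use assms(1) in simp)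
  moreover have "mconst (1 / c) * (mconst c * g) = g" for g
    using assms(1) by (simp add: mult.assoc[symmetric] mconst_hom(2,4)[symmetric])
  then have "map (\<lambda>g. mconst (1 / c) * g) (map (\<lambda>g. mconst c * g) gs) = gs"
    unfolding map_map o_def by (intro map_idI) simp
  ultimately show ?thesis by simp
qed

lemma member_le_sum_list_nonneg:
  fixes f :: "'a \<Rightarrow> real"
  assumes "\<And>y. 0 \<le> f y" "x \<in> set xs" shows "f x \<le> (\<Sum>y\<leftarrow>xs. f y)"
  using assms(2)
proof (induction xs)
  case (Cons a xs)
  have "0 \<le> (\<Sum>y\<leftarrow>xs. f y)" using assms(1) by (intro sum_list_nonneg) auto
  then show ?case using Cons assms(1)[of a] by (cases "x = a") auto
qed simp

text \<open>The radius R comes first, from the original generators; then one common factor makes all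
  generators at most 1 on that box without altering S or the truncated modules.\<close>

lemma normalized_exists:
  assumes gvars: "\<forall>g\<in>set gs. mvars g \<subseteq> {..<n}"
    and Sbox: "\<forall>x. inS gs x \<longrightarrow> (\<forall>i<n. \<bar>x i\<bar> < 1)"
    and arch: "archimedean_qm n gs"
  shows "\<exists>c>0. \<exists>R C L T G \<gamma>. normalized n (map (\<lambda>g. mconst c * g) gs) R C L T G \<gamma>"
proof -
  obtain R :: real and T where R: "R \<ge> 1" and T: "\<And>J J'. J \<subseteq> {..<n} \<Longrightarrow> J' \<subseteq> {..<n} \<Longrightarrow>
      prod (box_u R) J * prod (box_v R) J' \<in> qmd {..<n} gs T"
    using archimedean_box[OF arch, of 1] by meson
  \<comment> \<open>Exceeds the supremum of every |g| on the box; the summand 1 keeps it positive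
    even for an empty list.\<close>
  define K where "K = 1 + (\<Sum>g\<leftarrow>gs. l1 g * R ^ mdeg g)"
  define c where "c = 1 / K"
  have nn: "l1 g * R ^ mdeg g \<ge> 0" for g using R by simp
  have "(\<Sum>g\<leftarrow>gs. l1 g * R ^ mdeg g) \<ge> 0" using nn by (intro sum_list_nonneg) auto
  then have K: "K \<ge> 1" by (simp add: K_def)
  then have c: "c > 0" by (simp add: c_def)
  define qs where "qs = map (\<lambda>g. mconst c * g) gs"
  have inS: "inS qs x \<longleftrightarrow> inS gs x" for x
    using c by (simp add: inS_def qs_def meval_mult zero_le_mult_iff)
  define G where "G = (\<Sum>g\<leftarrow>gs. mdeg g)"
  have gp: "g \<in> polys {..<n} G" if "g \<in> set gs" for g
    using gvars that by (auto simp: polys_def G_def intro: member_le_sum_list)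
  have qp: "q \<in> polys {..<n} G" if "q \<in> set qs" for q
    using that gp by (auto simp: qs_def intro: polys_mult_const)
  have qle1: "\<bar>meval q x\<bar> \<le> 1" if q: "q \<in> set qs" and x: "\<And>i. i < n \<Longrightarrow> \<bar>x i\<bar> \<le> R" for q x
  proof -
    obtain g where g: "g \<in> set gs" "q = mconst c * g" using q by (auto simp: qs_def)
    have "\<bar>meval g x\<bar> \<le> l1 g * R ^ mdeg g"
      using gvars g R x by (intro meval_bound[of g "{..<n}"]) (auto simp: polys_def)
    also have "\<dots> \<le> (\<Sum>g\<leftarrow>gs. l1 g * R ^ mdeg g)"
      using nn g(1) by (rule member_le_sum_list_nonneg)
    also have "\<dots> \<le> K" by (simp add: K_def)
    finally show ?thesis using K by (simp add: g meval_mult c_def abs_mult)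
  qed
  obtain L C where C: "C \<ge> 1" and loj: "\<forall>x \<epsilon>. (\<forall>i<n. \<bar>x i\<bar> \<le> R) \<longrightarrow> 0 < \<epsilon> \<longrightarrow> \<epsilon> \<le> 1 \<longrightarrow>
    (\<forall>g\<in>set qs. meval g x \<ge> - (\<epsilon> ^ L / C)) \<longrightarrow> (\<exists>s. inS qs s \<and> (\<forall>i<n. \<bar>x i - s i\<bar> \<le> \<epsilon>))"
    using lojasiewicz[of qs n R, OF mvars_polys[OF qp]] by blast
  define \<gamma> where "\<gamma> = 1 + (\<Sum>q\<leftarrow>qs. l1 q)"
  have "normalized n qs R C L T G \<gamma>"
  proof unfold_locales
    show "R \<ge> 1" "C \<ge> 1" by fact+
    have "(\<Sum>q\<leftarrow>qs. l1 q) \<ge> 0" by (intro sum_list_nonneg) auto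
    then show "\<gamma> \<ge> 1" by (simp add: \<gamma>_def)
    show "\<bar>x i\<bar> \<le> R" if "inS qs x" "i < n" for x i
    proof -
      have "\<bar>x i\<bar> < 1" using Sbox that inS by blast
      then show ?thesis using R by linarith
    qed
    show "1 + l1 q \<le> \<gamma>" if "q \<in> set qs" for q
      using member_le_sum_list_nonneg[OF l1_nonneg that] by (simp add: \<gamma>_def)
    show "prod (box_u R) J * prod (box_v R) J' \<in> qmd {..<n} qs T" if "J \<subseteq> {..<n}" "J' \<subseteq> {..<n}" for J J'
      unfolding qs_def using c T[OF that] by (rule qmd_scale)
    show "\<exists>s. inS qs s \<and> (\<forall>i<n. \<bar>x i - s i\<bar> \<le> \<epsilon>)"
      if "\<And>i. i < n \<Longrightarrow> \<bar>x i\<bar> \<le> R" "0 < \<epsilon>" "\<epsilon> \<le> 1" "\<And>q. q \<in> set qs \<Longrightarrow> meval q x \<ge> - (\<epsilon> ^ L / C)" for x \<epsilon>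
      by (rule loj[rule_format]) (use that in auto)
    show "\<bar>meval q x\<bar> \<le> 1" if "q \<in> set qs" "\<And>i. i < n \<Longrightarrow> \<bar>x i\<bar> \<le> R" for q x
      using that by (rule qle1)
    show "q \<in> polys {..<n} G" if "q \<in> set qs" for q
      using that by (rule qp)
  qed
  then show ?thesis using c unfolding qs_def by blast
qed

section \<open>The coefficient matrix of a polynomial quadratic in Y\<close>

text \<open>The multinomial theorem with all variables equal to 1, as an inequality because F may
  omit exponents. Splitting off the last exponent factors the multinomial into a binomial and a
  multinomial in one variable less.\<close>

lemma sum_xmultinom_homogeneous:
  assumes "finite F" "\<And>\<beta>. \<beta> \<in> F \<Longrightarrow> keys \<beta> \<subseteq> {..<n} \<and> mon_deg_in UNIV \<beta> = k"
  shows "(\<Sum>\<beta>\<in>F. xmultinom n \<beta>) \<le> real n ^ k"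
  using assms
proof (induction n arbitrary: F k)
  case 0
  then have F: "F \<subseteq> {0}" by auto
  show ?case
  proof (cases "F = {}")
    case False
    then have "F = {0}" using F by auto
    then show ?thesis using 0 by (simp add: xmultinom_def)
  qed simp
next
  case (Suc n)
  define r where "r \<beta> = \<beta> - single n (lookup \<beta> n)" for \<beta> :: "nat \<Rightarrow>\<^sub>0 nat"
  have lr: "lookup (r \<beta>) i = (if i = n then 0 else lookup \<beta> i)" for \<beta> i
    by (simp add: r_def lookup_minus lookup_single when_def)
  have \<beta>r: "\<beta> = r \<beta> + single n (lookup \<beta> n)" for \<beta>
    by (rule poly_mapping_eqI) (simp add: lookup_add lr lookup_single when_def)
  have kr: "keys (r \<beta>) \<subseteq> {..<n}" if "\<beta> \<in> F" for \<beta>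
    using Suc.prems(2)[OF that] by (auto simp: in_keys_iff lr subset_iff less_Suc_eq split: if_splits)
  have dr: "mon_deg_in UNIV (r \<beta>) + lookup \<beta> n = k" if "\<beta> \<in> F" for \<beta>
    using Suc.prems(2)[OF that] mon_deg_add[of UNIV "r \<beta>" "single n (lookup \<beta> n)"] \<beta>r[of \<beta>] by simp
  have le: "lookup \<beta> n \<le> k" if "\<beta> \<in> F" for \<beta>
    using dr[OF that] by simp
  have xm: "xmultinom (Suc n) \<beta> = xmultinom n (r \<beta>) * real (k choose lookup \<beta> n)" if "\<beta> \<in> F" for \<beta>
  proof -
    have s: "(\<Sum>i<n. lookup (r \<beta>) i) + lookup \<beta> n = k"
      using dr[OF that] kr[OF that] by (simp add: mon_deg_superset[of "{..<n}"])
    have le: "lookup \<beta> n \<le> k" "k - lookup \<beta> n = (\<Sum>i<n. lookup (r \<beta>) i)" using s by auto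
    have "(\<Sum>i<n. lookup \<beta> i) = (\<Sum>i<n. lookup (r \<beta>) i)"
      "(\<Prod>i<n. fact (lookup \<beta> i) :: real) = (\<Prod>i<n. fact (lookup (r \<beta>) i))"
      by (auto intro!: sum.cong prod.cong simp: lr)
    then show ?thesis
      using s by (simp add: xmultinom_def binomial_fact[OF le(1)] le(2) field_simps)
  qed
  have "(\<Sum>\<beta>\<in>F. xmultinom (Suc n) \<beta>)
      = (\<Sum>a\<le>k. \<Sum>\<beta>\<in>{\<beta>\<in>F. lookup \<beta> n = a}. xmultinom (Suc n) \<beta>)"
    using Suc.prems(1) le by (intro sum.group[symmetric]) auto
  also have "\<dots> = (\<Sum>a\<le>k. real (k choose a) * (\<Sum>\<beta>\<in>{\<beta>\<in>F. lookup \<beta> n = a}. xmultinom n (r \<beta>)))"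
    by (intro sum.cong refl) (auto simp: sum_distrib_left xm intro!: sum.cong)
  also have "\<dots> \<le> (\<Sum>a\<le>k. real (k choose a) * real n ^ (k - a))"
  proof (intro sum_mono mult_left_mono)
    fix a assume "a \<in> {..k}"
    have "inj_on r {\<beta>\<in>F. lookup \<beta> n = a}"
      by (rule inj_onI) (metis (mono_tags, lifting) \<beta>r mem_Collect_eq)
    then have "(\<Sum>\<beta>\<in>{\<beta>\<in>F. lookup \<beta> n = a}. xmultinom n (r \<beta>)) = (\<Sum>\<beta>\<in>r ` {\<beta>\<in>F. lookup \<beta> n = a}. xmultinom n \<beta>)"
      by (simp add: sum.reindex)
    also have "\<dots> \<le> real n ^ (k - a)"
      using Suc.prems(1) kr dr by (intro Suc.IH) force+
    finally show "(\<Sum>\<beta>\<in>{\<beta>\<in>F. lookup \<beta> n = a}. xmultinom n (r \<beta>)) \<le> real n ^ (k - a)" .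
  qed auto
  also have "\<dots> = (1 + real n) ^ k" using binomial_ring[of 1 "real n" k] by simp
  finally show ?case by (simp add: add.commute)
qed

text \<open>There are d + 1 homogeneous levels, each contributing at most n^d; the factor d + 1 is
  later absorbed by d^2 3^d.\<close>

lemma sum_xmultinom:
  assumes "finite F" "n > 0" "\<And>\<beta>. \<beta> \<in> F \<Longrightarrow> keys \<beta> \<subseteq> {..<n} \<and> mon_deg_in UNIV \<beta> \<le> d"
  shows "(\<Sum>\<beta>\<in>F. xmultinom n \<beta>) \<le> real (d + 1) * real n ^ d"
proof -
  have "(\<Sum>\<beta>\<in>F. xmultinom n \<beta>) = (\<Sum>k\<le>d. \<Sum>\<beta>\<in>{\<beta>\<in>F. mon_deg_in UNIV \<beta> = k}. xmultinom n \<beta>)"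
    using assms by (intro sum.group[symmetric]) auto
  also have "\<dots> \<le> (\<Sum>k\<le>d. real n ^ k)"
    using assms by (intro sum_mono sum_xmultinom_homogeneous) auto
  also have "\<dots> \<le> (\<Sum>k\<le>d. real n ^ d)"
    using assms by (intro sum_mono power_increasing) auto
  finally show ?thesis by simp
qed

lemma xmultinom_pos: "xmultinom n mo > 0"
  unfolding xmultinom_def by (intro divide_pos_pos prod_pos) auto

lemma lookup_le_bnorm: "\<bar>lookup f mo\<bar> \<le> bnorm n f * xmultinom n mo"
proof (cases "mo \<in> keys f")
  case True
  then have "\<bar>lookup f mo\<bar> / xmultinom n mo \<le> bnorm n f"
    unfolding bnorm_def by (intro Max_ge) auto
  then show ?thesis using xmultinom_pos[of n mo] by (simp add: divide_le_eq)
next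
  case False
  have "bnorm n f \<ge> 0" unfolding bnorm_def by (intro Max_ge) auto
  then show ?thesis using False xmultinom_pos[of n mo] by (simp add: in_keys_iff)
qed

lemma bnorm_nonneg: "bnorm n f \<ge> 0"
  unfolding bnorm_def by (intro Max_ge) auto

text \<open>Index r stands for the constant 1, the dehomogenized Z. Linear and constant terms in Y
  thus become entries of a matrix of size r + 1.\<close>

definition yexp :: "nat \<Rightarrow> nat \<Rightarrow> nat \<Rightarrow> (nat \<Rightarrow>\<^sub>0 nat)" where
  "yexp n r i = (if i < r then single (n + i) 1 else 0)"

definition yvar :: "nat \<Rightarrow> nat \<Rightarrow> nat \<Rightarrow> mpoly" where
  "yvar n r i = (if i < r then mvar (n + i) else 1)"

lemma yvar_single: "yvar n r i = single (yexp n r i) 1"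
  by (simp add: yvar_def yexp_def mvar_def)

lemma keys_empty: "keys \<beta> = {} \<Longrightarrow> \<beta> = 0"
  by (rule poly_mapping_eqI) (metis empty_iff in_keys_iff lookup_zero)

lemma mon_deg_eq_0: "mon_deg_in UNIV \<beta> = 0 \<Longrightarrow> \<beta> = 0"
proof (rule ccontr)
  assume *: "mon_deg_in UNIV \<beta> = 0" "\<beta> \<noteq> 0"
  then obtain v where v: "v \<in> keys \<beta>" using keys_empty[of \<beta>] by blast
  then have "lookup \<beta> v \<le> mon_deg_in UNIV \<beta>"
    unfolding mon_deg_in_def by (intro member_le_sum) auto
  then show False using * v by (simp add: in_keys_iff)
qed

text \<open>Variables are split off at most twice, and the index r fills the places left when the
  degree is below 2.\<close>

lemma yexp_decomposition:
  assumes "keys \<beta> \<subseteq> {n..<n + r}" "mon_deg_in UNIV \<beta> \<le> 2"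
  shows "\<exists>i\<le>r. \<exists>j\<le>r. \<beta> = yexp n r i + yexp n r j"
proof -
  have split: "\<exists>i<r. \<exists>\<beta>'. \<beta> = yexp n r i + \<beta>' \<and> keys \<beta>' \<subseteq> {n..<n + r} \<and> mon_deg_in UNIV \<beta> = Suc (mon_deg_in UNIV \<beta>')"
    if "\<beta> \<noteq> 0" "keys \<beta> \<subseteq> {n..<n + r}" for \<beta> :: "nat \<Rightarrow>\<^sub>0 nat"
  proof -
    have "keys \<beta> \<noteq> {}" using that(1) keys_empty[of \<beta>] by auto
    then obtain v where v: "v \<in> keys \<beta>" by (metis all_not_in_conv)
    then have "v \<in> {n..<n + r}" using that(2) by blast
    then have vr: "v - n < r" "n + (v - n) = v" by auto
    define \<beta>' where "\<beta>' = \<beta> - single v 1"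
    have "lookup \<beta> v \<ge> 1" using v by (simp add: in_keys_iff)
    then have eq: "\<beta> = yexp n r (v - n) + \<beta>'"
      using vr by (intro poly_mapping_eqI) (auto simp: yexp_def \<beta>'_def lookup_add lookup_minus lookup_single when_def)
    have "keys \<beta>' \<subseteq> keys \<beta>" by (auto simp: \<beta>'_def in_keys_iff lookup_minus)
    then have "keys \<beta>' \<subseteq> {n..<n + r}" using that(2) by (rule order_trans)
    moreover have "mon_deg_in UNIV \<beta> = Suc (mon_deg_in UNIV \<beta>')"
      unfolding arg_cong[OF eq, of "mon_deg_in UNIV"] mon_deg_add using vr(1) by (simp add: yexp_def)
    ultimately show ?thesis using eq vr(1) by (intro exI[of _ "v - n"] conjI exI[of _ \<beta>']) auto
  qed
  have zero: "yexp n r r = 0" by (simp add: yexp_def)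
  show ?thesis
  proof (cases "\<beta> = 0")
    case True
    then show ?thesis using zero by (intro exI[of _ r]) auto
  next
    case False
    then obtain i \<beta>' where i: "i < r" "\<beta> = yexp n r i + \<beta>'" "keys \<beta>' \<subseteq> {n..<n + r}"
      "mon_deg_in UNIV \<beta> = Suc (mon_deg_in UNIV \<beta>')" using split assms by blast
    show ?thesis
    proof (cases "\<beta>' = 0")
      case True
      then show ?thesis using i zero by (intro exI[of _ i] conjI exI[of _ r]) auto
    next
      case False
      then obtain j \<beta>'' where j: "j < r" "\<beta>' = yexp n r j + \<beta>''" "keys \<beta>'' \<subseteq> {n..<n + r}"
        "mon_deg_in UNIV \<beta>' = Suc (mon_deg_in UNIV \<beta>'')" using split i by blast
      then have "mon_deg_in UNIV \<beta>'' = 0" using i assms(2) by simp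
      then have "\<beta>'' = 0" by (rule mon_deg_eq_0)
      then show ?thesis using i j by (intro exI[of _ i] conjI exI[of _ j]) auto
    qed
  qed
qed

lemma monomial_decomposition:
  assumes "keys mo \<subseteq> {..<n + r}" "mon_deg_in (Yvars n r) mo \<le> 2"
  shows "\<exists>\<alpha> i j. keys \<alpha> \<subseteq> {..<n} \<and> i \<le> r \<and> j \<le> r \<and> mo = \<alpha> + (yexp n r i + yexp n r j)"
proof -
  define \<alpha> where "\<alpha> = (\<Sum>v\<in>keys mo \<inter> {..<n}. single v (lookup mo v))"
  define \<beta> where "\<beta> = (\<Sum>v\<in>keys mo \<inter> {n..<n + r}. single v (lookup mo v))"
  have l\<alpha>: "lookup \<alpha> v = (if v < n then lookup mo v else 0)" for v
    by (auto simp: \<alpha>_def lookup_sum lookup_single when_def in_keys_iff)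
  have l\<beta>: "lookup \<beta> v = (if n \<le> v then lookup mo v else 0)" for v
    using assms(1) by (auto simp: \<beta>_def lookup_sum lookup_single when_def in_keys_iff)
  have mo: "mo = \<alpha> + \<beta>"
    by (rule poly_mapping_eqI) (simp add: lookup_add l\<alpha> l\<beta>)
  have k\<alpha>: "keys \<alpha> \<subseteq> {..<n}" by (auto simp: in_keys_iff l\<alpha> split: if_splits)
  have k\<beta>: "keys \<beta> \<subseteq> {n..<n + r}"
    using subsetD[OF assms(1)] by (auto simp: in_keys_iff l\<beta> split: if_splits)
  have "mon_deg_in UNIV \<beta> = mon_deg_in (Yvars n r) mo"
  proof -
    have "mon_deg_in (Yvars n r) \<alpha> = 0" unfolding mon_deg_in_def Yvars_def using k\<alpha> by (intro sum.neutral) auto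
    moreover have "mon_deg_in (Yvars n r) \<beta> = mon_deg_in UNIV \<beta>"
      unfolding mon_deg_in_def Yvars_def using k\<beta> by (intro sum.cong) auto
    ultimately show ?thesis by (simp add: mo mon_deg_add)
  qed
  then obtain i j where "i \<le> r" "j \<le> r" "\<beta> = yexp n r i + yexp n r j"
    using yexp_decomposition[OF k\<beta>] assms(2) by auto
  then show ?thesis using mo k\<alpha> by blast
qed

text \<open>Each x contributes to the single entry (I x, J x).\<close>

lemma sum_matrix_entries:
  fixes F :: "'k \<Rightarrow> nat \<Rightarrow> nat \<Rightarrow> 'a :: comm_monoid_add"
  assumes "\<And>x. x \<in> K \<Longrightarrow> I x < m" "\<And>x. x \<in> K \<Longrightarrow> J x < m"
  shows "(\<Sum>i<m. \<Sum>j<m. \<Sum>x\<in>K. if I x = i \<and> J x = j then F x i j else 0) = (\<Sum>x\<in>K. F x (I x) (J x))"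
proof -
  have "(\<Sum>i<m. \<Sum>j<m. \<Sum>x\<in>K. if I x = i \<and> J x = j then F x i j else 0)
      = (\<Sum>i<m. \<Sum>x\<in>K. \<Sum>j<m. if I x = i \<and> J x = j then F x i j else 0)"
    by (intro sum.cong refl sum.swap)
  also have "\<dots> = (\<Sum>x\<in>K. \<Sum>i<m. \<Sum>j<m. if I x = i \<and> J x = j then F x i j else 0)" by (rule sum.swap)
  also have "\<dots> = (\<Sum>x\<in>K. F x (I x) (J x))"
  proof (rule sum.cong[OF refl])
    fix x assume x: "x \<in> K"
    have "(\<Sum>j<m. if I x = i \<and> J x = j then F x i j else 0) = (if I x = i then F x i (J x) else 0)" for i
      using assms(2)[OF x] by (cases "I x = i") auto
    then show "(\<Sum>i<m. \<Sum>j<m. if I x = i \<and> J x = j then F x i j else 0) = F x (I x) (J x)"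
      using assms(1)[OF x] by simp
  qed
  finally show ?thesis .
qed

text \<open>Every monomial is assigned to just one entry of a possibly asymmetric matrix. The
  coefficients of an entry are then coefficients of f itself, at distinct X-exponents, so the
  multinomial sum bounds the norm of the entry.\<close>

lemma coefficient_matrix:
  assumes vars: "mvars f \<subseteq> {..<n + r}" and degX: "deg_in {..<n} f = d" and degY: "deg_in (Yvars n r) f = 2"
  shows "\<exists>A. (\<forall>i j. A i j \<in> polys {..<n} d) \<and> f = form (Suc r) A (yvar n r) \<and>
    (\<forall>v. meval (homY n r 2 f) v = (\<Sum>i<Suc r. \<Sum>j<Suc r. meval (A i j) v * v (n + i) * v (n + j))) \<and>
    (n > 0 \<longrightarrow> (\<forall>i j. l1 (A i j) \<le> bnorm n f * (real (d + 1) * real n ^ d)))"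
proof -
  have key: "keys mo \<subseteq> {..<n + r}" "mon_deg_in (Yvars n r) mo \<le> 2" "mon_deg_in {..<n} mo \<le> d"
    if "mo \<in> keys f" for mo
    using vars degX degY that deg_in_le_iff[of "{..<n}" f d] deg_in_le_iff[of "Yvars n r" f 2]
    by (auto simp: mvars_def)
  have "\<forall>mo\<in>keys f. \<exists>\<alpha> i j. keys \<alpha> \<subseteq> {..<n} \<and> i \<le> r \<and> j \<le> r \<and> mo = \<alpha> + (yexp n r i + yexp n r j)"
    using key monomial_decomposition by blast
  then obtain \<alpha> I J where dec: "\<And>mo. mo \<in> keys f \<Longrightarrow> keys (\<alpha> mo) \<subseteq> {..<n} \<and> I mo \<le> r \<and> J mo \<le> r \<and>
      mo = \<alpha> mo + (yexp n r (I mo) + yexp n r (J mo))"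
    unfolding bchoice_iff by blast
  have IJ: "I mo < Suc r" "J mo < Suc r" if "mo \<in> keys f" for mo using dec[OF that] by auto
  define A where "A i j = (\<Sum>mo\<in>keys f. if I mo = i \<and> J mo = j then single (\<alpha> mo) (lookup f mo) else 0)" for i j
  have ydeg: "mon_deg_in {..<n} (yexp n r i) = 0" "mon_deg_in (Yvars n r) (yexp n r i) = (if i < r then 1 else 0)" for i
    by (auto simp: yexp_def Yvars_def)
  have deg\<alpha>: "mon_deg_in UNIV (\<alpha> mo) \<le> d" if "mo \<in> keys f" for mo
  proof -
    have "mon_deg_in {..<n} mo = mon_deg_in {..<n} (\<alpha> mo)"
      by (subst conjunct2[OF conjunct2[OF conjunct2[OF dec[OF that]]]]) (simp add: mon_deg_add ydeg)
    moreover have "mon_deg_in {..<n} (\<alpha> mo) = mon_deg_in UNIV (\<alpha> mo)"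
      unfolding mon_deg_in_def using dec[OF that] by (intro sum.cong) auto
    ultimately show ?thesis using key(3)[OF that] by simp
  qed
  have "A i j \<in> polys {..<n} d" for i j
    unfolding A_def using dec deg\<alpha> by (intro polys_sum) (auto simp: polys_iff split: if_splits)
  moreover have "f = form (Suc r) A (yvar n r)"
  proof -
    have "A i j * (yvar n r i * yvar n r j) = (\<Sum>mo\<in>keys f. if I mo = i \<and> J mo = j then
        single (\<alpha> mo + (yexp n r i + yexp n r j)) (lookup f mo) else 0)" for i j
      unfolding A_def sum_distrib_right
      by (intro sum.cong refl) (simp add: yvar_single mult_single)
    then have "form (Suc r) A (yvar n r)
        = (\<Sum>mo\<in>keys f. single (\<alpha> mo + (yexp n r (I mo) + yexp n r (J mo))) (lookup f mo))"
      by (simp only: sum_matrix_entries[of "keys f" I "Suc r" J, OF IJ])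
    also have "\<dots> = (\<Sum>mo\<in>keys f. single mo (lookup f mo))"
      using dec by (intro sum.cong refl) auto
    finally show ?thesis using mpoly_sum_singles[of f] by simp
  qed
  moreover have "meval (homY n r 2 f) v = (\<Sum>i<Suc r. \<Sum>j<Suc r. meval (A i j) v * v (n + i) * v (n + j))" for v
  proof -
    have yv: "mon v (yexp n r i) = (if i < r then v (n + i) else 1)" for i by (simp add: yexp_def)
    have "meval (A i j) v * v (n + i) * v (n + j) = (\<Sum>mo\<in>keys f. if I mo = i \<and> J mo = j then
        lookup f mo * mon v (\<alpha> mo) * v (n + i) * v (n + j) else 0)" for i j
      unfolding A_def meval_sum sum_distrib_right
      by (intro sum.cong refl) simp
    then have "(\<Sum>i<Suc r. \<Sum>j<Suc r. meval (A i j) v * v (n + i) * v (n + j))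
        = (\<Sum>mo\<in>keys f. lookup f mo * mon v (\<alpha> mo) * v (n + I mo) * v (n + J mo))"
      by (simp only: sum_matrix_entries[of "keys f" I "Suc r" J, OF IJ])
    also have "\<dots> = (\<Sum>mo\<in>keys f. lookup f mo * mon v mo * v (n + r) ^ (2 - mon_deg_in (Yvars n r) mo))"
    proof (rule sum.cong[OF refl])
      fix mo assume mo: "mo \<in> keys f"
      obtain i j where ij: "I mo = i" "J mo = j" by blast
      have d: "mo = \<alpha> mo + (yexp n r i + yexp n r j)" "i \<le> r" "j \<le> r" "keys (\<alpha> mo) \<subseteq> {..<n}"
        using dec[OF mo] ij by auto
      have "mon_deg_in (Yvars n r) (\<alpha> mo) = 0"
        unfolding mon_deg_in_def Yvars_def using d(4) by (intro sum.neutral) auto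
      then have yd: "mon_deg_in (Yvars n r) mo = (if i < r then 1 else 0) + (if j < r then 1 else 0)"
        by (subst d(1)) (simp add: mon_deg_add ydeg)
      have mm: "mon v mo = mon v (\<alpha> mo) * ((if i < r then v (n + i) else 1) * (if j < r then v (n + j) else 1))"
        by (subst d(1)) (simp add: mon_add yv)
      \<comment> \<open>Each index equal to r contributes one factor Z, matching the exponent 2
        minus the Y-degree in the homogenization.\<close>
      have "i < r \<or> i = r" "j < r \<or> j = r" using d by auto
      then show "lookup f mo * mon v (\<alpha> mo) * v (n + I mo) * v (n + J mo)
          = lookup f mo * mon v mo * v (n + r) ^ (2 - mon_deg_in (Yvars n r) mo)"
        unfolding ij yd mm by (auto simp: power2_eq_square)
    qed
    also have "\<dots> = meval (homY n r 2 f) v"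
      by (simp add: homY_def meval_sum meval_mult meval_power mmonom_def)
    finally show ?thesis by simp
  qed
  moreover have "l1 (A i j) \<le> bnorm n f * (real (d + 1) * real n ^ d)" if n: "n > 0" for i j
  proof -
    \<comment> \<open>Within one entry the Y-part is fixed, so a monomial is determined by its
      X-part and \<open>\<alpha>\<close> is injective on K.\<close>
    define K where "K = {mo\<in>keys f. I mo = i \<and> J mo = j}"
    have Kf: "finite K" "K \<subseteq> keys f" by (auto simp: K_def)
    have A: "A i j = (\<Sum>mo\<in>K. single (\<alpha> mo) (lookup f mo))"
      unfolding A_def K_def by (rule sum.inter_filter[symmetric]) simp
    have Kd: "mo = \<alpha> mo + (yexp n r i + yexp n r j)" if "mo \<in> K" for mo
    proof -
      have "mo \<in> keys f" "I mo = i" "J mo = j" using that by (auto simp: K_def)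
      then show ?thesis using dec[of mo] by metis
    qed
    have xm: "xmultinom n mo = xmultinom n (\<alpha> mo)" if "mo \<in> K" for mo
    proof -
      note eq = Kd[OF that]
      have "lookup mo v = lookup (\<alpha> mo) v" if "v < n" for v
        using that by (subst eq) (simp add: lookup_add yexp_def lookup_single when_def)
      then show ?thesis by (simp add: xmultinom_def)
    qed
    have "inj_on \<alpha> K"
    proof (rule inj_onI)
      fix x y assume xy: "x \<in> K" "y \<in> K" "\<alpha> x = \<alpha> y"
      then show "x = y" using Kd[OF xy(1)] Kd[OF xy(2)] by metis
    qed
    have "l1 (A i j) \<le> (\<Sum>mo\<in>K. \<bar>lookup f mo\<bar>)"
      unfolding A using l1_sum[of "\<lambda>mo. single (\<alpha> mo) (lookup f mo)" K] by simp
    also have "\<dots> \<le> (\<Sum>mo\<in>K. bnorm n f * xmultinom n (\<alpha> mo))"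
      using lookup_le_bnorm[of f _ n] xm by (intro sum_mono) metis
    also have "\<dots> = bnorm n f * (\<Sum>\<beta>\<in>\<alpha> ` K. xmultinom n \<beta>)"
      using \<open>inj_on \<alpha> K\<close> by (simp add: sum.reindex sum_distrib_left)
    also have "\<dots> \<le> bnorm n f * (real (d + 1) * real n ^ d)"
      using Kf n dec deg\<alpha> bnorm_nonneg[of n f] by (intro mult_left_mono sum_xmultinom) auto
    finally show ?thesis .
  qed
  ultimately show ?thesis by blast
qed

lemma polys_degree_0:
  assumes "p \<in> polys V 0" shows "p = mconst (meval p x)"
proof -
  have "keys p \<subseteq> {0}" using assms mon_deg_eq_0 by (auto simp: polys_iff)
  then have "p = mconst (lookup p 0)"
    by (intro poly_mapping_eqI) (auto simp: mconst_def lookup_single when_def in_keys_iff)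
  then show ?thesis by (metis meval_mconst)
qed

lemma yvar_polys: "i < Suc r \<Longrightarrow> yvar n r i \<in> polys {..<n + r} 1"
  unfolding yvar_def by (simp del: One_nat_def add: polys_mvar)

text \<open>The homogenization is a quadratic form in the coordinates n, ..., n + r. Scaling w to
  the unit sphere and placing it there, after x, turns the minimum over the sphere into an
  eigenvalue bound.\<close>

lemma matrix_positive:
  assumes gvars: "\<forall>g\<in>set gs. mvars g \<subseteq> {..<n}"
    and A: "\<And>i j. mvars (A i j) \<subseteq> {..<n}"
    and hom: "\<And>v. meval (homY n r 2 f) v = (\<Sum>i<Suc r. \<Sum>j<Suc r. meval (A i j) v * v (n + i) * v (n + j))"
    and min: "\<forall>v. inS gs v \<and> (\<Sum>i\<in>Yvars n r. (v i)\<^sup>2) + (v (n + r))\<^sup>2 = 1 \<longrightarrow> fstar \<le> meval (homY n r 2 f) v"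
    and x: "inS gs x"
  shows "fstar * (\<Sum>i<Suc r. (w i)\<^sup>2) \<le> form_at (Suc r) A x w"
proof -
  define W where "W = (\<Sum>i<Suc r. (w i)\<^sup>2)"
  have W0: "W \<ge> 0" unfolding W_def by (intro sum_nonneg) auto
  show ?thesis
  proof (cases "W = 0")
    case True
    then have "w i = 0" if "i < Suc r" for i
      using that unfolding W_def by (subst (asm) sum_nonneg_eq_0_iff) auto
    then show ?thesis by simp
  next
    case False
    then have W: "W > 0" using W0 by simp
    define s where "s = sqrt W"
    have s: "s > 0" "s\<^sup>2 = W" using W by (auto simp: s_def)
    define v where "v k = (if k < n then x k else w (k - n) / s)" for k
    have xv: "meval p v = meval p x" if "mvars p \<subseteq> {..<n}" for p
      using that by (rule meval_cong) (simp add: v_def)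
    have "inS gs v" using x gvars by (simp add: inS_def xv)
    moreover have "(\<Sum>i\<in>Yvars n r. (v i)\<^sup>2) + (v (n + r))\<^sup>2 = 1"
    proof -
      have "(\<Sum>i\<in>Yvars n r. (v i)\<^sup>2) = (\<Sum>i<r. (v (n + i))\<^sup>2)"
        unfolding Yvars_def using sum.atLeastLessThan_shift_0[of "\<lambda>i. (v i)\<^sup>2" n "n + r"]
        by (simp add: atLeast0LessThan)
      then have "(\<Sum>i\<in>Yvars n r. (v i)\<^sup>2) + (v (n + r))\<^sup>2 = (\<Sum>i<Suc r. (v (n + i))\<^sup>2)" by simp
      also have "\<dots> = W / s\<^sup>2"
        unfolding W_def sum_divide_distrib by (intro sum.cong refl) (simp add: v_def power_divide)
      finally show ?thesis using s W by simp
    qed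
    ultimately have "fstar \<le> meval (homY n r 2 f) v" using min by blast
    also have "\<dots> = form_at (Suc r) A x w / W"
      unfolding hom sum_divide_distrib s(2)[symmetric] power2_eq_square
      by (intro sum.cong refl) (simp add: xv[OF A] v_def)
    finally show ?thesis using W by (simp add: W_def pos_le_divide_eq)
  qed
qed

text \<open>What is needed for B to dominate d and, through (3/2)^d, also \<open>R ^ d\<close>. The
  first and third estimates are equalities at d = 1, whence the lower bound 3/2 for B.\<close>

lemma pow3_bounds:
  assumes "d \<ge> 1"
  shows "3 ^ d / 2 \<le> real d ^ 2 * 3 ^ d / real (d + 1)" "real d \<le> 3 ^ d / 2" "(3 / 2) ^ d \<le> (3 :: real) ^ d / 2"
proof -
  have "real (d + 1) \<le> 2 * real d ^ 2"
  proof -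
    have "1 * real d \<le> real d * real d" using assms by (intro mult_right_mono) auto
    moreover have "1 \<le> real d" using assms by simp
    ultimately have "real (d + 1) \<le> 2 * (real d * real d)" by linarith
    then show ?thesis by (simp only: power2_eq_square)
  qed
  then have "3 ^ d * real (d + 1) \<le> 3 ^ d * (2 * real d ^ 2)" by (intro mult_left_mono) auto
  then show "3 ^ d / 2 \<le> real d ^ 2 * 3 ^ d / real (d + 1)" by (simp add: field_simps)
  show "real d \<le> 3 ^ d / 2" "(3 / 2) ^ d \<le> (3 :: real) ^ d / 2"
    using assms by (induction d rule: dec_induct) (auto simp: field_simps)
qed

theorem theorem4:
  fixes n :: nat and gs :: "mpoly list"
  assumes gvars: "\<forall>g\<in>set gs. mvars g \<subseteq> {..<n}"
    and Snonempty: "\<exists>x. inS gs x"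
    and Sbox: "\<forall>x. inS gs x \<longrightarrow> (\<forall>i<n. \<bar>x i\<bar> < 1)"
    and arch: "archimedean_qm n gs"
  shows "\<exists>c::real. c > 0 \<and>
    (\<forall>(r::nat) (f::mpoly) (d::nat) (fstar::real).
      mvars f \<subseteq> {..<n + r}
      \<and> (\<forall>v. inS gs v \<longrightarrow> meval f v > 0)
      \<and> deg_in {..<n} f = d
      \<and> deg_in (Yvars n r) f = 2
      \<and> (\<forall>v. inS gs v \<and> (\<exists>i\<in>Yvars n r. v i \<noteq> 0) \<longrightarrow> meval (topY n r 2 f) v > 0)
      \<and> (\<exists>v. inS gs v \<and> (\<Sum>i\<in>Yvars n r. (v i)\<^sup>2) + (v (n + r))\<^sup>2 = 1
             \<and> meval (homY n r 2 f) v = fstar)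
      \<and> (\<forall>v. inS gs v \<and> (\<Sum>i\<in>Yvars n r. (v i)\<^sup>2) + (v (n + r))\<^sup>2 = 1
             \<longrightarrow> fstar \<le> meval (homY n r 2 f) v)
      \<and> fstar > 0
      \<longrightarrow> (\<exists>\<sigma>0 \<sigma>s. length \<sigma>s = length gs
            \<and> sos_in {..<n + r} \<sigma>0 \<and> (\<forall>\<sigma>\<in>set \<sigma>s. sos_in {..<n + r} \<sigma>)
            \<and> f = \<sigma>0 + sum_list (map (\<lambda>(\<sigma>, g). \<sigma> * g) (zip \<sigma>s gs))
            \<and> real (mdeg \<sigma>0) \<le> c * real r ^ 2 *
                 exp ((bnorm n f * real r ^ 2 * real d ^ 2 * (3 * real n) ^ d / fstar) powr c)
            \<and> (\<forall>(\<sigma>, g)\<in>set (zip \<sigma>s gs). real (mdeg (\<sigma> * g)) \<le> c * real r ^ 2 *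
                 exp ((bnorm n f * real r ^ 2 * real d ^ 2 * (3 * real n) ^ d / fstar) powr c))))"
proof -
  obtain c0 R C L T G \<gamma> where c0: "c0 > 0" and norm: "normalized n (map (\<lambda>g. mconst c0 * g) gs) R C L T G \<gamma>"
    using normalized_exists[OF gvars Sbox arch] by blast
  define qs where "qs = map (\<lambda>g. mconst c0 * g) gs"
  interpret normalized n qs R C L T G \<gamma> using norm by (simp add: qs_def)
  have inS: "inS qs x \<longleftrightarrow> inS gs x" for x
    using c0 by (simp add: inS_def qs_def meval_mult zero_le_mult_iff)
  \<comment> \<open>Then R^d <= ((3/2)^d)^m0, and (3/2)^d is at most 3^d / 2, hence at most
    B.\<close>
  obtain m0 where m0: "R < (3 / 2) ^ m0" using real_arch_pow[of "3/2" R] by auto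
  obtain e where e: "\<forall>B m a d A Y V. representable m0 e B m a d A Y V"
    using representation_bound[of m0] by (rule exE)
  obtain x0 where x0: "inS gs x0" using Snonempty by blast
  \<comment> \<open>The part e covers the exponent of B; the part 2 covers the degree 2 of the
    representation when d = 0.\<close>
  define c where "c = real e + 2"
  have c: "c > 0" by (simp add: c_def)
  have main: "\<exists>T'. f \<in> qmd {..<n + r} gs T' \<and> real T' \<le> c * real r ^ 2 *
      exp ((bnorm n f * real r ^ 2 * real d ^ 2 * (3 * real n) ^ d / fstar) powr c)"
    if vars: "mvars f \<subseteq> {..<n + r}" and degX: "deg_in {..<n} f = d" and degY: "deg_in (Yvars n r) f = 2"
      and min: "\<forall>v. inS gs v \<and> (\<Sum>i\<in>Yvars n r. (v i)\<^sup>2) + (v (n + r))\<^sup>2 = 1 \<longrightarrow> fstar \<le> meval (homY n r 2 f) v"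
      and fstar: "fstar > 0" for r f d fstar
  proof -
    have r: "r \<ge> 1"
    proof (rule ccontr)
      assume "\<not> r \<ge> 1"
      then have "deg_in (Yvars n r) f \<le> 0" unfolding deg_in_le_iff by (simp add: Yvars_def mon_deg_in_def)
      then show False using degY by simp
    qed
    have r2: "real r ^ 2 \<ge> 1" using r by (simp add: one_le_power)
    obtain A where A: "\<And>i j. A i j \<in> polys {..<n} d"
      and fA: "f = form (Suc r) A (yvar n r)"
      and hom: "\<And>v. meval (homY n r 2 f) v = (\<Sum>i<Suc r. \<Sum>j<Suc r. meval (A i j) v * v (n + i) * v (n + j))"
      and l1A: "\<And>i j. n > 0 \<Longrightarrow> l1 (A i j) \<le> bnorm n f * (real (d + 1) * real n ^ d)"
      using coefficient_matrix[OF vars degX degY] by blast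
    have pos: "fstar * (\<Sum>i<Suc r. (w i)\<^sup>2) \<le> form_at (Suc r) A x w"
      if "inS gs x" for x and w :: "nat \<Rightarrow> real"
      using matrix_positive[OF gvars mvars_polys[OF A] hom min that] .
    show ?thesis
    proof (cases "d = 0")
      \<comment> \<open>Here the bracket in the exponent is 0, so the bound reduces to
        \<open>c * real r ^ 2\<close>. The matrix is constant, equal to its value at
        \<open>x0\<close>, and f itself is a sum of squares of degree at most 2.\<close>
      case True
      have eq: "A i j = mconst (meval (A i j) x0)" for i j
        using A[of i j] unfolding True by (rule polys_degree_0)
      have psd: "form_at (Suc r) A x0 w \<ge> 0" for w
        using fstar by (intro order_trans[OF _ pos[OF x0]] mult_nonneg_nonneg sum_nonneg) auto
      have "sos_in {..<n + r} (\<Sum>i<Suc r. \<Sum>j<Suc r. mconst (meval (A i j) x0) * (yvar n r i * yvar n r j))"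
        "(\<Sum>i<Suc r. \<Sum>j<Suc r. mconst (meval (A i j) x0) * (yvar n r i * yvar n r j)) \<in> polys {..<n + r} 2"
        using psd_sos[where a = "\<lambda>i j. meval (A i j) x0" and Y = "yvar n r", OF psd yvar_polys]
        by (simp_all only:)
      then have "f \<in> qmd {..<n + r} gs 2"
        unfolding eq[symmetric] fA[symmetric] by (intro qmd_sos mdeg_polys)
      moreover have "real 2 \<le> c * real r ^ 2 * 1"
        using mult_mono[of 2 c 1 "real r ^ 2"] r2 by (simp add: c_def)
      ultimately show ?thesis using True by (intro exI[of _ 2]) simp
    next
      case False
      then have d: "d \<ge> 1" by simp
      have n: "n > 0"
      proof (rule ccontr)
        assume "\<not> n > 0"
        then have "deg_in {..<n} f \<le> 0" unfolding deg_in_le_iff by (simp add: mon_deg_in_def)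
        then show False using degX d by simp
      qed
      define K where "K = bnorm n f * (real (d + 1) * real n ^ d)"
      define a where "a = K / fstar"
      define B where "B = bnorm n f * real r ^ 2 * real d ^ 2 * (3 * real n) ^ d / fstar"
      \<comment> \<open>Testing the form on the last unit vector gives \<open>fstar\<close> <= K,
        hence a >= 1; the point \<open>x0\<close> of S lies in the unit cube, so the norm of the
        entry bounds its value there.\<close>
      have "fstar \<le> meval (A r r) x0"
      proof -
        let ?w = "\<lambda>i. if i = r then 1 else 0 :: real"
        have "(\<Sum>i<Suc r. (?w i)\<^sup>2) = 1" by (simp add: sum.delta)
        moreover have "form_at (Suc r) A x0 ?w = meval (A r r) x0"
          by (simp add: sum.neutral)
        ultimately show ?thesis using pos[OF x0, of ?w] by simp
      qed
      also have "\<dots> \<le> \<bar>meval (A r r) x0\<bar>" by simp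
      also have "\<dots> \<le> l1 (A r r) * 1 ^ d"
        using A assms(3)[rule_format, OF x0] by (intro meval_bound) (auto intro: less_imp_le)
      also have "\<dots> \<le> K" using l1A[OF n] by (simp add: K_def)
      finally have "fstar \<le> K" .
      then have a1: "a \<ge> 1" using fstar by (simp add: a_def)
      \<comment> \<open>The factor left in B after a and r^2 are taken out; it carries the growth
        3^d.\<close>
      define \<phi> where "\<phi> = real d ^ 2 * 3 ^ d / real (d + 1)"
      have \<phi>: "\<phi> \<ge> 3 ^ d / 2" using pow3_bounds(1)[OF d] by (simp add: \<phi>_def)
      have "(3 :: real) ^ 1 \<le> 3 ^ d" using d by (intro power_increasing) auto
      then have \<phi>1: "\<phi> \<ge> 3 / 2" using \<phi> by simp
      have B: "B = a * (real r ^ 2 * \<phi>)"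
      proof -
        define D where "D = real (d + 1)"
        have "D \<noteq> 0" by (simp add: D_def)
        then show ?thesis
          unfolding B_def a_def K_def \<phi>_def D_def[symmetric] power_mult_distrib
          using fstar by (simp add: field_simps)
      qed
      have "1 * (1 * \<phi>) \<le> a * (real r ^ 2 * \<phi>)" using a1 r2 \<phi>1 by (intro mult_mono) auto
      then have B\<phi>: "B \<ge> \<phi>" by (simp add: B)
      have "a * 1 \<le> a * (real r ^ 2 * \<phi>)"
        using a1 mult_mono[of 1 "real r ^ 2" 1 \<phi>] r2 \<phi>1 by (intro mult_left_mono) auto
      then have aB: "a \<le> B" by (simp add: B)
      have "real r ^ 2 * 1 \<le> real r ^ 2 * \<phi>" using \<phi>1 by (intro mult_left_mono) auto
      then have "1 * real r ^ 2 \<le> a * (real r ^ 2 * \<phi>)" using a1 by (intro mult_mono) auto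
      then have "real r ^ 2 \<le> B" unfolding B by linarith
      moreover have "real r * 1 \<le> real r * real r" using r by (intro mult_left_mono) auto
      then have "real r \<le> real r ^ 2" by (simp only: power2_eq_square mult_1_right)
      moreover have "1 \<le> real r" using r by simp
      ultimately have mB: "real (Suc r) \<le> 2 * B" by linarith
      have dB: "real d \<le> B" using pow3_bounds(2)[OF d] \<phi> B\<phi> by linarith
      have RB: "R ^ d \<le> B ^ m0"
      proof -
        have "R ^ d \<le> ((3 / 2) ^ m0) ^ d" using m0 R by (intro power_mono) auto
        also have "\<dots> = ((3 / 2) ^ d) ^ m0" by (simp add: power_mult[symmetric] mult.commute)
        also have "\<dots> \<le> B ^ m0" using pow3_bounds(3)[OF d] \<phi> B\<phi> by (intro power_mono) auto
        finally show ?thesis .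
      qed
      \<comment> \<open>Normalizes the lower bound of the form on S to 1, the hypothesis of the
        uniform degree bound; \<open>fstar\<close> survives only in the norm bound a.\<close>
      define A' where "A' i j = mconst (1 / fstar) * A i j" for i j
      have A': "A' i j \<in> polys {..<n} d" "l1 (A' i j) \<le> a" for i j
      proof -
        show "A' i j \<in> polys {..<n} d" unfolding A'_def by (intro polys_mult_const A)
        have "l1 (A' i j) \<le> 1 / fstar * l1 (A i j)"
          unfolding A'_def using l1_mult[of "mconst (1 / fstar)" "A i j"] fstar by simp
        also have "\<dots> \<le> 1 / fstar * K" using l1A[OF n] fstar unfolding K_def by (intro mult_left_mono) auto
        finally show "l1 (A' i j) \<le> a" by (simp add: a_def)
      qed
      have pos': "form_at (Suc r) A' x w \<ge> (\<Sum>i<Suc r. (w i)\<^sup>2)"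
        if "inS qs x" for x and w :: "nat \<Rightarrow> real"
      proof -
        have "form_at (Suc r) A' x w
            = form_at (Suc r) A x w / fstar"
          unfolding A'_def meval_mult meval_mconst sum_divide_distrib by (intro sum.cong refl) simp
        then show ?thesis
          using pos[of x w] that fstar by (simp add: inS pos_le_divide_eq mult.commute del: sum.lessThan_Suc)
      qed
      have "B \<ge> 3 / 2" using B\<phi> \<phi>1 by linarith
      then have "\<exists>T'. form (Suc r) A' (yvar n r) \<in> qmd {..<n + r} qs T'
          \<and> real T' \<le> exp (B ^ e)"
        using a1 aB mB d dB RB A' pos' yvar_polys
        by (intro e[unfolded representable_def, rule_format, of B a "Suc r" d A' "yvar n r" "{..<n + r}"]) simp_all
      then obtain T' where T': "form (Suc r) A' (yvar n r) \<in> qmd {..<n + r} qs T'"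
        "real T' \<le> exp (B ^ e)"
        by blast
      have inv: "mconst fstar * mconst (1 / fstar) = 1"
        using fstar by (simp add: mconst_hom(4)[symmetric] mconst_hom(2))
      have scale: "mconst fstar * (A' i j * y) = A i j * y" for i j y
      proof -
        have "mconst fstar * (A' i j * y) = (mconst fstar * mconst (1 / fstar)) * (A i j * y)"
          unfolding A'_def by (simp only: mult_ac)
        then show ?thesis by (simp only: inv mult_1)
      qed
      have "f = mconst fstar * form (Suc r) A' (yvar n r)"
        unfolding sum_distrib_left scale by (rule fA)
      then have "f \<in> qmd {..<n + r} qs T'" using qmd_mult_const[OF less_imp_le[OF fstar] T'(1)] by (simp only:)
      then have "f \<in> qmd {..<n + r} gs T'" unfolding qs_def by (rule qmd_unscale[OF c0])
      moreover have "real T' \<le> c * real r ^ 2 * exp (B powr c)"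
      proof -
        have "B ^ e = B powr real e" using B\<phi> \<phi>1 by (simp add: powr_realpow)
        also have "\<dots> \<le> B powr c" using B\<phi> \<phi>1 by (intro powr_mono) (auto simp: c_def)
        finally have "exp (B ^ e) \<le> exp (B powr c)" by simp
        with T'(2) have "real T' \<le> 1 * exp (B powr c)" by linarith
        also have "\<dots> \<le> (c * real r ^ 2) * exp (B powr c)"
          using mult_mono[of 1 c 1 "real r ^ 2"] r2 by (intro mult_right_mono) (auto simp: c_def)
        finally show ?thesis .
      qed
      ultimately show ?thesis unfolding B_def by blast
    qed
  qed
  show ?thesis
  proof (rule exI[of _ c], intro conjI allI impI, rule c, elim conjE)
    fix r f d fstar
    assume *: "mvars f \<subseteq> {..<n + r}" "deg_in {..<n} f = d" "deg_in (Yvars n r) f = 2"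
      "\<forall>v. inS gs v \<and> (\<Sum>i\<in>Yvars n r. (v i)\<^sup>2) + (v (n + r))\<^sup>2 = 1 \<longrightarrow> fstar \<le> meval (homY n r 2 f) v"
      "fstar > 0"
    let ?b = "c * real r ^ 2 * exp ((bnorm n f * real r ^ 2 * real d ^ 2 * (3 * real n) ^ d / fstar) powr c)"
    obtain T' where T': "f \<in> qmd {..<n + r} gs T'" "real T' \<le> ?b" using main[OF *] by blast
    obtain \<sigma>0 \<sigma>s where \<sigma>: "length \<sigma>s = length gs" "sos_in {..<n + r} \<sigma>0" "\<forall>\<sigma>\<in>set \<sigma>s. sos_in {..<n + r} \<sigma>"
      "f = \<sigma>0 + sum_list (map (\<lambda>(\<sigma>, g). \<sigma> * g) (zip \<sigma>s gs))"
      "mdeg \<sigma>0 \<le> T'" "\<forall>(\<sigma>, g)\<in>set (zip \<sigma>s gs). mdeg (\<sigma> * g) \<le> T'"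
      using qmd_lists[OF T'(1)] by blast
    have le: "real k \<le> ?b" if "k \<le> T'" for k using that T'(2) by linarith
    have "real (mdeg \<sigma>0) \<le> ?b" using \<sigma>(5) by (rule le)
    moreover have "\<forall>(\<sigma>, g)\<in>set (zip \<sigma>s gs). real (mdeg (\<sigma> * g)) \<le> ?b"
      using \<sigma>(6) le by auto
    ultimately show "\<exists>\<sigma>0 \<sigma>s. length \<sigma>s = length gs
            \<and> sos_in {..<n + r} \<sigma>0 \<and> (\<forall>\<sigma>\<in>set \<sigma>s. sos_in {..<n + r} \<sigma>)
            \<and> f = \<sigma>0 + sum_list (map (\<lambda>(\<sigma>, g). \<sigma> * g) (zip \<sigma>s gs))
            \<and> real (mdeg \<sigma>0) \<le> ?b \<and> (\<forall>(\<sigma>, g)\<in>set (zip \<sigma>s gs). real (mdeg (\<sigma> * g)) \<le> ?b)"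
      using \<sigma>(1-4) by blast
  qed
qed

end
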